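(* Consider the sparse Bernoulli hypergraph model and its Gaussian counterparts defined in the context. Assume that $\sup_{\alpha\in[n]^p}\|J_\alpha\|=O(1)$, that $\mathsf d_n\to\infty$ and $s_n-\mathsf d_n\to\infty$, and that the Bernoulli channel is well defined uniformly over $\Theta_n$. Let $\delta_n=\mathsf d_n^{-1/2}+(s_n-\mathsf d_n)^{-1/2}$. There exists a constant $C<\infty$, independent of $n$, $\theta$, and $\epsilon$, such that, for every sufficiently small fixed $\epsilon>0$, uniformly over $\theta\in\Theta_n$, $$\mathcal R_n^{\mathrm G}(\theta,\epsilon)-C\Bigl(\epsilon+\frac{\delta_n}\epsilon\Bigr)\le\mathcal R_n(\theta)\le\mathcal R_n^{\mathrm G}(\theta,-\epsilon)+C\Bigl(\epsilon+\frac{\delta_n}\epsilon\Bigr),$$ $$\mathcal V_n^{\mathrm G}(\theta,-\epsilon)-C\Bigl(\epsilon+\frac{\delta_n}\epsilon\Bigr)\le\mathcal V_n(\theta)\le\mathcal V_n^{\mathrm G}(\theta,\epsilon)+C\Bigl(\epsilon+\frac{\delta_n}\epsilon\Bigr).$$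
   Context: Fix integers $p\ge2$, $d\ge1$ and reals $\lambda>0$, $\lambda_\star>0$. Let $\Theta_n=T_n=[-1,1]^{d\times n}$, with elements $u=(u_1,\dots,u_n)$, $u_i\in[-1,1]^d$; $\pi$ is a Borel probability measure (prior) on $T_n$. For $\alpha\in[n]^p$ let $$\eta_\alpha(u)=n^{\frac{1-p}2}\,u_{\alpha_1}\otimes\cdots\otimes u_{\alpha_p}\in\mathbb R^{d^p},\qquad z_\alpha(u)=\langle J_\alpha,\eta_\alpha(u)\rangle,\qquad\eta(u)=(\eta_\alpha(u))_{\alpha\in[n]^p},$$ where $J_\alpha\in\mathbb R^{d^p}$ are deterministic coupling vectors. Let $s_n=n^{p-1}$, $\mathsf d_n\in(0,s_n)$, $b_n=\sqrt{(s_n-\mathsf d_n)/\mathsf d_n}$. Data ($P_\theta$): $G_\alpha$, $\alpha\in[n]^p$, independent with $$G_\alpha\sim\mathrm{Bernoulli}\Bigl(\tfrac{\mathsf d_n}{s_n}+\sqrt{\tfrac{\mathsf d_n}{s_n}\bigl(1-\tfrac{\mathsf d_n}{s_n}\bigr)}\sqrt{\lambda_\star}\,z_\alpha(\theta)\Bigr).$$ Likelihood process: $$X(t)=\sum_{\alpha\in[n]^p}\Bigl[G_\alpha\log(1+b_n\sqrt\lambda\,z_\alpha(t))+(1-G_\alpha)\log\Bigl(1-\frac{\sqrt\lambda\,z_\alpha(t)}{b_n}\Bigr)\Bigr],\quad t\in T_n.$$ "The Bernoulli channel is well defined uniformly over $\Theta_n$" means that, for $\kappa\in\{\lambda,\lambda_\star\}$,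 every $n$, $\alpha\in[n]^p$ and $u\in\Theta_n$, $1+b_n\sqrt\kappa\,z_\alpha(u)>0$ and $1-\sqrt\kappa\,z_\alpha(u)/b_n>0$. Let $H_\alpha=J_\alpha J_\alpha^\top$, $H=\bigoplus_\alpha H_\alpha$, and $\|h\|_H^2=\langle Hh,h\rangle$. For $a\in\{-1,0\}$ set $$A_\alpha^{(\beta)}=(\sqrt{\lambda\lambda_\star}-2\beta a)H_\alpha,\quad\Sigma_\alpha^{(\beta)}=\frac{(\lambda+\beta)^2}\lambda H_\alpha,\quad K_\alpha^{(\beta)}=(\lambda-2\beta a)H_\alpha,$$ and, under $Q_\theta$, let $Y_\beta$ be the Gaussian process on $T_n$ (continuous paths) with $$\mathbb E[Y_\beta(t)]=\sum_\alpha\Bigl\{\langle A_\alpha^{(\beta)}\eta_\alpha(\theta),\eta_\alpha(t)\rangle-\tfrac12\langle K_\alpha^{(\beta)}\eta_\alpha(t),\eta_\alpha(t)\rangle+\beta a\langle H_\alpha\eta_\alpha(\theta),\eta_\alpha(\theta)\rangle\Bigr\},$$ $$\mathrm{Cov}(Y_\beta(s),Y_\beta(t))=\sum_\alpha\langle\Sigma_\alpha^{(\beta)}\eta_\alpha(s),\eta_\alpha(t)\rangle.$$ Write $Y_\beta^{\mathrm{mse}}$ for $a=-1$ and $Y_\beta^{\mathrm{var}}$ for $a=0$. For a process $Z$ let $\pi_Z(\mathrm dt)=e^{Z(t)}\pi(\mathrm dt)/\int_{T_n}e^{Z(s)}\pi(\mathrm ds)$ and $\widehat\eta_Z=\int_{T_n}\eta(t)\,\pi_Z(\mathrm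 dt)$. Define $$\mathcal R_n(\theta)=\tfrac1n\mathbb E_{P_\theta}\bigl[\|\eta(\theta)-\widehat\eta_X\|_H^2\bigr],\qquad\mathcal V_n(\theta)=\tfrac1n\mathbb E_{P_\theta}\Bigl[\int_{T_n}\|\eta(t)-\widehat\eta_X\|_H^2\,\pi_X(\mathrm dt)\Bigr],$$ $$\mathcal R_n^{\mathrm G}(\theta,\beta)=\tfrac1n\mathbb E_{Q_\theta}\bigl[\|\eta(\theta)-\widehat\eta_{Y_\beta^{\mathrm{mse}}}\|_H^2\bigr],\qquad\mathcal V_n^{\mathrm G}(\theta,\beta)=\tfrac1n\mathbb E_{Q_\theta}\Bigl[\int_{T_n}\|\eta(t)-\widehat\eta_{Y_\beta^{\mathrm{var}}}\|_H^2\,\pi_{Y_\beta^{\mathrm{var}}}(\mathrm dt)\Bigr].$$ "Sufficiently small $\epsilon$" means $\epsilon\in(0,\epsilon_0)$ with $\epsilon_0$ independent of $n,\theta$. *)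

theory Defs
  imports "HOL-Probability.Probability" "HOL-Library.Landau_Symbols"
begin

(* The fixed integers p and d are the cardinalities of the index types 'p and 'd, so the
   tensor space R^(d^p) is real ^ ('p \<Rightarrow> 'd).  The varying n is an explicit argument: [n] is
   {..<n}, a parameter u = (u_1, ..., u_n) is an extensional function on {..<n}, and a
   multi-index in [n]^p is a function 'p \<Rightarrow> nat with values in {..<n}.  The argument J is
   the array of coupling vectors for the given n. *)

definition cube :: "nat \<Rightarrow> (nat \<Rightarrow> real ^ 'd::finite) set" where
  "cube n = {..<n} \<rightarrow>\<^sub>E {x. \<forall>j. x $ j \<in> {-1..1}}"

definition cube_sigma :: "nat \<Rightarrow> (nat \<Rightarrow> real ^ 'd::finite) measure" where
  "cube_sigma n = restrict_space (Pi\<^sub>M {..<n} (\<lambda>_. borel)) (cube n)"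

definition prior_on_cube :: "nat \<Rightarrow> (nat \<Rightarrow> real ^ 'd::finite) measure \<Rightarrow> bool" where
  "prior_on_cube n \<pi> \<longleftrightarrow> prob_space \<pi> \<and> sets \<pi> = sets (cube_sigma n)"

definition multi_indices :: "nat \<Rightarrow> ('p::finite \<Rightarrow> nat) set" where
  "multi_indices n = {\<alpha>. \<forall>i. \<alpha> i < n}"

definition eta :: "nat \<Rightarrow> (nat \<Rightarrow> real ^ 'd::finite) \<Rightarrow> ('p::finite \<Rightarrow> nat) \<Rightarrow> real ^ ('p \<Rightarrow> 'd)" where
  "eta n u \<alpha> = real n powr ((1 - real CARD('p)) / 2) *\<^sub>R (\<chi> k. \<Prod>i\<in>UNIV. u (\<alpha> i) $ k i)"

definition zfun :: "nat \<Rightarrow> (('p::finite \<Rightarrow> nat) \<Rightarrow> real ^ ('p \<Rightarrow> 'd::finite)) \<Rightarrow>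
    (nat \<Rightarrow> real ^ 'd) \<Rightarrow> ('p \<Rightarrow> nat) \<Rightarrow> real" where
  "zfun n J u \<alpha> = J \<alpha> \<bullet> eta n u \<alpha>"

definition s_scale :: "nat \<Rightarrow> nat \<Rightarrow> real" where
  "s_scale p n = real n ^ (p - 1)"

definition b_scale :: "nat \<Rightarrow> nat \<Rightarrow> real \<Rightarrow> real" where
  "b_scale p n dn = sqrt ((s_scale p n - dn) / dn)"

definition delta :: "nat \<Rightarrow> nat \<Rightarrow> real \<Rightarrow> real" where
  "delta p n dn = dn powr (-1/2) + (s_scale p n - dn) powr (-1/2)"


section \<open>Bernoulli channel\<close>

definition bern_well_defined :: "real \<Rightarrow> nat \<Rightarrow> real \<Rightarrow>
    (('p::finite \<Rightarrow> nat) \<Rightarrow> real ^ ('p \<Rightarrow> 'd::finite)) \<Rightarrow> bool" where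
  "bern_well_defined \<kappa> n dn J \<longleftrightarrow>
     (\<forall>\<alpha>\<in>multi_indices n. \<forall>u\<in>cube n.
        1 + b_scale CARD('p) n dn * sqrt \<kappa> * zfun n J u \<alpha> > 0 \<and>
        1 - sqrt \<kappa> * zfun n J u \<alpha> / b_scale CARD('p) n dn > 0)"

(* The joint law of the independent labels; outside [n]^p the value is the dummy False. *)
definition bern_law :: "real \<Rightarrow> nat \<Rightarrow> real \<Rightarrow>
    (('p::finite \<Rightarrow> nat) \<Rightarrow> real ^ ('p \<Rightarrow> 'd::finite)) \<Rightarrow> (nat \<Rightarrow> real ^ 'd) \<Rightarrow>
    (('p \<Rightarrow> nat) \<Rightarrow> bool) pmf" where
  "bern_law lams n dn J \<theta> =
     Pi_pmf (multi_indices n) False (\<lambda>\<alpha>. bernoulli_pmf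
       (let q = dn / s_scale CARD('p) n
        in q + sqrt (q * (1 - q)) * sqrt lams * zfun n J \<theta> \<alpha>))"

definition bern_loglik :: "real \<Rightarrow> nat \<Rightarrow> real \<Rightarrow>
    (('p::finite \<Rightarrow> nat) \<Rightarrow> real ^ ('p \<Rightarrow> 'd::finite)) \<Rightarrow> (('p \<Rightarrow> nat) \<Rightarrow> bool) \<Rightarrow>
    (nat \<Rightarrow> real ^ 'd) \<Rightarrow> real" where
  "bern_loglik lam n dn J G t =
     (\<Sum>\<alpha>\<in>multi_indices n.
        of_bool (G \<alpha>) * ln (1 + b_scale CARD('p) n dn * sqrt lam * zfun n J t \<alpha>) +
        (1 - of_bool (G \<alpha>)) * ln (1 - sqrt lam * zfun n J t \<alpha> / b_scale CARD('p) n dn))"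


section \<open>Posterior functionals\<close>

definition posterior :: "'t measure \<Rightarrow> ('t \<Rightarrow> real) \<Rightarrow> 't measure" where
  "posterior \<pi> Z = density \<pi> (\<lambda>t. ennreal (exp (Z t) / (\<integral>s. exp (Z s) \<partial>\<pi>)))"

definition eta_hat :: "nat \<Rightarrow> (nat \<Rightarrow> real ^ 'd::finite) measure \<Rightarrow> ((nat \<Rightarrow> real ^ 'd) \<Rightarrow> real) \<Rightarrow>
    ('p::finite \<Rightarrow> nat) \<Rightarrow> real ^ ('p \<Rightarrow> 'd)" where
  "eta_hat n \<pi> Z \<alpha> = (\<integral>t. eta n t \<alpha> \<partial>posterior \<pi> Z)"

definition Hmat :: "(('p::finite \<Rightarrow> nat) \<Rightarrow> real ^ ('p \<Rightarrow> 'd::finite)) \<Rightarrow> ('p \<Rightarrow> nat) \<Rightarrow>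
    real ^ ('p \<Rightarrow> 'd) ^ ('p \<Rightarrow> 'd)" where
  "Hmat J \<alpha> = (\<chi> k l. J \<alpha> $ k * J \<alpha> $ l)"

(* The quadratic form of the block-diagonal matrix with blocks Hmat J \<alpha>. *)
definition H_norm_sq :: "nat \<Rightarrow> (('p::finite \<Rightarrow> nat) \<Rightarrow> real ^ ('p \<Rightarrow> 'd::finite)) \<Rightarrow>
    (('p \<Rightarrow> nat) \<Rightarrow> real ^ ('p \<Rightarrow> 'd)) \<Rightarrow> real" where
  "H_norm_sq n J h = (\<Sum>\<alpha>\<in>multi_indices n. (Hmat J \<alpha> *v h \<alpha>) \<bullet> h \<alpha>)"

definition sq_error :: "nat \<Rightarrow> (('p::finite \<Rightarrow> nat) \<Rightarrow> real ^ ('p \<Rightarrow> 'd::finite)) \<Rightarrow>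
    (nat \<Rightarrow> real ^ 'd) measure \<Rightarrow> (nat \<Rightarrow> real ^ 'd) \<Rightarrow> ((nat \<Rightarrow> real ^ 'd) \<Rightarrow> real) \<Rightarrow> real" where
  "sq_error n J \<pi> \<theta> Z = H_norm_sq n J (\<lambda>\<alpha>. eta n \<theta> \<alpha> - eta_hat n \<pi> Z \<alpha>)"

definition post_var :: "nat \<Rightarrow> (('p::finite \<Rightarrow> nat) \<Rightarrow> real ^ ('p \<Rightarrow> 'd::finite)) \<Rightarrow>
    (nat \<Rightarrow> real ^ 'd) measure \<Rightarrow> ((nat \<Rightarrow> real ^ 'd) \<Rightarrow> real) \<Rightarrow> real" where
  "post_var n J \<pi> Z =
     (\<integral>t. H_norm_sq n J (\<lambda>\<alpha>. eta n t \<alpha> - eta_hat n \<pi> Z \<alpha>) \<partial>posterior \<pi> Z)"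

definition bern_risk :: "real \<Rightarrow> real \<Rightarrow> nat \<Rightarrow> real \<Rightarrow>
    (('p::finite \<Rightarrow> nat) \<Rightarrow> real ^ ('p \<Rightarrow> 'd::finite)) \<Rightarrow>
    (nat \<Rightarrow> real ^ 'd) measure \<Rightarrow> (nat \<Rightarrow> real ^ 'd) \<Rightarrow> real" where
  "bern_risk lam lams n dn J \<pi> \<theta> =
     1 / real n * measure_pmf.expectation (bern_law lams n dn J \<theta>)
       (\<lambda>G. sq_error n J \<pi> \<theta> (bern_loglik lam n dn J G))"

definition bern_var :: "real \<Rightarrow> real \<Rightarrow> nat \<Rightarrow> real \<Rightarrow>
    (('p::finite \<Rightarrow> nat) \<Rightarrow> real ^ ('p \<Rightarrow> 'd::finite)) \<Rightarrow>
    (nat \<Rightarrow> real ^ 'd) measure \<Rightarrow> (nat \<Rightarrow> real ^ 'd) \<Rightarrow> real" where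
  "bern_var lam lams n dn J \<pi> \<theta> =
     1 / real n * measure_pmf.expectation (bern_law lams n dn J \<theta>)
       (\<lambda>G. post_var n J \<pi> (bern_loglik lam n dn J G))"

definition gauss_risk :: "nat \<Rightarrow> (('p::finite \<Rightarrow> nat) \<Rightarrow> real ^ ('p \<Rightarrow> 'd::finite)) \<Rightarrow>
    (nat \<Rightarrow> real ^ 'd) measure \<Rightarrow> (nat \<Rightarrow> real ^ 'd) \<Rightarrow> 'w measure \<Rightarrow>
    ('w \<Rightarrow> (nat \<Rightarrow> real ^ 'd) \<Rightarrow> real) \<Rightarrow> real" where
  "gauss_risk n J \<pi> \<theta> Q Y = 1 / real n * (\<integral>\<omega>. sq_error n J \<pi> \<theta> (Y \<omega>) \<partial>Q)"

definition gauss_var :: "nat \<Rightarrow> (('p::finite \<Rightarrow> nat) \<Rightarrow> real ^ ('p \<Rightarrow> 'd::finite)) \<Rightarrow>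
    (nat \<Rightarrow> real ^ 'd) measure \<Rightarrow> 'w measure \<Rightarrow>
    ('w \<Rightarrow> (nat \<Rightarrow> real ^ 'd) \<Rightarrow> real) \<Rightarrow> real" where
  "gauss_var n J \<pi> Q Y = 1 / real n * (\<integral>\<omega>. post_var n J \<pi> (Y \<omega>) \<partial>Q)"


section \<open>Gaussian counterparts\<close>

(* Degenerate (almost surely constant) variables count as Gaussian. *)
definition gaussian_rv :: "'w measure \<Rightarrow> ('w \<Rightarrow> real) \<Rightarrow> bool" where
  "gaussian_rv M X \<longleftrightarrow> X \<in> borel_measurable M \<and>
     ((\<exists>\<mu> \<sigma>. \<sigma> > 0 \<and> distributed M lborel X (normal_density \<mu> \<sigma>)) \<or>
      (\<exists>\<mu>. AE \<omega> in M. X \<omega> = \<mu>))"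

definition gaussian_process :: "'w measure \<Rightarrow> 't set \<Rightarrow> ('w \<Rightarrow> 't \<Rightarrow> real) \<Rightarrow> bool" where
  "gaussian_process M T Y \<longleftrightarrow> prob_space M \<and>
     (\<forall>S c. finite S \<and> S \<subseteq> T \<longrightarrow> gaussian_rv M (\<lambda>\<omega>. \<Sum>t\<in>S. c t * Y \<omega> t))"

definition cov :: "'w measure \<Rightarrow> ('w \<Rightarrow> real) \<Rightarrow> ('w \<Rightarrow> real) \<Rightarrow> real" where
  "cov M X X' = (\<integral>\<omega>. (X \<omega> - (\<integral>\<omega>'. X \<omega>' \<partial>M)) * (X' \<omega> - (\<integral>\<omega>'. X' \<omega>' \<partial>M)) \<partial>M)"

definition continuous_gaussian_process ::
  "'w measure \<Rightarrow> 't::topological_space set \<Rightarrow> ('t \<Rightarrow> real) \<Rightarrow> ('t \<Rightarrow> 't \<Rightarrow> real) \<Rightarrow>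
    ('w \<Rightarrow> 't \<Rightarrow> real) \<Rightarrow> bool" where
  "continuous_gaussian_process M T m k Y \<longleftrightarrow> gaussian_process M T Y \<and>
     (\<forall>\<omega>\<in>space M. continuous_on T (Y \<omega>)) \<and>
     (\<forall>t\<in>T. (\<integral>\<omega>. Y \<omega> t \<partial>M) = m t) \<and>
     (\<forall>s\<in>T. \<forall>t\<in>T. cov M (\<lambda>\<omega>. Y \<omega> s) (\<lambda>\<omega>. Y \<omega> t) = k s t)"

definition Amat :: "real \<Rightarrow> real \<Rightarrow> real \<Rightarrow> real \<Rightarrow> (('p::finite \<Rightarrow> nat) \<Rightarrow> real ^ ('p \<Rightarrow> 'd::finite)) \<Rightarrow>
    ('p \<Rightarrow> nat) \<Rightarrow> real ^ ('p \<Rightarrow> 'd) ^ ('p \<Rightarrow> 'd)" where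
  "Amat lam lams a \<beta> J \<alpha> = (sqrt (lam * lams) - 2 * \<beta> * a) *\<^sub>R Hmat J \<alpha>"

definition Smat :: "real \<Rightarrow> real \<Rightarrow> (('p::finite \<Rightarrow> nat) \<Rightarrow> real ^ ('p \<Rightarrow> 'd::finite)) \<Rightarrow>
    ('p \<Rightarrow> nat) \<Rightarrow> real ^ ('p \<Rightarrow> 'd) ^ ('p \<Rightarrow> 'd)" where
  "Smat lam \<beta> J \<alpha> = ((lam + \<beta>)\<^sup>2 / lam) *\<^sub>R Hmat J \<alpha>"

definition Kmat :: "real \<Rightarrow> real \<Rightarrow> real \<Rightarrow> (('p::finite \<Rightarrow> nat) \<Rightarrow> real ^ ('p \<Rightarrow> 'd::finite)) \<Rightarrow>
    ('p \<Rightarrow> nat) \<Rightarrow> real ^ ('p \<Rightarrow> 'd) ^ ('p \<Rightarrow> 'd)" where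
  "Kmat lam a \<beta> J \<alpha> = (lam - 2 * \<beta> * a) *\<^sub>R Hmat J \<alpha>"

definition gauss_mean :: "real \<Rightarrow> real \<Rightarrow> real \<Rightarrow> real \<Rightarrow> nat \<Rightarrow>
    (('p::finite \<Rightarrow> nat) \<Rightarrow> real ^ ('p \<Rightarrow> 'd::finite)) \<Rightarrow> (nat \<Rightarrow> real ^ 'd) \<Rightarrow>
    (nat \<Rightarrow> real ^ 'd) \<Rightarrow> real" where
  "gauss_mean lam lams a \<beta> n J \<theta> t =
     (\<Sum>\<alpha>\<in>multi_indices n.
        (Amat lam lams a \<beta> J \<alpha> *v eta n \<theta> \<alpha>) \<bullet> eta n t \<alpha>
        - 1/2 * ((Kmat lam a \<beta> J \<alpha> *v eta n t \<alpha>) \<bullet> eta n t \<alpha>)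
        + \<beta> * a * ((Hmat J \<alpha> *v eta n \<theta> \<alpha>) \<bullet> eta n \<theta> \<alpha>))"

definition gauss_cov :: "real \<Rightarrow> real \<Rightarrow> nat \<Rightarrow>
    (('p::finite \<Rightarrow> nat) \<Rightarrow> real ^ ('p \<Rightarrow> 'd::finite)) \<Rightarrow> (nat \<Rightarrow> real ^ 'd) \<Rightarrow>
    (nat \<Rightarrow> real ^ 'd) \<Rightarrow> real" where
  "gauss_cov lam \<beta> n J s t =
     (\<Sum>\<alpha>\<in>multi_indices n. (Smat lam \<beta> J \<alpha> *v eta n s \<alpha>) \<bullet> eta n t \<alpha>)"

end

theory Submission
  imports Defs
begin

text \<open>Put \<open>q = d\<^sub>n / s\<^sub>n\<close> and standardise the labels, \<open>\<zeta> = (G - q) / sqrt (q * (1 - q))\<close>. This noise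
takes the two values \<open>b\<close> and \<open>- 1 / b\<close>, has mean \<open>sqrt lams * z(\<theta>)\<close> and nearly unit variance,
and it turns the log-likelihood into a sum of terms \<open>ln (1 + \<zeta> * sqrt lam * z(t))\<close>. As \<open>z\<close> is of
order \<open>1 / sqrt s\<^sub>n\<close>, the products \<open>\<zeta> * z\<close> are of order \<open>\<delta>\<^sub>n\<close>. Each label thus contributes a
nearly linear term with a small quadratic correction, and only its first two moments should
matter.

To compare risks, add to the log-likelihood \<open>\<beta>\<close> times the perturbation
\<open>U = a * (z(\<theta>) - z(t))\<^sup>2 + (\<zeta> - E \<zeta>) * z(t) / sqrt lam\<close>, summed over the labels, and let \<open>F \<beta>\<close> be
the expected logarithm of the partition function. Replace \<open>\<zeta>\<close> by \<open>sqrt lams * z(\<theta>)\<close> plus a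
standard normal variable, and the log-likelihood by \<open>sqrt lam * \<zeta> * z(t) - lam * z(t)\<^sup>2 / 2\<close>: the
perturbed process is then, in law, the Gaussian process with parameter \<open>\<beta>\<close>, whose mean and
standard deviation are affine in \<open>\<beta>\<close>. Three facts give the theorem.

\<^item> Both functions \<open>F\<close> are convex, since the exponents are affine in \<open>\<beta>\<close>; so \<open>F\<close> lies
  above its tangents (\<open>free_energy_tangent\<close>).
\<^item> By approximate Gaussian integration by parts, the noise part of the slope equals the posterior
  variance (\<open>gaussian_ibp_approx\<close>). The quadratic part is \<open>a\<close> times the squared error plus \<open>a\<close>
  times the posterior variance. Hence the slope is minus the squared error for \<open>a = - 1\<close> and the
  posterior variance for \<open>a = 0\<close>, up to \<open>O(n * \<beta>)\<close>.
\<^item> Exchanging the Bernoulli labels for Gaussian ones, one at a time, changes \<open>F\<close> by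
  \<open>O(n * \<delta>\<^sub>n)\<close> (\<open>lindeberg_swap\<close>).

The tangent inequality at \<open>0\<close> for the Bernoulli function and at \<open>\<beta> = \<epsilon>\<close> or \<open>\<beta> = - \<epsilon>\<close> for the Gaussian one
bound the same increment from both sides. Division by \<open>n * \<epsilon>\<close> leaves the error \<open>\<epsilon> + \<delta>\<^sub>n / \<epsilon>\<close>, and the
sign of \<open>\<beta>\<close> selects the upper or the lower bound (\<open>risk_comparison\<close>).

All this is done for finitely supported priors, where posterior averages are finite sums. A
general prior is the limit of its images under rounding to a grid, with constants that do not
depend on the grid. On a grid the given Gaussian process may be replaced by a linear form in
independent normal variables, because all projections of the two to the line have the same law
(\<open>cramer_wold\<close>). Finally, if \<open>\<delta>\<^sub>n\<close> is bounded away from \<open>0\<close>, the claim is trivial because all risks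
are bounded.\<close>

section \<open>Weighted averages and their tilts\<close>

definition weights :: "'t set \<Rightarrow> ('t \<Rightarrow> real) \<Rightarrow> bool" where
  "weights T v \<longleftrightarrow> finite T \<and> (\<forall>t\<in>T. 0 \<le> v t) \<and> 0 < sum v T"

definition wavg :: "'t set \<Rightarrow> ('t \<Rightarrow> real) \<Rightarrow> ('t \<Rightarrow> real) \<Rightarrow> real" where
  "wavg T v f = (\<Sum>t\<in>T. v t * f t) / sum v T"

definition wcov :: "'t set \<Rightarrow> ('t \<Rightarrow> real) \<Rightarrow> ('t \<Rightarrow> real) \<Rightarrow> ('t \<Rightarrow> real) \<Rightarrow> real" where
  "wcov T v f g = wavg T v (\<lambda>t. f t * g t) - wavg T v f * wavg T v g"

definition tilt :: "('t \<Rightarrow> real) \<Rightarrow> ('t \<Rightarrow> real) \<Rightarrow> 't \<Rightarrow> real" where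
  "tilt v u t = v t * exp (u t)"

lemma tilt_tilt: "tilt (tilt v u) u' = tilt v (\<lambda>t. u t + u' t)"
  by (simp add: tilt_def fun_eq_iff exp_add)

lemma tilt_0 [simp]: "tilt v (\<lambda>t. 0) = v"
  by (simp add: tilt_def fun_eq_iff)

lemma weights_tilt: assumes "weights T v" shows "weights T (tilt v u)"
proof -
  have fin: "finite T" and nn: "\<And>t. t \<in> T \<Longrightarrow> 0 \<le> v t" and pos: "0 < sum v T"
    using assms by (auto simp: weights_def)
  obtain t where "t \<in> T" "0 < v t"
    using pos nn by (metis less_le_not_le not_le sum_nonpos)
  then have "0 < sum (tilt v u) T"
    by (intro sum_pos2[OF fin]) (auto simp: tilt_def nn)
  then show ?thesis using fin nn by (auto simp: weights_def tilt_def)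
qed

lemma wavg_mono:
  assumes "weights T v" "\<And>t. t \<in> T \<Longrightarrow> f t \<le> g t"
  shows "wavg T v f \<le> wavg T v g"
  unfolding wavg_def using assms
  by (intro divide_right_mono sum_mono mult_left_mono) (auto simp: weights_def)

lemma wavg_const: "weights T v \<Longrightarrow> wavg T v (\<lambda>_. c) = c"
  by (simp add: wavg_def weights_def flip: sum_distrib_right)

lemma wavg_add: "wavg T v (\<lambda>t. f t + g t) = wavg T v f + wavg T v g"
  by (simp add: wavg_def algebra_simps sum.distrib add_divide_distrib)

lemma wavg_diff: "wavg T v (\<lambda>t. f t - g t) = wavg T v f - wavg T v g"
  by (simp add: wavg_def algebra_simps sum_subtractf diff_divide_distrib)

lemma wavg_cmult: "wavg T v (\<lambda>t. c * f t) = c * wavg T v f"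
  by (simp add: wavg_def algebra_simps sum_distrib_left)

lemma wavg_sum: "wavg T v (\<lambda>t. \<Sum>i\<in>I. f i t) = (\<Sum>i\<in>I. wavg T v (f i))"
  unfolding wavg_def by (simp add: sum_distrib_left sum_divide_distrib) (rule sum.swap)

lemma abs_wavg_le:
  assumes "weights T v" "\<And>t. t \<in> T \<Longrightarrow> \<bar>f t\<bar> \<le> F"
  shows "\<bar>wavg T v f\<bar> \<le> F"
proof -
  have "wavg T v f \<le> F" "- F \<le> wavg T v f"
    using wavg_mono[OF assms(1), of f "\<lambda>_. F"] wavg_mono[OF assms(1), of "\<lambda>_. - F" f]
      wavg_const[OF assms(1)] assms(2) by (fastforce simp: abs_le_iff)+
  then show ?thesis by linarith
qed

lemma weights_nonempty: "weights T v \<Longrightarrow> T \<noteq> {}"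
  by (auto simp: weights_def)

lemma bound_nonneg: "T \<noteq> {} \<Longrightarrow> (\<And>t. t \<in> T \<Longrightarrow> \<bar>f t\<bar> \<le> (F::real)) \<Longrightarrow> 0 \<le> F"
  by (metis abs_ge_zero all_not_in_conv order_trans)

lemma abs_wcov_le:
  assumes v: "weights T v" and f: "\<And>t. t \<in> T \<Longrightarrow> \<bar>f t\<bar> \<le> F" and g: "\<And>t. t \<in> T \<Longrightarrow> \<bar>g t\<bar> \<le> G"
  shows "\<bar>wcov T v f g\<bar> \<le> 2 * F * G"
proof -
  have F: "0 \<le> F" using bound_nonneg[OF weights_nonempty[OF v]] f by blast
  have "\<bar>wavg T v (\<lambda>t. f t * g t)\<bar> \<le> F * G"
    by (rule abs_wavg_le[OF v]) (auto simp: abs_mult F intro!: mult_mono f g)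
  moreover have "\<bar>wavg T v f * wavg T v g\<bar> \<le> F * G"
    unfolding abs_mult using abs_wavg_le[OF v f] abs_wavg_le[OF v g] F by (intro mult_mono) auto
  ultimately show ?thesis unfolding wcov_def by linarith
qed

lemma wcov_commute: "wcov T v f g = wcov T v g f"
  by (simp add: wcov_def mult.commute)

lemma wcov_add_right: "wcov T v f (\<lambda>t. g t + h t) = wcov T v f g + wcov T v f h"
  by (simp add: wcov_def distrib_left wavg_add algebra_simps)

lemma wcov_cmult_right: "wcov T v f (\<lambda>t. c * g t) = c * wcov T v f g"
  using wavg_cmult[of T v c "\<lambda>t. f t * g t"]
  by (simp add: wcov_def wavg_cmult algebra_simps)

lemma wavg_sq_dist:
  assumes "weights T v"
  shows "wavg T v (\<lambda>t. (y - f t)\<^sup>2) = (y - wavg T v f)\<^sup>2 + wcov T v f f"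
proof -
  have "(\<lambda>t. (y - f t)\<^sup>2) = (\<lambda>t. y\<^sup>2 + (- 2 * y) * f t + f t * f t)"
    by (simp add: fun_eq_iff power2_eq_square algebra_simps)
  then show ?thesis
    by (simp only: wavg_add wavg_cmult wavg_const[OF assms])
      (simp add: wcov_def power2_eq_square algebra_simps)
qed

text \<open>All expansions below come from one identity: along the tilt \<open>s * u\<close> the average of
\<open>f\<close> moves at the speed of its covariance with \<open>u\<close>.\<close>

lemma has_derivative_wavg_tilt:
  assumes "weights T v"
  shows "((\<lambda>s. wavg T (tilt v (\<lambda>t. s * u t)) f) has_real_derivative
           wcov T (tilt v (\<lambda>t. s * u t)) f u) (at s)"
proof -
  let ?w = "\<lambda>s. tilt v (\<lambda>t. s * u t)"
  have pos: "sum (?w s) T \<noteq> 0" for s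
    using weights_tilt[OF assms] by (metis less_irrefl weights_def)
  have 1: "((\<lambda>s. \<Sum>t\<in>T. ?w s t * f t) has_real_derivative (\<Sum>t\<in>T. ?w s t * (f t * u t))) (at s)"
    unfolding tilt_def by (auto intro!: derivative_eq_intros sum.cong)
  have 2: "((\<lambda>s. sum (?w s) T) has_real_derivative (\<Sum>t\<in>T. ?w s t * u t)) (at s)"
    unfolding tilt_def by (auto intro!: derivative_eq_intros sum.cong)
  show ?thesis
    unfolding wavg_def wcov_def
    by (rule DERIV_cong[OF DERIV_divide[OF 1 2 pos]]) (use pos in \<open>simp add: field_simps\<close>)
qed

lemma has_derivative_ln_sum_tilt:
  assumes "weights T v"
  shows "((\<lambda>s. ln (sum (tilt v (\<lambda>t. s * u t)) T)) has_real_derivative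
           wavg T (tilt v (\<lambda>t. s * u t)) u) (at s)"
proof -
  let ?w = "\<lambda>s. tilt v (\<lambda>t. s * u t)"
  have pos: "0 < sum (?w s) T" for s
    using weights_tilt[OF assms] by (metis weights_def)
  have 2: "((\<lambda>s. sum (?w s) T) has_real_derivative (\<Sum>t\<in>T. ?w s t * u t)) (at s)"
    unfolding tilt_def by (auto intro!: derivative_eq_intros sum.cong)
  show ?thesis unfolding wavg_def
    by (rule DERIV_cong[OF DERIV_chain2[where f = ln, OF DERIV_ln[OF pos] 2]]) (simp add: field_simps)
qed

lemma abs_diff_le_of_derivative_bound:
  fixes h :: "real \<Rightarrow> real"
  assumes "\<And>s. 0 \<le> s \<Longrightarrow> s \<le> 1 \<Longrightarrow> (h has_real_derivative h' s) (at s)"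
    and "\<And>s. 0 \<le> s \<Longrightarrow> s \<le> 1 \<Longrightarrow> \<bar>h' s\<bar> \<le> K"
  shows "\<bar>h 1 - h 0\<bar> \<le> K"
proof -
  obtain z where "0 < z" "z < 1" "h 1 - h 0 = (1 - 0) * h' z"
    using MVT2[of 0 1 h h'] assms(1) by auto
  then show ?thesis using assms(2)[of z] by simp
qed

lemma wavg_tilt_diff:
  assumes v: "weights T v" and f: "\<And>t. t \<in> T \<Longrightarrow> \<bar>f t\<bar> \<le> F" and u: "\<And>t. t \<in> T \<Longrightarrow> \<bar>u t\<bar> \<le> U"
  shows "\<bar>wavg T (tilt v u) f - wavg T v f\<bar> \<le> 2 * F * U"
  using abs_diff_le_of_derivative_bound[OF has_derivative_wavg_tilt[OF v]
      abs_wcov_le[OF weights_tilt[OF v] f u]]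
  by simp

text \<open>The covariance is a polynomial in three averages, each of which moves by an amount proportional to
the size of the tilt.\<close>

lemma wcov_tilt_diff:
  assumes v: "weights T v" and f: "\<And>t. t \<in> T \<Longrightarrow> \<bar>f t\<bar> \<le> F" and g: "\<And>t. t \<in> T \<Longrightarrow> \<bar>g t\<bar> \<le> G"
    and u: "\<And>t. t \<in> T \<Longrightarrow> \<bar>u t\<bar> \<le> U"
  shows "\<bar>wcov T (tilt v u) f g - wcov T v f g\<bar> \<le> 6 * F * G * U"
proof -
  note ne = weights_nonempty[OF v]
  have F: "0 \<le> F" and G: "0 \<le> G" and U: "0 \<le> U"
    using bound_nonneg[OF ne] f g u by blast+
  have fg: "\<bar>wavg T (tilt v u) (\<lambda>t. f t * g t) - wavg T v (\<lambda>t. f t * g t)\<bar> \<le> 2 * (F * G) * U"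
    by (rule wavg_tilt_diff[OF v _ u]) (auto simp: abs_mult F intro!: mult_mono f g)
  define a b where "a = wavg T (tilt v u) f" and "b = wavg T (tilt v u) g"
  define a0 b0 where "a0 = wavg T v f" and "b0 = wavg T v g"
  have "\<bar>a * b - a0 * b0\<bar> = \<bar>(a - a0) * b + a0 * (b - b0)\<bar>" by (simp add: algebra_simps)
  also have "\<dots> \<le> \<bar>a - a0\<bar> * \<bar>b\<bar> + \<bar>a0\<bar> * \<bar>b - b0\<bar>" by (metis abs_mult abs_triangle_ineq)
  also have "\<dots> \<le> (2 * F * U) * G + F * (2 * G * U)"
    unfolding a_def b_def a0_def b0_def
    using F G U wavg_tilt_diff[OF v f u] wavg_tilt_diff[OF v g u]
      abs_wavg_le[OF weights_tilt[OF v] g] abs_wavg_le[OF v f]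
    by (intro add_mono mult_mono) auto
  finally show ?thesis using fg
    unfolding wcov_def a_def b_def a0_def b0_def by (simp add: algebra_simps abs_le_iff)
qed

lemma wavg_tilt_expansion:
  assumes v: "weights T v" and f: "\<And>t. t \<in> T \<Longrightarrow> \<bar>f t\<bar> \<le> F" and u: "\<And>t. t \<in> T \<Longrightarrow> \<bar>u t\<bar> \<le> U"
  shows "\<bar>wavg T (tilt v u) f - wavg T v f - wcov T v f u\<bar> \<le> 6 * F * U\<^sup>2"
proof -
  let ?h = "\<lambda>s. wavg T (tilt v (\<lambda>t. s * u t)) f - s * wcov T v f u"
  note ne = weights_nonempty[OF v]
  have F: "0 \<le> F" and U: "0 \<le> U" using bound_nonneg[OF ne] f u by blast+
  have "\<bar>?h 1 - ?h 0\<bar> \<le> 6 * F * U * U"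
  proof (rule abs_diff_le_of_derivative_bound)
    fix s :: real assume s: "0 \<le> s" "s \<le> 1"
    show "(?h has_real_derivative (wcov T (tilt v (\<lambda>t. s * u t)) f u - wcov T v f u)) (at s)"
      by (auto intro!: derivative_eq_intros has_derivative_wavg_tilt[OF v])
    have su: "\<bar>s * u t\<bar> \<le> U" if "t \<in> T" for t
      using s u[OF that] mult_left_le_one_le[of "\<bar>u t\<bar>" s] by (simp add: abs_mult)
    show "\<bar>wcov T (tilt v (\<lambda>t. s * u t)) f u - wcov T v f u\<bar> \<le> 6 * F * U * U"
      by (rule wcov_tilt_diff[OF v f u su])
  qed
  then show ?thesis by (simp add: power2_eq_square algebra_simps)
qed

text \<open>The second-order cumulant expansion. It holds for tilts of every size, so that unbounded Gaussian
noise can be inserted without truncation.\<close>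

lemma ln_sum_tilt_expansion:
  assumes v: "weights T v" and u: "\<And>t. t \<in> T \<Longrightarrow> \<bar>u t\<bar> \<le> U"
  shows "\<bar>ln (sum (tilt v u) T) - ln (sum v T) - wavg T v u - wcov T v u u / 2\<bar> \<le> 6 * U ^ 3"
proof -
  let ?h = "\<lambda>s. ln (sum (tilt v (\<lambda>t. s * u t)) T) - s * wavg T v u - s\<^sup>2 / 2 * wcov T v u u"
  have U: "0 \<le> U" using bound_nonneg[OF weights_nonempty[OF v]] u by blast
  have "\<bar>?h 1 - ?h 0\<bar> \<le> 6 * U * U\<^sup>2"
  proof (rule abs_diff_le_of_derivative_bound)
    fix s :: real assume s: "0 \<le> s" "s \<le> 1"
    show "(?h has_real_derivative (wavg T (tilt v (\<lambda>t. s * u t)) u - wavg T v u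
             - wcov T v u (\<lambda>t. s * u t))) (at s)"
      by (rule DERIV_cong[OF DERIV_diff[OF DERIV_diff[OF has_derivative_ln_sum_tilt[OF v]]]])
        (auto intro!: derivative_eq_intros simp: wcov_cmult_right)
    have su: "\<bar>s * u t\<bar> \<le> U" if "t \<in> T" for t
      using s u[OF that] mult_left_le_one_le[of "\<bar>u t\<bar>" s] by (simp add: abs_mult)
    show "\<bar>wavg T (tilt v (\<lambda>t. s * u t)) u - wavg T v u - wcov T v u (\<lambda>t. s * u t)\<bar> \<le> 6 * U * U\<^sup>2"
      by (rule wavg_tilt_expansion[OF v u su])
  qed
  then show ?thesis by (simp add: power2_eq_square power3_eq_cube algebra_simps)
qed

lemma ln_sum_tilt_diff:
  assumes v: "weights T v" and u: "\<And>t. t \<in> T \<Longrightarrow> \<bar>u t\<bar> \<le> U"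
  shows "\<bar>ln (sum (tilt v u) T) - ln (sum v T)\<bar> \<le> U"
  using abs_diff_le_of_derivative_bound[OF has_derivative_ln_sum_tilt[OF v]
      abs_wavg_le[OF weights_tilt[OF v] u]]
  by simp

text \<open>Jensen's inequality in the form in which it expresses convexity of the log partition function: a
tangent lies below the graph.\<close>

lemma ln_sum_tilt_ge:
  assumes v: "weights T v"
  shows "ln (sum v T) + wavg T v u \<le> ln (sum (tilt v u) T)"
proof -
  let ?m = "wavg T v u"
  have pos: "0 < sum v T" "0 < sum (tilt v u) T"
    using v weights_tilt[OF v, of u] by (auto simp: weights_def)
  have "exp ?m = wavg T v (\<lambda>t. exp ?m * (1 + (u t - ?m)))"
    by (simp only: wavg_cmult wavg_add wavg_diff wavg_const[OF v]) simp
  also have "\<dots> \<le> wavg T v (\<lambda>t. exp (u t))"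
  proof (rule wavg_mono[OF v])
    fix t
    have "exp ?m * (1 + (u t - ?m)) \<le> exp ?m * exp (u t - ?m)"
      by (intro mult_left_mono exp_ge_add_one_self) auto
    then show "exp ?m * (1 + (u t - ?m)) \<le> exp (u t)" by (simp flip: exp_add)
  qed
  also have "\<dots> = sum (tilt v u) T / sum v T" by (simp add: wavg_def tilt_def)
  finally have "?m \<le> ln (sum (tilt v u) T / sum v T)"
    using pos by (metis divide_pos_pos exp_gt_zero ln_exp ln_mono)
  then show ?thesis using pos by (simp add: ln_div)
qed

section \<open>One noisy coordinate\<close>

text \<open>A term of the log-likelihood at a fixed value \<open>\<zeta>\<close> of the noise: linear in the
signal \<open>x\<close>, with a remainder that is quadratic in \<open>\<tau> = \<kappa> * (1 +
\<bar>\<zeta>\<bar>)\<close>. The remainder is also required to be at most linear in \<open>\<tau>\<close>,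
which keeps the third-order errors under control when \<open>\<tau>\<close> is large.\<close>

locale near_linear =
  fixes T :: "'t set" and v x l :: "'t \<Rightarrow> real" and A c \<kappa> \<zeta> :: real
  assumes v: "weights T v" and A: "1 \<le> A" "\<bar>c\<bar> \<le> A" and \<kappa>: "0 \<le> \<kappa>"
    and x: "\<And>t. t \<in> T \<Longrightarrow> \<bar>x t\<bar> \<le> \<kappa>"
    and rem: "\<And>t. t \<in> T \<Longrightarrow>
      \<bar>l t - c * \<zeta> * x t\<bar> \<le> A * min (\<kappa> * (1 + \<bar>\<zeta>\<bar>)) ((\<kappa> * (1 + \<bar>\<zeta>\<bar>))\<^sup>2)"
begin

definition "\<tau> = \<kappa> * (1 + \<bar>\<zeta>\<bar>)"
definition "r t = l t - c * \<zeta> * x t"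

lemma \<tau>: "0 \<le> \<tau>" "\<kappa> \<le> \<tau>" "\<kappa> * \<bar>\<zeta>\<bar> \<le> \<tau>"
  using \<kappa> by (auto simp: \<tau>_def algebra_simps)

lemma r1: "t \<in> T \<Longrightarrow> \<bar>r t\<bar> \<le> A * \<tau>" and r2: "t \<in> T \<Longrightarrow> \<bar>r t\<bar> \<le> A * \<tau>\<^sup>2"
proof -
  assume t: "t \<in> T"
  have "A * min \<tau> (\<tau>\<^sup>2) \<le> A * \<tau>" "A * min \<tau> (\<tau>\<^sup>2) \<le> A * \<tau>\<^sup>2"
    using A by (auto intro!: mult_left_mono)
  then show "\<bar>r t\<bar> \<le> A * \<tau>" "\<bar>r t\<bar> \<le> A * \<tau>\<^sup>2"
    using rem[OF t] unfolding r_def \<tau>_def by linarith+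
qed

lemma l_split: "l t = c * \<zeta> * x t + r t"
  by (simp add: r_def)

lemma wcov_l: "wcov T v f l = c * \<zeta> * wcov T v f x + wcov T v f r"
proof -
  have "wcov T v f l = wcov T v f (\<lambda>t. c * \<zeta> * x t + r t)"
    by (rule arg_cong[where f = "wcov T v f"]) (simp add: r_def)
  then show ?thesis by (simp only: wcov_add_right wcov_cmult_right)
qed

lemma c\<zeta>: "\<kappa> * \<bar>c * \<zeta>\<bar> \<le> A * \<tau>"
proof -
  have "\<bar>c\<bar> * (\<kappa> * \<bar>\<zeta>\<bar>) \<le> A * \<tau>" using A \<tau> \<kappa> by (intro mult_mono) auto
  then show ?thesis by (simp add: abs_mult algebra_simps)
qed

lemma l_le: assumes "t \<in> T" shows "\<bar>l t\<bar> \<le> 2 * A * \<tau>"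
proof -
  have "\<bar>c * \<zeta> * x t\<bar> \<le> \<bar>c * \<zeta>\<bar> * \<kappa>"
    unfolding abs_mult[of "c * \<zeta>"] using x[OF assms] by (intro mult_left_mono) auto
  then show ?thesis using c\<zeta> r1[OF assms] l_split[of t] by (simp add: algebra_simps)
qed

lemma ln_sum_tilt_near_linear:
  "\<bar>ln (sum (tilt v l) T) - ln (sum v T) - wavg T v l - c\<^sup>2 * \<zeta>\<^sup>2 * wcov T v x x / 2\<bar>
     \<le> 51 * A ^ 3 * \<tau> ^ 3"
proof -
  have "wcov T v l l = c * \<zeta> * wcov T v x l + wcov T v r l"
    using wcov_l[of l] wcov_commute[of T v l x] wcov_commute[of T v l r] by simp
  then have ll: "wcov T v l l - c\<^sup>2 * \<zeta>\<^sup>2 * wcov T v x x = 2 * ((c * \<zeta>) * wcov T v x r) + wcov T v r r"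
    by (simp add: wcov_l wcov_commute[of T v r x] power2_eq_square algebra_simps)
  have "\<bar>(c * \<zeta>) * wcov T v x r\<bar> \<le> \<bar>c * \<zeta>\<bar> * (2 * \<kappa> * (A * \<tau>\<^sup>2))"
    unfolding abs_mult[of "c * \<zeta>"] by (intro mult_left_mono abs_wcov_le[OF v x r2]) auto
  also have "\<dots> = (\<kappa> * \<bar>c * \<zeta>\<bar>) * (2 * A * \<tau>\<^sup>2)" by simp
  also have "\<dots> \<le> (A * \<tau>) * (2 * A * \<tau>\<^sup>2)"
    by (intro mult_right_mono c\<zeta>) (use A in auto)
  also have "\<dots> \<le> 2 * A ^ 3 * \<tau> ^ 3"
  proof -
    have "A\<^sup>2 * \<tau> ^ 3 \<le> A ^ 3 * \<tau> ^ 3"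
      using A \<tau> by (intro mult_right_mono power_increasing) auto
    then show ?thesis by (simp add: power2_eq_square power3_eq_cube algebra_simps)
  qed
  finally have 1: "\<bar>(c * \<zeta>) * wcov T v x r\<bar> \<le> 2 * A ^ 3 * \<tau> ^ 3" .
  have "\<bar>wcov T v r r\<bar> \<le> 2 * (A * \<tau>) * (A * \<tau>\<^sup>2)" by (rule abs_wcov_le[OF v r1 r2])
  also have "\<dots> \<le> 2 * A ^ 3 * \<tau> ^ 3"
  proof -
    have "A\<^sup>2 * \<tau> ^ 3 \<le> A ^ 3 * \<tau> ^ 3"
      using A \<tau> by (intro mult_right_mono power_increasing) auto
    then show ?thesis by (simp add: power2_eq_square power3_eq_cube algebra_simps)
  qed
  finally have 2: "\<bar>wcov T v r r\<bar> \<le> 2 * A ^ 3 * \<tau> ^ 3" .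
  have 3: "\<bar>ln (sum (tilt v l) T) - ln (sum v T) - wavg T v l - wcov T v l l / 2\<bar> \<le> 48 * A ^ 3 * \<tau> ^ 3"
    using ln_sum_tilt_expansion[where u = l, OF v l_le] by (simp add: power_mult_distrib)
  show ?thesis using 1 2 3 ll by (simp only: abs_le_iff) (elim conjE, intro conjI; linarith)
qed

lemma wavg_tilt_near_linear:
  "\<bar>wavg T (tilt v l) x - (wavg T v x + c * \<zeta> * wcov T v x x)\<bar> \<le> 26 * A\<^sup>2 * \<kappa> * \<tau>\<^sup>2"
proof -
  have "wcov T v x l = c * \<zeta> * wcov T v x x + wcov T v x r"
    by (rule wcov_l)
  moreover have "\<bar>wcov T v x r\<bar> \<le> 2 * \<kappa> * (A * \<tau>\<^sup>2)" by (rule abs_wcov_le[OF v x r2])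
  moreover have "2 * \<kappa> * (A * \<tau>\<^sup>2) \<le> 2 * A\<^sup>2 * \<kappa> * \<tau>\<^sup>2"
  proof -
    have "A * (2 * \<kappa> * \<tau>\<^sup>2) \<le> A\<^sup>2 * (2 * \<kappa> * \<tau>\<^sup>2)"
      using A \<kappa> self_le_power[of A 2] by (intro mult_right_mono) auto
    then show ?thesis by (simp add: algebra_simps)
  qed
  moreover have "\<bar>wavg T (tilt v l) x - wavg T v x - wcov T v x l\<bar> \<le> 24 * A\<^sup>2 * \<kappa> * \<tau>\<^sup>2"
    using wavg_tilt_expansion[where u = l and f = x, OF v x l_le] by (simp add: power_mult_distrib algebra_simps)
  ultimately show ?thesis by (simp only: abs_le_iff) (elim conjE, intro conjI; linarith)
qed

lemma wvar_tilt_near_linear: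
  "\<bar>wcov T (tilt v l) x x - wcov T v x x\<bar> \<le> 12 * A * \<tau> ^ 3"
proof -
  have "\<bar>wcov T (tilt v l) x x - wcov T v x x\<bar> \<le> 6 * \<kappa> * \<kappa> * (2 * A * \<tau>)"
    by (rule wcov_tilt_diff[OF v x x l_le])
  also have "\<dots> = 12 * A * ((\<kappa> * \<kappa>) * \<tau>)" by simp
  also have "\<dots> \<le> 12 * A * ((\<tau> * \<tau>) * \<tau>)"
    using A \<kappa> \<tau> by (intro mult_left_mono mult_right_mono mult_mono) auto
  finally show ?thesis by (simp add: power3_eq_cube)
qed

lemmas l_bound = l_le[unfolded \<tau>_def]
lemmas ln_sum_bound = ln_sum_tilt_near_linear[unfolded \<tau>_def]
lemmas wvar_bound = wvar_tilt_near_linear[unfolded \<tau>_def]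

end

text \<open>One coordinate of the observation, with noise law \<open>\<nu>\<close>, log-likelihood
\<open>l\<close>, signal \<open>x\<close> of size \<open>\<kappa>\<close> and expected log-likelihood
\<open>m\<close>. The number \<open>\<eta>\<close> is the third-order error scale: up to a constant it bounds
the third moment of \<open>\<kappa> * (1 + \<bar>\<zeta>\<bar>)\<close>, the error of \<open>m\<close>, and
the distance of the second moment of the noise from \<open>1\<close> in units of \<open>1 /
\<kappa>\<^sup>2\<close>. The mean \<open>\<mu>\<close> of the noise may be as large as the signal. Bernoulli
and Gaussian noise with the same \<open>c\<close>, \<open>x\<close> and \<open>m\<close> both satisfy these
conditions, and every estimate below depends on the coordinate only through these data.\<close>

locale channel = prob_space \<nu> for \<nu> :: "real measure" +
  fixes T :: "'t set" and l :: "real \<Rightarrow> 't \<Rightarrow> real" and x m :: "'t \<Rightarrow> real" and A c \<kappa> \<eta> \<mu> :: real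
  assumes sets_\<nu> [measurable_cong]: "sets \<nu> = sets borel"
    and A: "1 \<le> A" "\<bar>c\<bar> \<le> A" and \<kappa>: "0 \<le> \<kappa>" "\<kappa> \<le> 1"
    and x: "\<And>t. t \<in> T \<Longrightarrow> \<bar>x t\<bar> \<le> \<kappa>"
    and l_measurable [measurable]: "\<And>t. t \<in> T \<Longrightarrow> (\<lambda>\<zeta>. l \<zeta> t) \<in> borel_measurable borel"
    and rem: "AE \<zeta> in \<nu>. \<forall>t\<in>T.
      \<bar>l \<zeta> t - c * \<zeta> * x t\<bar> \<le> A * min (\<kappa> * (1 + \<bar>\<zeta>\<bar>)) ((\<kappa> * (1 + \<bar>\<zeta>\<bar>))\<^sup>2)"
    and third: "integrable \<nu> (\<lambda>\<zeta>. (1 + \<bar>\<zeta>\<bar>) ^ 3)" "\<kappa> ^ 3 * (\<integral>\<zeta>. (1 + \<bar>\<zeta>\<bar>) ^ 3 \<partial>\<nu>) \<le> A * \<eta>"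
    and first: "(\<integral>\<zeta>. \<zeta> \<partial>\<nu>) = \<mu>" "\<bar>\<mu>\<bar> \<le> A * \<kappa>"
    and second: "\<kappa>\<^sup>2 * \<bar>(\<integral>\<zeta>. \<zeta>\<^sup>2 \<partial>\<nu>) - 1\<bar> \<le> A * \<eta>"
    and mean: "\<And>t. t \<in> T \<Longrightarrow> \<bar>(\<integral>\<zeta>. l \<zeta> t \<partial>\<nu>) - m t\<bar> \<le> A * \<eta>"
begin

lemma near_linear_AE: "weights T v \<Longrightarrow> AE \<zeta> in \<nu>. near_linear T v x (l \<zeta>) A c \<kappa> \<zeta>"
  using rem by eventually_elim (unfold_locales, use A \<kappa> x in auto)

lemma integrable_of_growth:
  assumes [measurable]: "f \<in> borel_measurable borel" and "AE \<zeta> in \<nu>. \<bar>f \<zeta>\<bar> \<le> K * (1 + \<bar>\<zeta>\<bar>) ^ 3"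
  shows "integrable \<nu> (f :: real \<Rightarrow> real)"
  by (rule Bochner_Integration.integrable_bound[OF integrable_mult_right[OF third(1), of K]])
    (use assms(2) in \<open>auto elim!: eventually_mono\<close>)

lemma power_growth: "k \<le> 3 \<Longrightarrow> \<bar>\<zeta>::real\<bar> ^ k \<le> (1 + \<bar>\<zeta>\<bar>) ^ 3"
  by (rule order_trans[OF power_mono power_increasing]) auto

lemma integrable_id: "integrable \<nu> (\<lambda>\<zeta>. \<zeta>)"
  by (rule integrable_of_growth[where K = 1]) (use power_growth[of 1] in auto)

lemma integrable_sq: "integrable \<nu> (\<lambda>\<zeta>. \<zeta>\<^sup>2)"
  by (rule integrable_of_growth[where K = 1]) (use power_growth[of 2] in auto)

lemma \<tau>3_le: "(\<integral>\<zeta>. (\<kappa> * (1 + \<bar>\<zeta>\<bar>)) ^ 3 \<partial>\<nu>) \<le> A * \<eta>"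
  using third(2) by (simp add: power_mult_distrib)

lemma \<kappa>3_le: "\<kappa> ^ 3 \<le> A * \<eta>"
proof -
  have "(\<integral>\<zeta>. 1 \<partial>\<nu>) \<le> (\<integral>\<zeta>. (1 + \<bar>\<zeta>\<bar>) ^ 3 \<partial>\<nu>)"
    by (intro integral_mono third(1)) (auto intro!: one_le_power)
  then have "\<kappa> ^ 3 * 1 \<le> \<kappa> ^ 3 * (\<integral>\<zeta>. (1 + \<bar>\<zeta>\<bar>) ^ 3 \<partial>\<nu>)"
    using \<kappa> by (intro mult_left_mono) (auto simp: prob_space)
  then show ?thesis using third(2) by simp
qed

lemma \<eta>: "0 \<le> \<eta>"
proof -
  have "0 \<le> A * \<eta>" using \<kappa>3_le \<kappa> by (meson order_trans zero_le_power)
  then show ?thesis using A by (simp add: zero_le_mult_iff)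
qed

lemma A\<eta>_mono: "i \<le> j \<Longrightarrow> A ^ i * \<eta> \<le> A ^ j * \<eta>"
  using A \<eta> by (intro mult_right_mono power_increasing) auto

lemma growth_AE: "AE \<zeta> in \<nu>. \<forall>t\<in>T. \<bar>l \<zeta> t\<bar> \<le> 2 * A * (\<kappa> * (1 + \<bar>\<zeta>\<bar>))"
  using rem
proof eventually_elim
  case (elim \<zeta>)
  show ?case
  proof
    fix t assume t: "t \<in> T"
    have w: "weights {t} (\<lambda>_. 1)" by (auto simp: weights_def)
    interpret near_linear "{t}" "\<lambda>_. 1" x "l \<zeta>" A c \<kappa> \<zeta>
      by unfold_locales (use A \<kappa> x t elim w in auto)
    show "\<bar>l \<zeta> t\<bar> \<le> 2 * A * (\<kappa> * (1 + \<bar>\<zeta>\<bar>))" using l_le[of t] by (simp add: \<tau>_def)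
  qed
qed

lemma integrable_linear_growth:
  assumes [measurable]: "f \<in> borel_measurable borel" and "AE \<zeta> in \<nu>. \<bar>f \<zeta>\<bar> \<le> K * (1 + \<bar>\<zeta>\<bar>)"
  shows "integrable \<nu> (f :: real \<Rightarrow> real)"
proof -
  have "integrable \<nu> (\<lambda>\<zeta>. 1 + \<bar>\<zeta>\<bar>)" using integrable_id by auto
  from integrable_mult_right[OF this, of K] show ?thesis
    by (rule Bochner_Integration.integrable_bound) (use assms(2) in \<open>auto elim!: eventually_mono\<close>)
qed

lemma integrable_l: assumes "t \<in> T" shows "integrable \<nu> (\<lambda>\<zeta>. l \<zeta> t)"
  by (rule integrable_linear_growth[where K = "2 * A * \<kappa>"])
    (use growth_AE assms in \<open>auto elim!: eventually_mono simp: mult.assoc\<close>)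

lemma wavg_measurable [measurable]:
  assumes "weights T v" shows "(\<lambda>\<zeta>. wavg T (tilt v (l \<zeta>)) f) \<in> borel_measurable borel"
  unfolding wavg_def tilt_def by measurable

lemma wcov_measurable [measurable]:
  assumes "weights T v" shows "(\<lambda>\<zeta>. wcov T (tilt v (l \<zeta>)) f g) \<in> borel_measurable borel"
  unfolding wcov_def using assms by measurable

lemma ln_sum_measurable [measurable]:
  "(\<lambda>\<zeta>. ln (sum (tilt v (l \<zeta>)) T)) \<in> borel_measurable borel"
  unfolding tilt_def by measurable

lemma integrable_ln_sum:
  assumes v: "weights T v" shows "integrable \<nu> (\<lambda>\<zeta>. ln (sum (tilt v (l \<zeta>)) T))"
proof -
  have "integrable \<nu> (\<lambda>\<zeta>. ln (sum (tilt v (l \<zeta>)) T) - ln (sum v T))"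
  proof (rule integrable_linear_growth[where K = "2 * A * \<kappa>"])
    show "AE \<zeta> in \<nu>. \<bar>ln (sum (tilt v (l \<zeta>)) T) - ln (sum v T)\<bar> \<le> 2 * A * \<kappa> * (1 + \<bar>\<zeta>\<bar>)"
      using growth_AE by eventually_elim (auto intro!: ln_sum_tilt_diff[OF v] simp: mult.assoc)
  qed measurable
  from Bochner_Integration.integrable_add[OF this, of "\<lambda>_. ln (sum v T)"] show ?thesis by simp
qed

lemma abs_integral_le_\<tau>3:
  assumes f: "integrable \<nu> f" and "AE \<zeta> in \<nu>. \<bar>f \<zeta>\<bar> \<le> K * (\<kappa> * (1 + \<bar>\<zeta>\<bar>)) ^ 3" and K: "0 \<le> K"
  shows "\<bar>\<integral>\<zeta>. f \<zeta> \<partial>\<nu>\<bar> \<le> K * (A * \<eta>)"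
proof -
  have "\<bar>\<integral>\<zeta>. f \<zeta> \<partial>\<nu>\<bar> \<le> (\<integral>\<zeta>. K * (\<kappa> * (1 + \<bar>\<zeta>\<bar>)) ^ 3 \<partial>\<nu>)"
    by (rule integral_abs_bound[THEN order_trans], rule integral_mono_AE)
      (use assms third(1) in \<open>auto simp: power_mult_distrib\<close>)
  also have "\<dots> \<le> K * (A * \<eta>)" using \<tau>3_le K by (simp add: mult_left_mono)
  finally show ?thesis .
qed

text \<open>The expected effect of one coordinate on the log partition function depends on its noise only
through \<open>m\<close> and \<open>c\<close>, up to third order; this universal value is what makes two noise
laws exchangeable.\<close>

lemma free_energy_increment:
  assumes v: "weights T v"
  shows "\<bar>(\<integral>\<zeta>. ln (sum (tilt v (l \<zeta>)) T) \<partial>\<nu>) - (ln (sum v T) + wavg T v m + c\<^sup>2 * wcov T v x x / 2)\<bar>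
    \<le> 53 * A ^ 4 * \<eta>"
proof -
  let ?V = "wcov T v x x"
  let ?g = "\<lambda>\<zeta>. ln (sum (tilt v (l \<zeta>)) T) - ln (sum v T) - wavg T v (l \<zeta>) - c\<^sup>2 * \<zeta>\<^sup>2 * ?V / 2"
  have fin: "finite T" using v by (simp add: weights_def)
  have four: "51 * A ^ 3 * (A * \<eta>) = 51 * (A ^ 4 * \<eta>)"
    by (simp add: eval_nat_numeral)
  have int_avg: "integrable \<nu> (\<lambda>\<zeta>. wavg T v (l \<zeta>))"
    unfolding wavg_def by (auto intro!: Bochner_Integration.integrable_sum integrable_l)
  have avg: "(\<integral>\<zeta>. wavg T v (l \<zeta>) \<partial>\<nu>) = wavg T v (\<lambda>t. \<integral>\<zeta>. l \<zeta> t \<partial>\<nu>)"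
    unfolding wavg_def by (simp add: Bochner_Integration.integral_sum integrable_l)
  have int_g: "integrable \<nu> ?g"
    using integrable_ln_sum[OF v] int_avg integrable_sq by auto
  have "\<bar>\<integral>\<zeta>. ?g \<zeta> \<partial>\<nu>\<bar> \<le> 51 * A ^ 3 * (A * \<eta>)"
    by (rule abs_integral_le_\<tau>3[OF int_g])
      (use near_linear_AE[OF v] A in
        \<open>auto elim!: eventually_mono dest: near_linear.ln_sum_bound\<close>)
  moreover have "(\<integral>\<zeta>. ?g \<zeta> \<partial>\<nu>) = (\<integral>\<zeta>. ln (sum (tilt v (l \<zeta>)) T) \<partial>\<nu>) - ln (sum v T)
      - wavg T v (\<lambda>t. \<integral>\<zeta>. l \<zeta> t \<partial>\<nu>) - c\<^sup>2 * (\<integral>\<zeta>. \<zeta>\<^sup>2 \<partial>\<nu>) * ?V / 2"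
    using integrable_ln_sum[OF v] int_avg integrable_sq by (simp add: prob_space avg)
  moreover have "\<bar>wavg T v (\<lambda>t. \<integral>\<zeta>. l \<zeta> t \<partial>\<nu>) - wavg T v m\<bar> \<le> A * \<eta>"
    unfolding wavg_diff[symmetric] by (rule abs_wavg_le[OF v mean])
  moreover have "\<bar>c\<^sup>2 * (\<integral>\<zeta>. \<zeta>\<^sup>2 \<partial>\<nu>) * ?V / 2 - c\<^sup>2 * ?V / 2\<bar> \<le> A ^ 3 * \<eta>"
  proof -
    have "\<bar>?V\<bar> \<le> 2 * \<kappa> * \<kappa>" by (rule abs_wcov_le[OF v x x])
    then have "\<bar>?V\<bar> * \<bar>(\<integral>\<zeta>. \<zeta>\<^sup>2 \<partial>\<nu>) - 1\<bar> \<le> (2 * \<kappa> * \<kappa>) * \<bar>(\<integral>\<zeta>. \<zeta>\<^sup>2 \<partial>\<nu>) - 1\<bar>"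
      by (rule mult_right_mono) simp
    also have "\<dots> \<le> 2 * (A * \<eta>)" using second by (simp add: power2_eq_square)
    finally have a: "\<bar>?V\<bar> * \<bar>(\<integral>\<zeta>. \<zeta>\<^sup>2 \<partial>\<nu>) - 1\<bar> \<le> 2 * (A * \<eta>)" .
    have "c\<^sup>2 \<le> A\<^sup>2" using A by (metis abs_ge_zero power2_abs power_mono)
    then have "c\<^sup>2 * (\<bar>?V\<bar> * \<bar>(\<integral>\<zeta>. \<zeta>\<^sup>2 \<partial>\<nu>) - 1\<bar>) \<le> A\<^sup>2 * (2 * (A * \<eta>))"
      by (rule mult_mono[OF _ a]) auto
    moreover have "\<bar>c\<^sup>2 * (\<integral>\<zeta>. \<zeta>\<^sup>2 \<partial>\<nu>) * ?V / 2 - c\<^sup>2 * ?V / 2\<bar>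
        = c\<^sup>2 * (\<bar>?V\<bar> * \<bar>(\<integral>\<zeta>. \<zeta>\<^sup>2 \<partial>\<nu>) - 1\<bar>) / 2"
      by (subst abs_mult[symmetric], subst abs_of_nonneg[of "c\<^sup>2", symmetric], simp,
          subst abs_mult[symmetric]) (simp add: algebra_simps flip: diff_divide_distrib)
    ultimately show ?thesis by (simp add: power2_eq_square power3_eq_cube algebra_simps)
  qed
  ultimately show ?thesis
    using A\<eta>_mono[of 1 4, simplified] A\<eta>_mono[of 3 4, simplified] four
    by (simp only: abs_le_iff) (elim conjE, intro conjI; linarith)
qed

lemma integrable_response:
  assumes v: "weights T v" shows "integrable \<nu> (\<lambda>\<zeta>. (\<zeta> - \<mu>) * wavg T (tilt v (l \<zeta>)) x)"
    (is "integrable \<nu> ?f")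
proof (rule integrable_linear_growth[where K = "(1 + \<bar>\<mu>\<bar>) * \<kappa>"])
  show "AE \<zeta> in \<nu>. \<bar>?f \<zeta>\<bar> \<le> (1 + \<bar>\<mu>\<bar>) * \<kappa> * (1 + \<bar>\<zeta>\<bar>)"
  proof (rule AE_I2)
    fix \<zeta>
    have "\<bar>\<zeta> - \<mu>\<bar> \<le> (1 + \<bar>\<mu>\<bar>) * (1 + \<bar>\<zeta>\<bar>)"
    proof -
      have "(1 + \<bar>\<mu>\<bar>) * (1 + \<bar>\<zeta>\<bar>) = 1 + \<bar>\<mu>\<bar> + \<bar>\<zeta>\<bar> + \<bar>\<mu>\<bar> * \<bar>\<zeta>\<bar>"
        by (simp add: algebra_simps)
      moreover have "0 \<le> \<bar>\<mu>\<bar> * \<bar>\<zeta>\<bar>" by simp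
      ultimately show ?thesis by linarith
    qed
    then have "\<bar>\<zeta> - \<mu>\<bar> * \<bar>wavg T (tilt v (l \<zeta>)) x\<bar> \<le> (1 + \<bar>\<mu>\<bar>) * (1 + \<bar>\<zeta>\<bar>) * \<kappa>"
      by (rule mult_mono[OF _ abs_wavg_le[where f = x, OF weights_tilt[OF v] x]]) auto
    then show "\<bar>?f \<zeta>\<bar> \<le> (1 + \<bar>\<mu>\<bar>) * \<kappa> * (1 + \<bar>\<zeta>\<bar>)"
      unfolding abs_mult by (simp add: mult_ac)
  qed
qed (use v in measurable)

lemma integrable_wvar:
  assumes v: "weights T v" shows "integrable \<nu> (\<lambda>\<zeta>. wcov T (tilt v (l \<zeta>)) x x)"
  by (rule integrable_const_bound[where B = "2 * \<kappa> * \<kappa>"])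
    (use v abs_wcov_le[where f = x and g = x, OF weights_tilt[OF v] x x] in auto)

text \<open>Gaussian integration by parts up to third order: the noise enters the tilt through \<open>c *
\<zeta> * x\<close>, so its covariance with the average of \<open>x\<close> is \<open>c\<close> times the
variance of \<open>x\<close>.\<close>

lemma gaussian_ibp_approx:
  assumes v: "weights T v"
  shows "\<bar>(\<integral>\<zeta>. (\<zeta> - \<mu>) * wavg T (tilt v (l \<zeta>)) x \<partial>\<nu>) - c * (\<integral>\<zeta>. wcov T (tilt v (l \<zeta>)) x x \<partial>\<nu>)\<bar>
    \<le> 70 * A ^ 4 * \<eta>"
proof -
  let ?V = "wcov T v x x" and ?a = "wavg T v x"
  let ?f = "\<lambda>\<zeta>. (\<zeta> - \<mu>) * wavg T (tilt v (l \<zeta>)) x" and ?h = "\<lambda>\<zeta>. wcov T (tilt v (l \<zeta>)) x x"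
  let ?g = "\<lambda>\<zeta>. (\<zeta> - \<mu>) * (?a + c * \<zeta> * ?V)"
  have four: "52 * A ^ 3 * (A * \<eta>) = 52 * (A ^ 4 * \<eta>)"
    by (simp add: eval_nat_numeral)
  have \<mu>: "\<bar>\<mu>\<bar> \<le> A"
  proof -
    have "A * \<kappa> \<le> A * 1" using A \<kappa> by (intro mult_left_mono) auto
    then show ?thesis using first(2) by simp
  qed
  note int_f = integrable_response[OF v] and int_h = integrable_wvar[OF v]
  have g_eq: "?g = (\<lambda>\<zeta>. (?a - c * \<mu> * ?V) * \<zeta> + c * ?V * \<zeta>\<^sup>2 - \<mu> * ?a)"
    by (simp add: fun_eq_iff algebra_simps power2_eq_square)
  have int_g: "integrable \<nu> ?g"
    unfolding g_eq using integrable_id integrable_sq by auto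
  have g: "(\<integral>\<zeta>. ?g \<zeta> \<partial>\<nu>) = c * ?V * ((\<integral>\<zeta>. \<zeta>\<^sup>2 \<partial>\<nu>) - \<mu>\<^sup>2)"
    unfolding g_eq using integrable_id integrable_sq
    by (simp add: first(1) prob_space) (simp add: algebra_simps power2_eq_square)
  have fg: "\<bar>\<integral>\<zeta>. ?f \<zeta> - ?g \<zeta> \<partial>\<nu>\<bar> \<le> 52 * A ^ 3 * (A * \<eta>)"
  proof (rule abs_integral_le_\<tau>3)
    show "AE \<zeta> in \<nu>. \<bar>?f \<zeta> - ?g \<zeta>\<bar> \<le> 52 * A ^ 3 * (\<kappa> * (1 + \<bar>\<zeta>\<bar>)) ^ 3"
      using near_linear_AE[OF v]
    proof eventually_elim
      case (elim \<zeta>)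
      then interpret near_linear T v x "l \<zeta>" A c \<kappa> \<zeta> .
      have "\<bar>?f \<zeta> - ?g \<zeta>\<bar> = \<bar>\<zeta> - \<mu>\<bar> * \<bar>wavg T (tilt v (l \<zeta>)) x - (?a + c * \<zeta> * ?V)\<bar>"
        by (simp add: right_diff_distrib flip: abs_mult)
      also have "\<dots> \<le> \<bar>\<zeta> - \<mu>\<bar> * (26 * A\<^sup>2 * \<kappa> * \<tau>\<^sup>2)"
        by (intro mult_left_mono wavg_tilt_near_linear) auto
      also have "\<dots> = (26 * A\<^sup>2 * \<tau>\<^sup>2) * (\<kappa> * \<bar>\<zeta> - \<mu>\<bar>)" by simp
      also have "\<dots> \<le> (26 * A\<^sup>2 * \<tau>\<^sup>2) * (2 * A * \<tau>)"
      proof (rule mult_left_mono)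
        have "\<kappa> * \<bar>\<zeta> - \<mu>\<bar> \<le> \<kappa> * (\<bar>\<zeta>\<bar> + A)" using \<mu> \<kappa> by (intro mult_left_mono) auto
        also have "\<dots> \<le> \<tau> + A * \<tau>"
        proof -
          have "A * \<kappa> \<le> A * \<tau>" by (rule mult_left_mono[OF \<tau>(2)]) (use A in simp)
          then show ?thesis using \<tau>(3) by (simp add: algebra_simps)
        qed
        also have "\<dots> \<le> 2 * A * \<tau>" using A \<tau> mult_right_mono[OF A(1), of \<tau>] by simp
        finally show "\<kappa> * \<bar>\<zeta> - \<mu>\<bar> \<le> 2 * A * \<tau>" .
      qed (use A in auto)
      finally show ?case by (simp add: \<tau>_def power2_eq_square power3_eq_cube algebra_simps)
    qed
  qed (use int_f int_g A in auto)
  have hV: "\<bar>\<integral>\<zeta>. ?h \<zeta> - ?V \<partial>\<nu>\<bar> \<le> 12 * A * (A * \<eta>)"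
    by (rule abs_integral_le_\<tau>3)
      (use int_h near_linear_AE[OF v] A in
        \<open>auto elim!: eventually_mono dest: near_linear.wvar_bound\<close>)
  have hV': "\<bar>c * ((\<integral>\<zeta>. ?h \<zeta> \<partial>\<nu>) - ?V)\<bar> \<le> 12 * A ^ 3 * \<eta>"
  proof -
    have "\<bar>c\<bar> * \<bar>(\<integral>\<zeta>. ?h \<zeta> \<partial>\<nu>) - ?V\<bar> \<le> A * (12 * A * (A * \<eta>))"
      using hV int_h A by (intro mult_mono) (auto simp: prob_space)
    then show ?thesis unfolding abs_mult by (simp add: power3_eq_cube algebra_simps)
  qed
  have V: "\<bar>c * ?V * ((\<integral>\<zeta>. \<zeta>\<^sup>2 \<partial>\<nu>) - \<mu>\<^sup>2) - c * ?V\<bar> \<le> 2 * A\<^sup>2 * \<eta> + 2 * A ^ 4 * \<eta>"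
  proof -
    let ?d = "(\<integral>\<zeta>. \<zeta>\<^sup>2 \<partial>\<nu>) - 1 - \<mu>\<^sup>2"
    have mu2: "\<kappa>\<^sup>2 * \<mu>\<^sup>2 \<le> A ^ 3 * \<eta>"
    proof -
      have "\<mu>\<^sup>2 \<le> (A * \<kappa>)\<^sup>2" using first(2) by (metis abs_ge_zero power2_abs power_mono)
      then have "\<kappa>\<^sup>2 * \<mu>\<^sup>2 \<le> \<kappa>\<^sup>2 * (A * \<kappa>)\<^sup>2" by (intro mult_left_mono) auto
      also have "\<dots> = A\<^sup>2 * (\<kappa> ^ 3 * \<kappa>)" by (simp add: power2_eq_square power3_eq_cube)
      also have "\<dots> \<le> A\<^sup>2 * ((A * \<eta>) * 1)"
        using \<kappa> \<kappa>3_le A \<eta> by (intro mult_left_mono mult_mono) auto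
      finally show ?thesis by (simp add: power2_eq_square power3_eq_cube)
    qed
    have "\<bar>c * ?V\<bar> \<le> A * (2 * \<kappa> * \<kappa>)"
      unfolding abs_mult[of c] using A abs_wcov_le[OF v x x] by (intro mult_mono) auto
    then have "\<bar>c * ?V * ?d\<bar> \<le> A * (2 * \<kappa> * \<kappa>) * \<bar>?d\<bar>"
      unfolding abs_mult[of "c * ?V"] by (rule mult_right_mono) auto
    also have "\<dots> \<le> A * (2 * \<kappa> * \<kappa>) * (\<bar>(\<integral>\<zeta>. \<zeta>\<^sup>2 \<partial>\<nu>) - 1\<bar> + \<mu>\<^sup>2)"
    proof (rule mult_left_mono)
      show "\<bar>?d\<bar> \<le> \<bar>(\<integral>\<zeta>. \<zeta>\<^sup>2 \<partial>\<nu>) - 1\<bar> + \<mu>\<^sup>2"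
        using abs_triangle_ineq4[of "(\<integral>\<zeta>. \<zeta>\<^sup>2 \<partial>\<nu>) - 1" "\<mu>\<^sup>2"] by simp
    qed (use A \<kappa> in auto)
    also have "\<dots> = 2 * A * (\<kappa>\<^sup>2 * \<bar>(\<integral>\<zeta>. \<zeta>\<^sup>2 \<partial>\<nu>) - 1\<bar> + \<kappa>\<^sup>2 * \<mu>\<^sup>2)"
      by (simp add: power2_eq_square algebra_simps)
    also have "\<dots> \<le> 2 * A * (A * \<eta> + A ^ 3 * \<eta>)"
      using second mu2 A by (intro mult_left_mono add_mono) auto
    finally show ?thesis by (simp add: algebra_simps power2_eq_square eval_nat_numeral)
  qed
  have "(\<integral>\<zeta>. ?f \<zeta> - ?g \<zeta> \<partial>\<nu>) = (\<integral>\<zeta>. ?f \<zeta> \<partial>\<nu>) - (\<integral>\<zeta>. ?g \<zeta> \<partial>\<nu>)"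
    by (rule Bochner_Integration.integral_diff[OF int_f int_g])
  with fg hV' V show ?thesis
    unfolding g right_diff_distrib[of c]
    using A\<eta>_mono[of 2 4, simplified] A\<eta>_mono[of 3 4, simplified] four
    by (simp only: abs_le_iff) (elim conjE, intro conjI; linarith)
qed

end

section \<open>Independent coordinates\<close>

text \<open>A function that is not integrable has integral \<open>0\<close>, so the pointwise bound alone
controls the integral.\<close>

lemma (in prob_space) abs_integral_le_const:
  fixes g :: "'a \<Rightarrow> real"
  assumes "\<And>\<omega>. \<omega> \<in> space M \<Longrightarrow> \<bar>g \<omega>\<bar> \<le> e" and "0 \<le> e"
  shows "\<bar>\<integral>\<omega>. g \<omega> \<partial>M\<bar> \<le> e"
proof (cases "integrable M g")
  case True
  have "\<bar>\<integral>\<omega>. g \<omega> \<partial>M\<bar> \<le> (\<integral>\<omega>. e \<partial>M)"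
    by (rule integral_abs_bound[THEN order_trans], rule integral_mono)
      (use True assms in auto)
  then show ?thesis by (simp add: prob_space)
qed (use assms in \<open>simp add: not_integrable_integral_eq\<close>)

text \<open>Finitely many independent coordinates. The laws are probability measures for all indices, also
outside \<open>I\<close>, because the product of measures is formed for a total family.\<close>

locale channels =
  fixes I :: "'i set" and \<nu> :: "'i \<Rightarrow> real measure" and T :: "'t set" and l :: "'i \<Rightarrow> real \<Rightarrow> 't \<Rightarrow> real"
    and x m :: "'i \<Rightarrow> 't \<Rightarrow> real" and A c \<kappa> \<eta> :: real and \<mu> :: "'i \<Rightarrow> real" and v :: "'t \<Rightarrow> real"
  assumes finite_I: "finite I" and v: "weights T v"
    and prob_all: "\<And>i. prob_space (\<nu> i)"
    and channel: "\<And>i. i \<in> I \<Longrightarrow> channel (\<nu> i) T (l i) (x i) (m i) A c \<kappa> \<eta> (\<mu> i)"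
begin

sublocale P: product_prob_space \<nu> I
  using prob_all by (simp add: product_prob_space_def product_prob_space_axioms_def
      product_sigma_finite_def prob_space_imp_sigma_finite)

lemma prob_1: "measure (\<nu> i) (space (\<nu> i)) = 1"
  by (rule prob_space.prob_space[OF prob_all])

abbreviation "P \<equiv> PiM I \<nu>"

definition "pot J \<zeta> t = (\<Sum>i\<in>J. l i (\<zeta> i) t)"

lemma sets_\<nu>: "i \<in> I \<Longrightarrow> sets (\<nu> i) = sets borel"
  using channel channel.sets_\<nu> by blast

lemma component_measurable: "i \<in> I \<Longrightarrow> (\<lambda>\<zeta>. \<zeta> i) \<in> borel_measurable P"
  using measurable_component_singleton[of i I \<nu>] sets_\<nu> by (simp cong: measurable_cong_sets)

lemma l_measurable: "i \<in> I \<Longrightarrow> t \<in> T \<Longrightarrow> (\<lambda>\<zeta>. l i (\<zeta> i) t) \<in> borel_measurable P"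
  by (rule measurable_compose[OF component_measurable channel.l_measurable[OF channel]])

lemma pot_measurable: "J \<subseteq> I \<Longrightarrow> t \<in> T \<Longrightarrow> (\<lambda>\<zeta>. pot J \<zeta> t) \<in> borel_measurable P"
  unfolding pot_def by (auto intro!: borel_measurable_sum l_measurable)

lemma sum_tilt_measurable: "J \<subseteq> I \<Longrightarrow> (\<lambda>\<zeta>. \<Sum>t\<in>T. tilt v (pot J \<zeta>) t * f t) \<in> borel_measurable P"
  unfolding tilt_def
  by (intro borel_measurable_sum borel_measurable_times borel_measurable_const
      measurable_compose[OF pot_measurable borel_measurable_exp]) auto

lemma wavg_measurable: "J \<subseteq> I \<Longrightarrow> (\<lambda>\<zeta>. wavg T (tilt v (pot J \<zeta>)) f) \<in> borel_measurable P"
  unfolding wavg_def using sum_tilt_measurable[of J f] sum_tilt_measurable[of J "\<lambda>_. 1"] by simp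

lemma wcov_measurable: "J \<subseteq> I \<Longrightarrow> (\<lambda>\<zeta>. wcov T (tilt v (pot J \<zeta>)) f g) \<in> borel_measurable P"
  unfolding wcov_def using wavg_measurable by simp

lemma ln_sum_measurable: "J \<subseteq> I \<Longrightarrow> (\<lambda>\<zeta>. ln (sum (tilt v (pot J \<zeta>)) T)) \<in> borel_measurable P"
  using sum_tilt_measurable[of J "\<lambda>_. 1"] by simp

lemma integrable_component:
  assumes "i \<in> I" "integrable (\<nu> i) f"
  shows "integrable P (\<lambda>\<zeta>. f (\<zeta> i) :: real)"
  using assms integrable_distr_eq[of "\<lambda>\<zeta>. \<zeta> i" P "\<nu> i" f] P.PiM_component[OF assms(1)]
  by (simp add: borel_measurable_integrable)

lemma integrable_abs_component: "i \<in> I \<Longrightarrow> integrable P (\<lambda>\<zeta>. \<bar>\<zeta> i\<bar>)"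
  by (rule integrable_component) (auto intro: integrable_abs channel.integrable_id[OF channel])

lemma pot_growth:
  assumes "J \<subseteq> I"
  shows "AE \<zeta> in P. \<forall>t\<in>T. \<bar>pot J \<zeta> t\<bar> \<le> (\<Sum>i\<in>J. 2 * A * (\<kappa> * (1 + \<bar>\<zeta> i\<bar>)))"
proof -
  have "AE \<zeta> in P. \<forall>t\<in>T. \<bar>l i (\<zeta> i) t\<bar> \<le> 2 * A * (\<kappa> * (1 + \<bar>\<zeta> i\<bar>))" if "i \<in> J" for i
    by (rule AE_PiM_component[OF prob_all]) (use that assms channel.growth_AE[OF channel] in auto)
  then have "AE \<zeta> in P. \<forall>i\<in>J. \<forall>t\<in>T. \<bar>l i (\<zeta> i) t\<bar> \<le> 2 * A * (\<kappa> * (1 + \<bar>\<zeta> i\<bar>))"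
    by (rule AE_finite_allI[OF finite_subset[OF assms finite_I]])
  then show ?thesis
    unfolding pot_def by eventually_elim (auto intro!: order_trans[OF sum_abs] sum_mono)
qed

lemma integrable_ln_sum:
  assumes "J \<subseteq> I" shows "integrable P (\<lambda>\<zeta>. ln (sum (tilt v (pot J \<zeta>)) T))"
proof -
  have "integrable P (\<lambda>\<zeta>. \<Sum>i\<in>J. 2 * A * (\<kappa> * (1 + \<bar>\<zeta> i\<bar>)))"
    using assms by (auto intro!: Bochner_Integration.integrable_sum integrable_mult_right
        Bochner_Integration.integrable_add integrable_abs_component)
  then have "integrable P (\<lambda>\<zeta>. ln (sum (tilt v (pot J \<zeta>)) T) - ln (sum v T))"
  proof (rule Bochner_Integration.integrable_bound)
    show "AE \<zeta> in P. norm (ln (sum (tilt v (pot J \<zeta>)) T) - ln (sum v T))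
        \<le> norm (\<Sum>i\<in>J. 2 * A * (\<kappa> * (1 + \<bar>\<zeta> i\<bar>)))"
      using pot_growth[OF assms]
    proof eventually_elim
      case (elim \<zeta>)
      then show ?case
        using ln_sum_tilt_diff[OF v, of "pot J \<zeta>" "\<Sum>i\<in>J. 2 * A * (\<kappa> * (1 + \<bar>\<zeta> i\<bar>))"]
        by (auto simp: abs_le_iff)
    qed
  qed (use ln_sum_measurable[OF assms] in simp)
  from Bochner_Integration.integrable_add[OF this, of "\<lambda>_. ln (sum v T)"] show ?thesis by simp
qed

lemma integrable_wavg:
  assumes "J \<subseteq> I" shows "integrable P (\<lambda>\<zeta>. wavg T (tilt v (pot J \<zeta>)) f)"
proof (rule P.P.integrable_const_bound[where B = "\<Sum>t\<in>T. \<bar>f t\<bar>"])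
  have "\<bar>f t\<bar> \<le> (\<Sum>t\<in>T. \<bar>f t\<bar>)" if "t \<in> T" for t
    using v that by (intro member_le_sum) (auto simp: weights_def)
  then show "AE \<zeta> in P. norm (wavg T (tilt v (pot J \<zeta>)) f) \<le> (\<Sum>t\<in>T. \<bar>f t\<bar>)"
    by (auto intro!: abs_wavg_le[OF weights_tilt[OF v]])
qed (rule wavg_measurable[OF assms])

lemma integrable_wcov:
  assumes "J \<subseteq> I" shows "integrable P (\<lambda>\<zeta>. wcov T (tilt v (pot J \<zeta>)) f g)"
proof (rule P.P.integrable_const_bound[where B = "2 * (\<Sum>t\<in>T. \<bar>f t\<bar>) * (\<Sum>t\<in>T. \<bar>g t\<bar>)"])
  have "\<bar>f t\<bar> \<le> (\<Sum>t\<in>T. \<bar>f t\<bar>)" if "t \<in> T" for t and f :: "'t \<Rightarrow> real"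
    using v that by (intro member_le_sum) (auto simp: weights_def)
  then show "AE \<zeta> in P. norm (wcov T (tilt v (pot J \<zeta>)) f g) \<le> 2 * (\<Sum>t\<in>T. \<bar>f t\<bar>) * (\<Sum>t\<in>T. \<bar>g t\<bar>)"
    by (auto intro!: abs_wcov_le[OF weights_tilt[OF v]])
qed (rule wcov_measurable[OF assms])

text \<open>Fubini's theorem, with the coordinate \<open>\<alpha>\<close> integrated first. Together with the
next lemma it reduces every estimate on the product space to one coordinate, the others acting as fixed
weights.\<close>

lemma integral_remove:
  fixes f :: "('i \<Rightarrow> real) \<Rightarrow> real"
  assumes "\<alpha> \<in> I" and "integrable P f"
  shows "(\<integral>\<zeta>. f \<zeta> \<partial>P) = (\<integral>\<zeta>. (\<integral>y. f (\<zeta>(\<alpha> := y)) \<partial>\<nu> \<alpha>) \<partial>PiM (I - {\<alpha>}) \<nu>)"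
  using P.product_integral_insert[of "I - {\<alpha>}" \<alpha> f] assms finite_I by (simp add: insert_absorb)

lemma abs_integral_le_of_remove:
  fixes f :: "('i \<Rightarrow> real) \<Rightarrow> real"
  assumes "\<alpha> \<in> I" "integrable P f" "0 \<le> e"
    and "\<And>\<zeta>. \<bar>\<integral>y. f (\<zeta>(\<alpha> := y)) \<partial>\<nu> \<alpha>\<bar> \<le> e"
  shows "\<bar>\<integral>\<zeta>. f \<zeta> \<partial>P\<bar> \<le> e"
proof -
  interpret R: prob_space "PiM (I - {\<alpha>}) \<nu>" by (rule prob_space_PiM) (rule prob_all)
  show ?thesis unfolding integral_remove[OF assms(1,2)]
    by (rule R.abs_integral_le_const) (use assms in auto)
qed

lemma pot_remove: assumes "\<alpha> \<in> I" shows "pot I (\<zeta>(\<alpha> := y)) t = pot (I - {\<alpha>}) \<zeta> t + l \<alpha> y t"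
  unfolding pot_def using finite_I assms by (auto simp: sum.remove[of I \<alpha>] intro!: sum.cong)

lemma pot_remove': "pot (I - {\<alpha>}) (\<zeta>(\<alpha> := y)) = pot (I - {\<alpha>}) \<zeta>"
  unfolding pot_def by (auto simp: fun_eq_iff intro!: sum.cong)

lemma tilt_remove:
  "\<alpha> \<in> I \<Longrightarrow> tilt v (pot I (\<zeta>(\<alpha> := y))) = tilt (tilt v (pot (I - {\<alpha>}) \<zeta>)) (l \<alpha> y)"
  by (simp add: fun_eq_iff tilt_def pot_remove exp_add)

text \<open>The universal value of \<open>free_energy_increment\<close>, with the other coordinates as base
weights. It does not look at the coordinate \<open>\<alpha>\<close>, so it has the same expectation under two
products of measures that differ only there.\<close>

definition "cavity \<alpha> \<zeta> = (let w = tilt v (pot (I - {\<alpha>}) \<zeta>) in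
  ln (sum w T) + wavg T w (m \<alpha>) + c\<^sup>2 * wcov T w (x \<alpha>) (x \<alpha>) / 2)"

lemma cavity_remove: "cavity \<alpha> (\<zeta>(\<alpha> := y)) = cavity \<alpha> \<zeta>"
  unfolding cavity_def pot_remove' ..

lemma integrable_cavity: "integrable P (cavity \<alpha>)"
  unfolding cavity_def Let_def
  by (intro Bochner_Integration.integrable_add integrable_ln_sum integrable_wavg integrable_divide
      integrable_mult_right integrable_wcov) auto

lemma integral_ln_sum_cavity:
  assumes "\<alpha> \<in> I"
  shows "\<bar>(\<integral>\<zeta>. ln (sum (tilt v (pot I \<zeta>)) T) \<partial>P) - (\<integral>\<zeta>. cavity \<alpha> \<zeta> \<partial>P)\<bar> \<le> 53 * A ^ 4 * \<eta>"
proof -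
  interpret ch: channel "\<nu> \<alpha>" T "l \<alpha>" "x \<alpha>" "m \<alpha>" A c \<kappa> \<eta> "\<mu> \<alpha>" by (rule channel[OF assms])
  have "\<bar>\<integral>\<zeta>. ln (sum (tilt v (pot I \<zeta>)) T) - cavity \<alpha> \<zeta> \<partial>P\<bar> \<le> 53 * A ^ 4 * \<eta>"
  proof (rule abs_integral_le_of_remove[OF assms])
    fix \<zeta>
    let ?w = "tilt v (pot (I - {\<alpha>}) \<zeta>)"
    have w: "weights T ?w" by (rule weights_tilt[OF v])
    have eq: "(\<integral>y. ln (sum (tilt v (pot I (\<zeta>(\<alpha> := y)))) T) - cavity \<alpha> (\<zeta>(\<alpha> := y)) \<partial>\<nu> \<alpha>)
        = (\<integral>y. ln (sum (tilt ?w (l \<alpha> y)) T) \<partial>\<nu> \<alpha>) - cavity \<alpha> \<zeta>"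
      using ch.integrable_ln_sum[OF w] by (simp add: tilt_remove[OF assms] cavity_remove prob_1)
    show "\<bar>\<integral>y. ln (sum (tilt v (pot I (\<zeta>(\<alpha> := y)))) T) - cavity \<alpha> (\<zeta>(\<alpha> := y)) \<partial>\<nu> \<alpha>\<bar>
        \<le> 53 * A ^ 4 * \<eta>"
      using ch.free_energy_increment[OF w] unfolding eq by (simp only: cavity_def Let_def)
  qed (use integrable_ln_sum integrable_cavity ch.\<eta> ch.A in auto)
  then show ?thesis using integrable_ln_sum integrable_cavity by simp
qed

text \<open>Integration by parts in the coordinate \<open>\<alpha>\<close> with all the others frozen.\<close>

lemma integral_noise_response:
  assumes "\<alpha> \<in> I"
  shows "integrable P (\<lambda>\<zeta>. (\<zeta> \<alpha> - \<mu> \<alpha>) * wavg T (tilt v (pot I \<zeta>)) (x \<alpha>))"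
    and "\<bar>(\<integral>\<zeta>. (\<zeta> \<alpha> - \<mu> \<alpha>) * wavg T (tilt v (pot I \<zeta>)) (x \<alpha>) \<partial>P)
      - c * (\<integral>\<zeta>. wcov T (tilt v (pot I \<zeta>)) (x \<alpha>) (x \<alpha>) \<partial>P)\<bar> \<le> 70 * A ^ 4 * \<eta>"
proof -
  interpret ch: channel "\<nu> \<alpha>" T "l \<alpha>" "x \<alpha>" "m \<alpha>" A c \<kappa> \<eta> "\<mu> \<alpha>" by (rule channel[OF assms])
  let ?f = "\<lambda>\<zeta>. (\<zeta> \<alpha> - \<mu> \<alpha>) * wavg T (tilt v (pot I \<zeta>)) (x \<alpha>)"
  let ?h = "\<lambda>\<zeta>. wcov T (tilt v (pot I \<zeta>)) (x \<alpha>) (x \<alpha>)"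
  have "integrable P (\<lambda>\<zeta>. (\<bar>\<zeta> \<alpha>\<bar> + \<bar>\<mu> \<alpha>\<bar>) * \<kappa>)"
    using integrable_abs_component[OF assms] by auto
  then show int_f: "integrable P ?f"
  proof (rule Bochner_Integration.integrable_bound)
    show "AE \<zeta> in P. norm (?f \<zeta>) \<le> norm ((\<bar>\<zeta> \<alpha>\<bar> + \<bar>\<mu> \<alpha>\<bar>) * \<kappa>)"
    proof (rule AE_I2)
      fix \<zeta>
      have "\<bar>\<zeta> \<alpha> - \<mu> \<alpha>\<bar> * \<bar>wavg T (tilt v (pot I \<zeta>)) (x \<alpha>)\<bar> \<le> (\<bar>\<zeta> \<alpha>\<bar> + \<bar>\<mu> \<alpha>\<bar>) * \<kappa>"
        using abs_wavg_le[where f = "x \<alpha>", OF weights_tilt[OF v] ch.x] by (intro mult_mono) auto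
      also have "\<dots> \<le> \<bar>(\<bar>\<zeta> \<alpha>\<bar> + \<bar>\<mu> \<alpha>\<bar>) * \<kappa>\<bar>" by (rule abs_ge_self)
      finally show "norm (?f \<zeta>) \<le> norm ((\<bar>\<zeta> \<alpha>\<bar> + \<bar>\<mu> \<alpha>\<bar>) * \<kappa>)" by (simp add: abs_mult)
    qed
  qed (use component_measurable[OF assms] wavg_measurable in auto)
  have "\<bar>\<integral>\<zeta>. ?f \<zeta> - c * ?h \<zeta> \<partial>P\<bar> \<le> 70 * A ^ 4 * \<eta>"
  proof (rule abs_integral_le_of_remove[OF assms])
    fix \<zeta>
    let ?w = "tilt v (pot (I - {\<alpha>}) \<zeta>)"
    have w: "weights T ?w" by (rule weights_tilt[OF v])
    have i1: "integrable (\<nu> \<alpha>) (\<lambda>y. (y - \<mu> \<alpha>) * wavg T (tilt ?w (l \<alpha> y)) (x \<alpha>))"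
      by (rule ch.integrable_response[OF w])
    have i2: "integrable (\<nu> \<alpha>) (\<lambda>y. wcov T (tilt ?w (l \<alpha> y)) (x \<alpha>) (x \<alpha>))"
      by (rule ch.integrable_wvar[OF w])
    have "(\<integral>y. ?f (\<zeta>(\<alpha> := y)) - c * ?h (\<zeta>(\<alpha> := y)) \<partial>\<nu> \<alpha>)
        = (\<integral>y. (y - \<mu> \<alpha>) * wavg T (tilt ?w (l \<alpha> y)) (x \<alpha>) \<partial>\<nu> \<alpha>)
          - c * (\<integral>y. wcov T (tilt ?w (l \<alpha> y)) (x \<alpha>) (x \<alpha>) \<partial>\<nu> \<alpha>)"
      using i1 i2 by (simp add: tilt_remove[OF assms])
    then show "\<bar>\<integral>y. ?f (\<zeta>(\<alpha> := y)) - c * ?h (\<zeta>(\<alpha> := y)) \<partial>\<nu> \<alpha>\<bar> \<le> 70 * A ^ 4 * \<eta>"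
      using ch.gaussian_ibp_approx[OF w] by simp
  qed (use int_f integrable_wcov ch.\<eta> ch.A in auto)
  then show "\<bar>(\<integral>\<zeta>. ?f \<zeta> \<partial>P) - c * (\<integral>\<zeta>. ?h \<zeta> \<partial>P)\<bar> \<le> 70 * A ^ 4 * \<eta>"
    using int_f integrable_wcov by simp
qed

end

text \<open>Lindeberg's replacement method. The hybrid family uses the second channel on \<open>J\<close> and
the first one elsewhere; enlarging \<open>J\<close> by one index changes the expectation only by the distance
of both hybrids to their common cavity value.\<close>

lemma lindeberg_swap:
  assumes "channels I \<nu> T l x m A c \<kappa> \<eta> \<mu> v" "channels I \<nu>' T l' x m A c \<kappa> \<eta> \<mu>' v"
  shows "\<bar>(\<integral>\<zeta>. ln (sum (tilt v (channels.pot l I \<zeta>)) T) \<partial>PiM I \<nu>)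
     - (\<integral>\<zeta>. ln (sum (tilt v (channels.pot l' I \<zeta>)) T) \<partial>PiM I \<nu>')\<bar> \<le> real (card I) * (106 * A ^ 4 * \<eta>)"
proof -
  \<comment> \<open>\<open>F J\<close> is the expectation for the hybrid that uses the second channel exactly
    on \<open>J\<close>.\<close>
  define N where "N J i = (if i \<in> J then \<nu>' i else \<nu> i)" for J i
  define L where "L J i = (if i \<in> J then l' i else l i)" for J i
  define M where "M J i = (if i \<in> J then \<mu>' i else \<mu> i)" for J i
  define F where "F J = (\<integral>\<zeta>. ln (sum (tilt v (channels.pot (L J) I \<zeta>)) T) \<partial>PiM I (N J))" for J
  have hybrid: "channels I (N J) T (L J) x m A c \<kappa> \<eta> (M J) v" for J
    using assms unfolding channels_def N_def L_def M_def by auto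
  have finite_I: "finite I" using assms(1) by (simp add: channels_def)
  have step: "\<bar>F (insert \<alpha> J) - F J\<bar> \<le> 106 * A ^ 4 * \<eta>" if \<alpha>: "\<alpha> \<in> I" "\<alpha> \<notin> J" for \<alpha> J
  proof -
    interpret H: channels I "N J" T "L J" x m A c \<kappa> \<eta> "M J" v by (rule hybrid)
    interpret H': channels I "N (insert \<alpha> J)" T "L (insert \<alpha> J)" x m A c \<kappa> \<eta> "M (insert \<alpha> J)" v
      by (rule hybrid)
    have pot: "H'.pot (I - {\<alpha>}) = H.pot (I - {\<alpha>})"
      unfolding H.pot_def[abs_def] H'.pot_def[abs_def] by (auto simp: fun_eq_iff L_def intro!: sum.cong)
    then have cav: "H'.cavity \<alpha> = H.cavity \<alpha>"
      unfolding H.cavity_def[abs_def] H'.cavity_def[abs_def] by simp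
    have PiM: "PiM (I - {\<alpha>}) (N (insert \<alpha> J)) = PiM (I - {\<alpha>}) (N J)"
      by (rule PiM_cong) (auto simp: N_def)
    have "(\<integral>\<zeta>. H'.cavity \<alpha> \<zeta> \<partial>PiM I (N (insert \<alpha> J)))
        = (\<integral>\<zeta>. H'.cavity \<alpha> \<zeta> \<partial>PiM (I - {\<alpha>}) (N (insert \<alpha> J)))"
      unfolding H'.integral_remove[OF \<alpha>(1) H'.integrable_cavity]
      by (simp add: H'.cavity_remove H'.prob_1)
    also have "\<dots> = (\<integral>\<zeta>. H.cavity \<alpha> \<zeta> \<partial>PiM (I - {\<alpha>}) (N J))"
      unfolding PiM cav ..
    also have "\<dots> = (\<integral>\<zeta>. H.cavity \<alpha> \<zeta> \<partial>PiM I (N J))"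
      unfolding H.integral_remove[OF \<alpha>(1) H.integrable_cavity]
      by (simp add: H.cavity_remove H.prob_1)
    finally have "(\<integral>\<zeta>. H'.cavity \<alpha> \<zeta> \<partial>PiM I (N (insert \<alpha> J))) = (\<integral>\<zeta>. H.cavity \<alpha> \<zeta> \<partial>PiM I (N J))" .
    then show ?thesis
      using H.integral_ln_sum_cavity[OF \<alpha>(1)] H'.integral_ln_sum_cavity[OF \<alpha>(1)]
      unfolding F_def by linarith
  qed
  have "\<bar>F J - F {}\<bar> \<le> real (card J) * (106 * A ^ 4 * \<eta>)" if "finite J" "J \<subseteq> I" for J
    using that
  proof (induction J rule: finite_induct)
    case (insert \<alpha> J)
    have "real (card (insert \<alpha> J)) * (106 * A ^ 4 * \<eta>) = real (card J) * (106 * A ^ 4 * \<eta>) + 106 * A ^ 4 * \<eta>"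
      using insert by (simp add: algebra_simps)
    then show ?case using step[of \<alpha> J] insert by simp
  qed simp
  from this[OF finite_I subset_refl] have "\<bar>F I - F {}\<bar> \<le> real (card I) * (106 * A ^ 4 * \<eta>)" .
  moreover have "F {} = (\<integral>\<zeta>. ln (sum (tilt v (channels.pot l I \<zeta>)) T) \<partial>PiM I \<nu>)"
    by (simp add: F_def N_def[abs_def] L_def[abs_def])
  moreover have "F I = (\<integral>\<zeta>. ln (sum (tilt v (channels.pot l' I \<zeta>)) T) \<partial>PiM I \<nu>')"
  proof -
    have "PiM I (N I) = PiM I \<nu>'" by (rule PiM_cong) (auto simp: N_def)
    moreover have "channels.pot (L I) I = channels.pot l' I"
      unfolding channels.pot_def[OF hybrid, abs_def] channels.pot_def[OF assms(2), abs_def]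
      by (auto simp: fun_eq_iff L_def intro!: sum.cong)
    ultimately show ?thesis by (simp add: F_def)
  qed
  ultimately show ?thesis by linarith
qed

context channels
begin

text \<open>The perturbed process is the original one plus \<open>\<beta>\<close> times a random function of
\<open>t\<close>, for the same realisation of the noise. Convexity therefore bounds the increment of the free
energy from below by its slope, and the noise part of the slope is evaluated by integration by parts.\<close>

lemma free_energy_tangent:
  assumes "channels I \<nu> T l' x m' A c' \<kappa> \<eta> \<mu> v"
    and l': "\<And>i \<zeta> t. i \<in> I \<Longrightarrow> t \<in> T \<Longrightarrow> l' i \<zeta> t = l i \<zeta> t + \<beta> * (g i t + \<gamma> * ((\<zeta> - \<mu> i) * x i t))"
  shows "(\<integral>\<zeta>. ln (sum (tilt v (pot I \<zeta>)) T) \<partial>P)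
      + \<beta> * (\<integral>\<zeta>. (\<Sum>i\<in>I. wavg T (tilt v (pot I \<zeta>)) (g i) + \<gamma> * c * wcov T (tilt v (pot I \<zeta>)) (x i) (x i)) \<partial>P)
      - \<bar>\<beta> * \<gamma>\<bar> * real (card I) * (70 * A ^ 4 * \<eta>)
    \<le> (\<integral>\<zeta>. ln (sum (tilt v (channels.pot l' I \<zeta>)) T) \<partial>P)"
proof -
  interpret C': channels I \<nu> T l' x m' A c' \<kappa> \<eta> \<mu> v by fact
  let ?w = "\<lambda>\<zeta>. tilt v (pot I \<zeta>)"
  let ?noise = "\<lambda>\<zeta> i. (\<zeta> i - \<mu> i) * wavg T (?w \<zeta>) (x i)"
  let ?D = "\<lambda>\<zeta>. \<Sum>i\<in>I. wavg T (?w \<zeta>) (g i) + \<gamma> * ?noise \<zeta> i"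
  let ?E = "\<lambda>\<zeta>. \<Sum>i\<in>I. wavg T (?w \<zeta>) (g i) + \<gamma> * c * wcov T (?w \<zeta>) (x i) (x i)"
  have int_D: "integrable P ?D"
    by (intro Bochner_Integration.integrable_sum Bochner_Integration.integrable_add integrable_wavg
        integrable_mult_right integral_noise_response(1)) auto
  have int_E: "integrable P ?E"
    by (intro Bochner_Integration.integrable_sum Bochner_Integration.integrable_add integrable_wavg
        integrable_mult_right integrable_wcov) auto
  have pointwise: "ln (sum (?w \<zeta>) T) + \<beta> * ?D \<zeta> \<le> ln (sum (tilt v (C'.pot I \<zeta>)) T)" for \<zeta>
  proof -
    let ?u = "\<lambda>t. \<beta> * (\<Sum>i\<in>I. g i t + \<gamma> * ((\<zeta> i - \<mu> i) * x i t))"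
    have "tilt (?w \<zeta>) ?u t = tilt v (C'.pot I \<zeta>) t" if "t \<in> T" for t
      unfolding tilt_tilt unfolding tilt_def pot_def C'.pot_def
      by (simp add: l' that sum.distrib flip: sum_distrib_left)
    then have "sum (tilt (?w \<zeta>) ?u) T = sum (tilt v (C'.pot I \<zeta>)) T" by (rule sum.cong[OF refl])
    moreover have "wavg T (?w \<zeta>) ?u = \<beta> * ?D \<zeta>"
      by (simp add: wavg_cmult wavg_sum wavg_add)
    ultimately show ?thesis
      using ln_sum_tilt_ge[OF weights_tilt[OF v], of "pot I \<zeta>" ?u] by simp
  qed
  have "(\<integral>\<zeta>. ln (sum (?w \<zeta>) T) \<partial>P) + \<beta> * (\<integral>\<zeta>. ?D \<zeta> \<partial>P)
      = (\<integral>\<zeta>. ln (sum (?w \<zeta>) T) + \<beta> * ?D \<zeta> \<partial>P)"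
    using integrable_ln_sum[OF subset_refl] int_D by simp
  also have "\<dots> \<le> (\<integral>\<zeta>. ln (sum (tilt v (C'.pot I \<zeta>)) T) \<partial>P)"
    by (intro integral_mono pointwise C'.integrable_ln_sum Bochner_Integration.integrable_add
        integrable_ln_sum integrable_mult_right int_D) auto
  finally have 1: "(\<integral>\<zeta>. ln (sum (?w \<zeta>) T) \<partial>P) + \<beta> * (\<integral>\<zeta>. ?D \<zeta> \<partial>P)
      \<le> (\<integral>\<zeta>. ln (sum (tilt v (C'.pot I \<zeta>)) T) \<partial>P)" .
  let ?N = "\<lambda>i. \<integral>\<zeta>. ?noise \<zeta> i \<partial>P" and ?V = "\<lambda>i. \<integral>\<zeta>. wcov T (?w \<zeta>) (x i) (x i) \<partial>P"
  have D: "(\<integral>\<zeta>. ?D \<zeta> \<partial>P) = (\<Sum>i\<in>I. (\<integral>\<zeta>. wavg T (?w \<zeta>) (g i) \<partial>P) + \<gamma> * ?N i)"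
  proof (subst Bochner_Integration.integral_sum)
    fix i assume i: "i \<in> I"
    show "integrable P (\<lambda>\<zeta>. wavg T (?w \<zeta>) (g i) + \<gamma> * ?noise \<zeta> i)"
      by (intro Bochner_Integration.integrable_add integrable_wavg
        integrable_mult_right integral_noise_response(1)[OF i]) auto
  qed (intro sum.cong refl, subst Bochner_Integration.integral_add,
      auto intro!: integrable_wavg integrable_mult_right integral_noise_response(1))
  have E: "(\<integral>\<zeta>. ?E \<zeta> \<partial>P) = (\<Sum>i\<in>I. (\<integral>\<zeta>. wavg T (?w \<zeta>) (g i) \<partial>P) + \<gamma> * (c * ?V i))"
    using integrable_wavg[OF subset_refl] integrable_wcov[OF subset_refl]
    by (simp add: mult.assoc)
  have "\<bar>(\<integral>\<zeta>. ?D \<zeta> \<partial>P) - (\<integral>\<zeta>. ?E \<zeta> \<partial>P)\<bar> = \<bar>\<Sum>i\<in>I. \<gamma> * (?N i - c * ?V i)\<bar>"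
    unfolding D E sum_subtractf[symmetric] by (simp add: algebra_simps)
  also have "\<dots> \<le> (\<Sum>i\<in>I. \<bar>\<gamma>\<bar> * (70 * A ^ 4 * \<eta>))"
    unfolding abs_mult[symmetric]
    by (rule order_trans[OF sum_abs], rule sum_mono, unfold abs_mult[of \<gamma>], rule mult_left_mono)
      (use integral_noise_response(2) in auto)
  finally have "\<bar>\<beta>\<bar> * \<bar>(\<integral>\<zeta>. ?D \<zeta> \<partial>P) - (\<integral>\<zeta>. ?E \<zeta> \<partial>P)\<bar> \<le> \<bar>\<beta>\<bar> * (real (card I) * (\<bar>\<gamma>\<bar> * (70 * A ^ 4 * \<eta>)))"
    by (simp add: mult_left_mono)
  then have "\<bar>\<beta> * (\<integral>\<zeta>. ?D \<zeta> \<partial>P) - \<beta> * (\<integral>\<zeta>. ?E \<zeta> \<partial>P)\<bar> \<le> \<bar>\<beta> * \<gamma>\<bar> * real (card I) * (70 * A ^ 4 * \<eta>)"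
    unfolding abs_mult[of \<beta>, symmetric] right_diff_distrib by (simp add: abs_mult mult_ac)
  then show ?thesis using 1 by (simp only: abs_le_iff) linarith
qed

end

section \<open>The two noise laws\<close>

definition two_point :: "real \<Rightarrow> real \<Rightarrow> real measure" where
  "two_point b p = distr (measure_pmf (bernoulli_pmf p)) borel (\<lambda>g. if g then b else - 1 / b)"

definition std_gauss :: "real measure" where
  "std_gauss = density lborel std_normal_density"

lemma prob_space_two_point: "prob_space (two_point b p)"
  unfolding two_point_def by (intro measure_pmf.prob_space_distr) simp

lemma sets_two_point [measurable_cong]: "sets (two_point b p) = sets borel"
  by (simp add: two_point_def)

lemma integral_two_point:
  fixes f :: "real \<Rightarrow> real"
  assumes "0 \<le> p" "p \<le> 1" "f \<in> borel_measurable borel"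
  shows "(\<integral>\<zeta>. f \<zeta> \<partial>two_point b p) = p * f b + (1 - p) * f (- 1 / b)"
  unfolding two_point_def using assms by (subst integral_distr) (auto simp: mult.commute)

lemma integrable_two_point:
  fixes f :: "real \<Rightarrow> real"
  assumes "f \<in> borel_measurable borel"
  shows "integrable (two_point b p) f"
  unfolding two_point_def using assms
  by (subst integrable_distr_eq) (auto intro: integrable_measure_pmf_finite)

lemma AE_two_point: "Q b \<Longrightarrow> Q (- 1 / b) \<Longrightarrow> Measurable.pred borel Q \<Longrightarrow> AE \<zeta> in two_point b p. Q \<zeta>"
  unfolding two_point_def by (subst AE_distr_iff) auto

lemma prob_space_std_gauss: "prob_space std_gauss"
  unfolding std_gauss_def by (rule prob_space_normal_density) simp

lemma sets_std_gauss [measurable_cong]: "sets std_gauss = sets borel"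
  by (simp add: std_gauss_def)

lemma std_gauss_moment:
  "integrable std_gauss (\<lambda>\<zeta>. \<zeta> ^ k)"
  "(\<integral>\<zeta>. \<zeta> \<partial>std_gauss) = 0" "(\<integral>\<zeta>. \<zeta>\<^sup>2 \<partial>std_gauss) = 1" "(\<integral>\<zeta>. \<zeta> ^ 4 \<partial>std_gauss) = 3"
proof -
  show "integrable std_gauss (\<lambda>\<zeta>. \<zeta> ^ k)"
    unfolding std_gauss_def using integrable_normal_moment[of 1 0 k] by (subst integrable_density) auto
  show "(\<integral>\<zeta>. \<zeta> \<partial>std_gauss) = 0"
    unfolding std_gauss_def using integral_normal_moment_odd[of 1 0 0] by (subst integral_density) auto
  show "(\<integral>\<zeta>. \<zeta>\<^sup>2 \<partial>std_gauss) = 1"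
    unfolding std_gauss_def using integral_normal_moment_even[of 1 0 1]
    by (subst integral_density) (auto simp: eval_nat_numeral)
  show "(\<integral>\<zeta>. \<zeta> ^ 4 \<partial>std_gauss) = 3"
    unfolding std_gauss_def using integral_normal_moment_even[of 1 0 2]
    by (subst integral_density) (auto simp: fact_numeral power2_eq_square)
qed

text \<open>Equality holds at \<open>z = 1\<close>: the difference of the two sides is \<open>3 * (1 + z) * (1
- z)\<^sup>2\<close>.\<close>

lemma cube_one_plus_le: "0 \<le> (z::real) \<Longrightarrow> (1 + z) ^ 3 \<le> 4 + 4 * z ^ 3"
proof -
  assume z: "0 \<le> z"
  have "0 \<le> 3 * ((1 + z) * (1 - z)\<^sup>2)" using z by (intro mult_nonneg_nonneg) auto
  also have "\<dots> = 4 + 4 * z ^ 3 - (1 + z) ^ 3"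
    by (simp add: power2_eq_square power3_eq_cube algebra_simps)
  finally show ?thesis by simp
qed

lemma third_moment_std_gauss:
  "integrable std_gauss (\<lambda>\<zeta>. (1 + \<bar>\<zeta>\<bar>) ^ 3)" "(\<integral>\<zeta>. (1 + \<bar>\<zeta>\<bar>) ^ 3 \<partial>std_gauss) \<le> 20"
proof -
  interpret prob_space std_gauss by (rule prob_space_std_gauss)
  have bound: "(1 + \<bar>\<zeta>\<bar>) ^ 3 \<le> 8 + 4 * \<zeta> ^ 4" for \<zeta> :: real
  proof -
    have "\<bar>\<zeta>\<bar> ^ 3 \<le> 1 + \<bar>\<zeta>\<bar> ^ 4"
    proof (cases "\<bar>\<zeta>\<bar> \<le> 1")
      case True then show ?thesis using power_le_one[of "\<bar>\<zeta>\<bar>" 3] zero_le_power[of "\<bar>\<zeta>\<bar>" 4] by linarith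
    next
      case False then show ?thesis using power_increasing[of 3 4 "\<bar>\<zeta>\<bar>"] by simp
    qed
    then show ?thesis using cube_one_plus_le[of "\<bar>\<zeta>\<bar>"] by simp
  qed
  have int: "integrable std_gauss (\<lambda>\<zeta>. 8 + 4 * \<zeta> ^ 4)" using std_gauss_moment(1)[of 4] by simp
  show *: "integrable std_gauss (\<lambda>\<zeta>. (1 + \<bar>\<zeta>\<bar>) ^ 3)"
  proof (rule Bochner_Integration.integrable_bound[OF int])
    show "AE \<zeta> in std_gauss. norm ((1 + \<bar>\<zeta>\<bar>) ^ 3) \<le> norm (8 + 4 * \<zeta> ^ 4)"
      using bound by (auto intro!: AE_I2 order_trans[OF bound abs_ge_self])
  qed measurable
  have "(\<integral>\<zeta>. (1 + \<bar>\<zeta>\<bar>) ^ 3 \<partial>std_gauss) \<le> (\<integral>\<zeta>. 8 + 4 * \<zeta> ^ 4 \<partial>std_gauss)"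
    by (rule integral_mono[OF * int bound])
  then show "(\<integral>\<zeta>. (1 + \<bar>\<zeta>\<bar>) ^ 3 \<partial>std_gauss) \<le> 20"
    using std_gauss_moment(1)[of 4] std_gauss_moment(4) by (simp add: prob_space)
qed

lemma ln_one_plus_quadratic:
  fixes w :: real assumes "\<bar>w\<bar> \<le> 1 / 2"
  shows "\<bar>ln (1 + w) - w + w\<^sup>2 / 2\<bar> \<le> 2 * \<bar>w\<bar> ^ 3"
proof -
  let ?h = "\<lambda>s. ln (1 + s * w) - s * w + (s * w)\<^sup>2 / 2"
  have pos: "1 / 2 \<le> 1 + s * w" if "0 \<le> s" "s \<le> 1" for s
    using assms that mult_left_le_one_le[of "\<bar>w\<bar>" s] abs_ge_minus_self[of "s * w"] by (simp add: abs_mult)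
  have "\<bar>?h 1 - ?h 0\<bar> \<le> 2 * \<bar>w\<bar> ^ 3"
  proof (rule abs_diff_le_of_derivative_bound)
    fix s :: real assume s: "0 \<le> s" "s \<le> 1"
    show "(?h has_real_derivative (w * (s * w)\<^sup>2 / (1 + s * w))) (at s)"
      using pos[OF s]
      by (auto intro!: derivative_eq_intros simp: field_simps power2_eq_square)
    have "(s * w)\<^sup>2 \<le> w\<^sup>2"
      using s by (simp add: power_mult_distrib mult_left_le_one_le power_le_one)
    then have "\<bar>w\<bar> * (s * w)\<^sup>2 / (1 + s * w) \<le> \<bar>w\<bar> * w\<^sup>2 / (1 / 2)"
      using pos[OF s] by (intro frac_le mult_left_mono) auto
    then show "\<bar>w * (s * w)\<^sup>2 / (1 + s * w)\<bar> \<le> 2 * \<bar>w\<bar> ^ 3"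
      using pos[OF s] by (simp add: abs_mult power2_eq_square power3_eq_cube)
  qed
  then show ?thesis by simp
qed

section \<open>Bernoulli against Gaussian observations\<close>

text \<open>The model with a finitely supported prior: parameters \<open>t \<in> T\<close> with weights
\<open>v\<close>, signals \<open>x i t\<close>, and true signals \<open>y i\<close>. The labels enter only
through \<open>b\<close>; the success probability of label \<open>i\<close> is \<open>(1 / b + sqrt lams * y
i) / (b + 1 / b)\<close>. The sum \<open>D = b + 1 / b\<close> is the reciprocal of the standard deviation
\<open>sqrt (q * (1 - q))\<close> of an unperturbed label and bounds the standardised noise.\<close>

locale comparison =
  fixes I :: "'i set" and T :: "'t set" and v :: "'t \<Rightarrow> real" and x :: "'i \<Rightarrow> 't \<Rightarrow> real"
    and y :: "'i \<Rightarrow> real" and \<kappa> b lam lams :: real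
  assumes finite_I: "finite I" and v: "weights T v" and lam: "0 < lam" and lams: "0 < lams"
    and x: "\<And>i t. i \<in> I \<Longrightarrow> t \<in> T \<Longrightarrow> \<bar>x i t\<bar> \<le> \<kappa>" and y: "\<And>i. i \<in> I \<Longrightarrow> \<bar>y i\<bar> \<le> \<kappa>"
    and \<kappa>: "0 \<le> \<kappa>" and b: "0 < b"
    and small: "\<kappa> * (b + 1 / b) \<le> 1 / 2" "sqrt lam * \<kappa> * (b + 1 / b) \<le> 1 / 2"
    and success: "\<And>i. i \<in> I \<Longrightarrow> 0 \<le> 1 / b + sqrt lams * y i"
      "\<And>i. i \<in> I \<Longrightarrow> 0 \<le> b - sqrt lams * y i"
begin

definition "s = sqrt lam"
definition "s' = sqrt lams"
definition "D = b + 1 / b"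
definition "\<eta> = \<kappa> ^ 3 * D"
definition "p i = (1 / b + s' * y i) / D"
text \<open>A constant that depends on \<open>lam\<close> and \<open>lams\<close> only and dominates every
bound that the two channels have to meet; these bounds are listed in \<open>A_ge\<close>.\<close>

definition "A = 20 + s + 1 / s + 2 * s\<^sup>2 + s' / s + s * s' + 4 * s' + 2 * s ^ 3 * (6 + 4 * s') + s\<^sup>2 * s'"
definition "c \<beta> = s + \<beta> / s"
definition "\<nu>B i = two_point b (p i)"
text \<open>The log-likelihood of label \<open>i\<close> with the perturbation of strength
\<open>\<beta>\<close> added. Its Gaussian counterpart \<open>lG\<close> is the second-order expansion: the
same mean \<open>m\<close> up to third order and the same linear response \<open>c \<beta>\<close> to the
noise.\<close>

definition "lB a \<beta> i \<zeta> t = ln (1 + \<zeta> * s * x i t) + \<beta> * (a * (y i - x i t)\<^sup>2 + (\<zeta> - s' * y i) * x i t / s)"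
definition "m a \<beta> i t = s * s' * y i * x i t - s\<^sup>2 * (x i t)\<^sup>2 / 2 + \<beta> * a * (y i - x i t)\<^sup>2"
definition "lG a \<beta> i \<zeta> t = m a \<beta> i t + c \<beta> * \<zeta> * x i t"

lemma s: "0 < s" "0 < s'" using lam lams by (auto simp: s_def s'_def)

lemma D_ge: "2 \<le> D"
proof -
  have "0 \<le> (b - 1)\<^sup>2 / b" using b by simp
  also have "\<dots> = D - 2" using b by (simp add: D_def field_simps power2_eq_square)
  finally show ?thesis by simp
qed

lemma \<kappa>D: "\<kappa> * D \<le> 1 / 2" "s * \<kappa> * D \<le> 1 / 2"
  using small by (auto simp: D_def s_def)

lemma \<kappa>_le: "\<kappa> \<le> 1 / 4"
proof -
  have "\<kappa> * 2 \<le> \<kappa> * D" using D_ge \<kappa> by (intro mult_left_mono) auto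
  then show ?thesis using \<kappa>D by simp
qed

lemma \<eta>_nonneg: "0 \<le> \<eta>"
  using \<kappa> D_ge by (simp add: \<eta>_def)

lemma A_ge:
  "1 \<le> A" "20 \<le> A" "s + 1 / s \<le> A" "2 * s\<^sup>2 + 4 + s' / s \<le> A" "s * s' + s\<^sup>2 + 4 \<le> A" "6 + 4 * s' \<le> A" "s' \<le> A"
  "2 * s ^ 3 * (6 + 4 * s') + s\<^sup>2 * s' / 2 \<le> A"
proof -
  have "0 \<le> s" "0 \<le> 1 / s" "0 \<le> s\<^sup>2" "0 \<le> s' / s" "0 \<le> s * s'" "0 \<le> s'"
    "0 \<le> 2 * s ^ 3 * (6 + 4 * s')" "0 \<le> s\<^sup>2 * s'"
    using s by auto
  then show "1 \<le> A" "20 \<le> A" "s + 1 / s \<le> A" "2 * s\<^sup>2 + 4 + s' / s \<le> A" "s * s' + s\<^sup>2 + 4 \<le> A"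
    "6 + 4 * s' \<le> A" "s' \<le> A" "2 * s ^ 3 * (6 + 4 * s') + s\<^sup>2 * s' / 2 \<le> A"
    unfolding A_def by linarith+
qed

lemma c_bound: "\<bar>\<beta>\<bar> \<le> 1 \<Longrightarrow> \<bar>c \<beta>\<bar> \<le> A"
proof -
  assume "\<bar>\<beta>\<bar> \<le> 1"
  then have "\<bar>\<beta> / s\<bar> \<le> 1 / s" using s by (simp add: divide_right_mono)
  then show ?thesis unfolding c_def using A_ge(3) s by linarith
qed

lemma sq_le: "i \<in> I \<Longrightarrow> t \<in> T \<Longrightarrow> (x i t)\<^sup>2 \<le> \<kappa>\<^sup>2"
  using x abs_le_square_iff[of "x i t" \<kappa>] \<kappa> by auto

lemma yx_le: "i \<in> I \<Longrightarrow> t \<in> T \<Longrightarrow> \<bar>y i * x i t\<bar> \<le> \<kappa>\<^sup>2"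
  unfolding power2_eq_square abs_mult using x y \<kappa> by (intro mult_mono) auto

lemma sq_diff_le: assumes "i \<in> I" "t \<in> T" shows "(y i - x i t)\<^sup>2 \<le> 4 * \<kappa>\<^sup>2"
proof -
  have "\<bar>y i - x i t\<bar> \<le> 2 * \<kappa>" using x[OF assms] y[OF assms(1)] by linarith
  then have "(y i - x i t)\<^sup>2 \<le> (2 * \<kappa>)\<^sup>2" by (metis abs_ge_zero power2_abs power_mono)
  then show ?thesis by simp
qed

lemma perturb_le: assumes "i \<in> I" "t \<in> T" "\<bar>a\<bar> \<le> 1" "\<bar>\<beta>\<bar> \<le> 1"
  shows "\<bar>\<beta> * a * (y i - x i t)\<^sup>2\<bar> \<le> 4 * \<kappa>\<^sup>2"
proof -
  have "\<bar>\<beta> * a\<bar> * (y i - x i t)\<^sup>2 \<le> 1 * (4 * \<kappa>\<^sup>2)"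
    using assms sq_diff_le[OF assms(1,2)] mult_mono[of "\<bar>\<beta>\<bar>" 1 "\<bar>a\<bar>" 1]
    by (intro mult_mono) (auto simp: abs_mult)
  then show ?thesis by (simp add: abs_mult)
qed

lemma rem_bound:
  assumes \<tau>: "\<kappa> \<le> \<tau>" and r: "\<bar>r\<bar> \<le> A * \<kappa>\<^sup>2"
  shows "\<bar>r\<bar> \<le> A * min \<tau> (\<tau>\<^sup>2)"
proof -
  have "\<kappa>\<^sup>2 \<le> \<tau>\<^sup>2" using \<tau> \<kappa> by (intro power_mono) auto
  moreover have "\<kappa>\<^sup>2 \<le> \<tau>"
  proof -
    have "\<kappa> * \<kappa> \<le> 1 * \<kappa>" using \<kappa> \<kappa>_le by (intro mult_right_mono) auto
    then show ?thesis using \<tau> by (simp add: power2_eq_square)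
  qed
  ultimately have "A * \<kappa>\<^sup>2 \<le> A * min \<tau> (\<tau>\<^sup>2)" using A_ge(1) by (intro mult_left_mono) auto
  then show ?thesis using r by simp
qed

lemma gauss_channel:
  assumes i: "i \<in> I" and a: "\<bar>a\<bar> \<le> 1" and \<beta>: "\<bar>\<beta>\<bar> \<le> 1"
  shows "channel std_gauss T (lG a \<beta> i) (x i) (m a \<beta> i) A (c \<beta>) \<kappa> \<eta> 0"
proof -
  interpret prob_space std_gauss by (rule prob_space_std_gauss)
  show ?thesis
  proof
    show "1 \<le> A" "\<bar>c \<beta>\<bar> \<le> A" "0 \<le> \<kappa>" "\<kappa> \<le> 1" using A_ge c_bound \<beta> \<kappa> \<kappa>_le by auto
    show "\<bar>x i t\<bar> \<le> \<kappa>" if "t \<in> T" for t using x i that by auto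
    show "(\<lambda>\<zeta>. lG a \<beta> i \<zeta> t) \<in> borel_measurable borel" for t unfolding lG_def by measurable
    show "AE \<zeta> in std_gauss. \<forall>t\<in>T. \<bar>lG a \<beta> i \<zeta> t - c \<beta> * \<zeta> * x i t\<bar>
        \<le> A * min (\<kappa> * (1 + \<bar>\<zeta>\<bar>)) ((\<kappa> * (1 + \<bar>\<zeta>\<bar>))\<^sup>2)"
    proof (intro AE_I2 ballI rem_bound)
      fix \<zeta> t assume t: "t \<in> T"
      show "\<kappa> \<le> \<kappa> * (1 + \<bar>\<zeta>\<bar>)" using \<kappa> by (simp add: algebra_simps)
      have "s * s' * \<bar>y i * x i t\<bar> \<le> s * s' * \<kappa>\<^sup>2"
        using yx_le[OF i t] s by (intro mult_left_mono) auto
      then have 1: "\<bar>s * s' * y i * x i t\<bar> \<le> s * s' * \<kappa>\<^sup>2" using s by (simp add: abs_mult mult.assoc)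
      have 2: "s\<^sup>2 * (x i t)\<^sup>2 \<le> s\<^sup>2 * \<kappa>\<^sup>2" "0 \<le> s\<^sup>2 * (x i t)\<^sup>2" using sq_le[OF i t] by (auto intro: mult_left_mono)
      have "(s * s' + s\<^sup>2 + 4) * \<kappa>\<^sup>2 \<le> A * \<kappa>\<^sup>2" using A_ge(5) by (rule mult_right_mono) simp
      then show "\<bar>lG a \<beta> i \<zeta> t - c \<beta> * \<zeta> * x i t\<bar> \<le> A * \<kappa>\<^sup>2"
        using 1 2 perturb_le[OF i t a \<beta>] unfolding lG_def m_def distrib_right by linarith
    qed
    show "integrable std_gauss (\<lambda>\<zeta>. (1 + \<bar>\<zeta>\<bar>) ^ 3)" by (rule third_moment_std_gauss)
    have "(\<integral>\<zeta>. (1 + \<bar>\<zeta>\<bar>) ^ 3 \<partial>std_gauss) \<le> A * D"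
      using third_moment_std_gauss(2) A_ge(2) D_ge mult_mono[of 20 A 1 D] by simp
    then show "\<kappa> ^ 3 * (\<integral>\<zeta>. (1 + \<bar>\<zeta>\<bar>) ^ 3 \<partial>std_gauss) \<le> A * \<eta>"
    proof -
      assume "(\<integral>\<zeta>. (1 + \<bar>\<zeta>\<bar>) ^ 3 \<partial>std_gauss) \<le> A * D"
      then have "\<kappa> ^ 3 * (\<integral>\<zeta>. (1 + \<bar>\<zeta>\<bar>) ^ 3 \<partial>std_gauss) \<le> \<kappa> ^ 3 * (A * D)"
        using \<kappa> by (intro mult_left_mono) auto
      then show ?thesis by (simp add: \<eta>_def mult.left_commute)
    qed
    show "(\<integral>\<zeta>. \<zeta> \<partial>std_gauss) = 0" by (rule std_gauss_moment)
    show "\<bar>0\<bar> \<le> A * \<kappa>" using A_ge \<kappa> by simp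
    show "\<kappa>\<^sup>2 * \<bar>(\<integral>\<zeta>. \<zeta>\<^sup>2 \<partial>std_gauss) - 1\<bar> \<le> A * \<eta>"
      using A_ge \<eta>_nonneg by (simp add: std_gauss_moment)
    show "\<bar>(\<integral>\<zeta>. lG a \<beta> i \<zeta> t \<partial>std_gauss) - m a \<beta> i t\<bar> \<le> A * \<eta>" for t
      unfolding lG_def using std_gauss_moment(1)[of 1] A_ge \<eta>_nonneg
      by (simp add: std_gauss_moment(2) prob_space)
  qed (rule sets_std_gauss)
qed

lemma p: assumes "i \<in> I" shows "0 \<le> p i" "p i \<le> 1"
  using success[OF assms] D_ge by (auto simp: p_def s'_def D_def)

lemma mean_noise: "i \<in> I \<Longrightarrow> (\<integral>\<zeta>. \<zeta> \<partial>\<nu>B i) = s' * y i"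
proof -
  assume i: "i \<in> I"
  have "p i * D = 1 / b + s' * y i" using D_ge by (simp add: p_def)
  moreover have "(\<integral>\<zeta>. \<zeta> \<partial>\<nu>B i) = p i * D - 1 / b"
    unfolding \<nu>B_def using p[OF i] by (subst integral_two_point) (auto simp: D_def algebra_simps)
  ultimately show ?thesis by simp
qed

text \<open>On its two values \<open>b\<close> and \<open>- 1 / b\<close> the noise solves \<open>\<zeta>\<^sup>2 = 1 + (b - 1 / b) * \<zeta>\<close>, so its mean
determines its second moment.\<close>

lemma second_moment: "i \<in> I \<Longrightarrow> (\<integral>\<zeta>. \<zeta>\<^sup>2 \<partial>\<nu>B i) = 1 + (b - 1 / b) * (s' * y i)"
proof -
  assume i: "i \<in> I"
  have "(\<integral>\<zeta>. \<zeta>\<^sup>2 \<partial>\<nu>B i) = (\<integral>\<zeta>. 1 + (b - 1 / b) * \<zeta> \<partial>\<nu>B i)"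
  proof -
    have "b\<^sup>2 = 1 + (b - 1 / b) * b" "(- 1 / b)\<^sup>2 = 1 + (b - 1 / b) * (- 1 / b)"
      using b by (simp_all add: field_simps power2_eq_square)
    then show ?thesis
      unfolding \<nu>B_def using p[OF i] by (subst (1 2) integral_two_point) (simp_all only:, measurable)
  qed
  also have "\<dots> = 1 + (b - 1 / b) * (\<integral>\<zeta>. \<zeta> \<partial>\<nu>B i)"
    unfolding \<nu>B_def using p[OF i] b by (subst (1 2) integral_two_point) (auto simp: field_simps)
  finally show ?thesis using mean_noise[OF i] by simp
qed

text \<open>Through this bound the third moment exceeds the second one by a factor \<open>D\<close>;
\<open>\<kappa> * D\<close> is of order \<open>\<delta>\<^sub>n\<close>.\<close>

lemma AE_noise: "AE \<zeta> in \<nu>B i. \<bar>\<zeta>\<bar> \<le> D"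
  unfolding \<nu>B_def by (rule AE_two_point) (use b in \<open>auto simp: D_def\<close>)

lemma second_moment_diff: assumes i: "i \<in> I" shows "\<bar>(\<integral>\<zeta>. \<zeta>\<^sup>2 \<partial>\<nu>B i) - 1\<bar> \<le> D * s' * \<kappa>"
proof -
  have "\<bar>b - 1 / b\<bar> \<le> D" using b unfolding D_def by (simp add: abs_le_iff)
  then have "\<bar>b - 1 / b\<bar> * (s' * \<bar>y i\<bar>) \<le> D * (s' * \<kappa>)"
    using s y[OF i] D_ge by (intro mult_mono) auto
  then show ?thesis unfolding second_moment[OF i] using s by (simp add: abs_mult mult.assoc)
qed

lemma third_moment: assumes i: "i \<in> I" shows "(\<integral>\<zeta>. (1 + \<bar>\<zeta>\<bar>) ^ 3 \<partial>\<nu>B i) \<le> (6 + 4 * s') * D"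
proof -
  interpret prob_space "\<nu>B i" unfolding \<nu>B_def by (rule prob_space_two_point)
  have int: "integrable (\<nu>B i) f" if "f \<in> borel_measurable borel" for f :: "real \<Rightarrow> real"
    unfolding \<nu>B_def by (rule integrable_two_point[OF that])
  have "(\<integral>\<zeta>. (1 + \<bar>\<zeta>\<bar>) ^ 3 \<partial>\<nu>B i) \<le> (\<integral>\<zeta>. 4 + 4 * D * \<zeta>\<^sup>2 \<partial>\<nu>B i)"
  proof (rule integral_mono_AE)
    show "AE \<zeta> in \<nu>B i. (1 + \<bar>\<zeta>\<bar>) ^ 3 \<le> 4 + 4 * D * \<zeta>\<^sup>2"
      using AE_noise
    proof eventually_elim
      case (elim \<zeta>)
      have "\<bar>\<zeta>\<bar> ^ 3 \<le> D * \<zeta>\<^sup>2"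
        using mult_right_mono[OF elim, of "\<zeta>\<^sup>2"] by (simp add: power3_eq_cube power2_eq_square mult.assoc)
      then show ?case using cube_one_plus_le[of "\<bar>\<zeta>\<bar>"] by simp
    qed
  qed (auto intro!: int)
  also have "\<dots> = 4 + 4 * D * (\<integral>\<zeta>. \<zeta>\<^sup>2 \<partial>\<nu>B i)"
    using int[of "\<lambda>\<zeta>. \<zeta>\<^sup>2"] by (simp add: prob_space)
  also have "\<dots> \<le> 4 + 4 * D * (1 + s')"
  proof -
    have "D * s' * \<kappa> \<le> s'"
      using mult_right_mono[OF \<kappa>D(1), of s'] s by (simp add: mult_ac)
    then have "(\<integral>\<zeta>. \<zeta>\<^sup>2 \<partial>\<nu>B i) \<le> 1 + s'" using second_moment_diff[OF i] by linarith
    then show ?thesis using D_ge by (intro add_left_mono mult_left_mono) auto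
  qed
  also have "\<dots> \<le> (6 + 4 * s') * D" using D_ge by (simp add: algebra_simps)
  finally show ?thesis .
qed

lemma bern_arg_small:
  assumes "i \<in> I" "t \<in> T" "\<bar>\<zeta>\<bar> \<le> D"
  shows "\<bar>\<zeta> * s * x i t\<bar> \<le> 1 / 2"
proof -
  have "(\<bar>\<zeta>\<bar> * s) * \<bar>x i t\<bar> \<le> (D * s) * \<kappa>"
    using assms x s by (intro mult_mono) auto
  moreover have "\<bar>\<zeta> * s * x i t\<bar> = (\<bar>\<zeta>\<bar> * s) * \<bar>x i t\<bar>" using s by (simp add: abs_mult)
  moreover have "(D * s) * \<kappa> = s * \<kappa> * D" by simp
  ultimately show ?thesis using \<kappa>D(2) by linarith
qed

text \<open>For the first two moments, the expansion \<open>ln (1 + w) = w - w\<^sup>2 / 2\<close> with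
\<open>w = \<zeta> * s * x\<close> turns the Bernoulli log-likelihood into the Gaussian one; the smallness
assumptions keep \<open>\<bar>w\<bar> \<le> 1 / 2\<close> on the support of the noise.\<close>

lemma bern_channel:
  assumes i: "i \<in> I" and a: "\<bar>a\<bar> \<le> 1" and \<beta>: "\<bar>\<beta>\<bar> \<le> 1"
  shows "channel (\<nu>B i) T (lB a \<beta> i) (x i) (m a \<beta> i) A (c \<beta>) \<kappa> \<eta> (s' * y i)"
proof -
  interpret prob_space "\<nu>B i" unfolding \<nu>B_def by (rule prob_space_two_point)
  have int: "integrable (\<nu>B i) f" if "f \<in> borel_measurable borel" for f :: "real \<Rightarrow> real"
    unfolding \<nu>B_def by (rule integrable_two_point[OF that])
  have [measurable_cong]: "sets (\<nu>B i) = sets borel" unfolding \<nu>B_def by (rule sets_two_point)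
  have third: "\<kappa> ^ 3 * (\<integral>\<zeta>. (1 + \<bar>\<zeta>\<bar>) ^ 3 \<partial>\<nu>B i) \<le> (6 + 4 * s') * \<eta>"
    using mult_left_mono[OF third_moment[OF i], of "\<kappa> ^ 3"] \<kappa> by (simp add: \<eta>_def mult_ac)
  show ?thesis
  proof
    show "1 \<le> A" "\<bar>c \<beta>\<bar> \<le> A" "0 \<le> \<kappa>" "\<kappa> \<le> 1" using A_ge c_bound \<beta> \<kappa> \<kappa>_le by auto
    show "\<bar>x i t\<bar> \<le> \<kappa>" if "t \<in> T" for t using x i that by auto
    show meas: "(\<lambda>\<zeta>. lB a \<beta> i \<zeta> t) \<in> borel_measurable borel" for t unfolding lB_def by measurable
    show "AE \<zeta> in \<nu>B i. \<forall>t\<in>T. \<bar>lB a \<beta> i \<zeta> t - c \<beta> * \<zeta> * x i t\<bar>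
        \<le> A * min (\<kappa> * (1 + \<bar>\<zeta>\<bar>)) ((\<kappa> * (1 + \<bar>\<zeta>\<bar>))\<^sup>2)"
      using AE_noise
    proof eventually_elim
      case (elim \<zeta>)
      show ?case
      proof
        fix t assume t: "t \<in> T"
        let ?\<tau> = "\<kappa> * (1 + \<bar>\<zeta>\<bar>)" and ?w = "\<zeta> * s * x i t"
        have \<tau>: "\<kappa> \<le> ?\<tau>" "\<bar>\<zeta>\<bar> * \<kappa> \<le> ?\<tau>" "0 \<le> ?\<tau>" using \<kappa> by (auto simp: algebra_simps)
        have "?\<tau> \<le> \<kappa> * (1 + D)" using elim \<kappa> by (intro mult_left_mono) auto
        also have "\<dots> \<le> 1" using \<kappa>_le \<kappa>D by (simp add: distrib_left)
        finally have \<tau>1: "?\<tau> \<le> 1" .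
        have "\<bar>\<zeta> * x i t\<bar> \<le> ?\<tau>"
          using mult_left_mono[OF x[OF i t], of "\<bar>\<zeta>\<bar>"] \<tau>(2) by (simp add: abs_mult)
        then have "(\<zeta> * x i t)\<^sup>2 \<le> ?\<tau>\<^sup>2" by (metis abs_ge_zero power2_abs power_mono)
        then have "s\<^sup>2 * (\<zeta> * x i t)\<^sup>2 \<le> s\<^sup>2 * ?\<tau>\<^sup>2" by (rule mult_left_mono) simp
        then have w2: "?w\<^sup>2 \<le> s\<^sup>2 * ?\<tau>\<^sup>2" by (simp add: power_mult_distrib mult_ac)
        have 1: "\<bar>ln (1 + ?w) - ?w\<bar> \<le> 2 * (s\<^sup>2 * ?\<tau>\<^sup>2)"
          using abs_ln_one_plus_x_minus_x_bound[OF bern_arg_small[OF i t elim]] w2 by linarith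
        have \<kappa>\<tau>: "\<kappa>\<^sup>2 \<le> ?\<tau>\<^sup>2" using \<tau> \<kappa> by (intro power_mono) auto
        have 2: "\<bar>\<beta> * a * (y i - x i t)\<^sup>2\<bar> \<le> 4 * ?\<tau>\<^sup>2"
          using perturb_le[OF i t a \<beta>] \<kappa>\<tau> by linarith
        have "\<bar>\<beta>\<bar> * (s' / s * \<bar>y i * x i t\<bar>) \<le> 1 * (s' / s * ?\<tau>\<^sup>2)"
          using \<beta> yx_le[OF i t] \<kappa>\<tau> s by (intro mult_mono) auto
        then have 3: "\<bar>\<beta> * (s' * y i * x i t / s)\<bar> \<le> s' / s * ?\<tau>\<^sup>2"
          using s by (simp add: abs_mult mult_ac)
        have "lB a \<beta> i \<zeta> t - c \<beta> * \<zeta> * x i t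
            = (ln (1 + ?w) - ?w) + \<beta> * a * (y i - x i t)\<^sup>2 - \<beta> * (s' * y i * x i t / s)"
          unfolding lB_def c_def using s by (simp add: field_simps)
        then have "\<bar>lB a \<beta> i \<zeta> t - c \<beta> * \<zeta> * x i t\<bar> \<le> (2 * s\<^sup>2 + 4 + s' / s) * ?\<tau>\<^sup>2"
          using 1 2 3 unfolding distrib_right by linarith
        also have "\<dots> \<le> A * min ?\<tau> (?\<tau>\<^sup>2)"
          using A_ge(1,4) \<tau>1 \<tau>(3) by (intro mult_mono) (auto simp: power2_eq_square mult_left_le)
        finally show "\<bar>lB a \<beta> i \<zeta> t - c \<beta> * \<zeta> * x i t\<bar> \<le> A * min ?\<tau> (?\<tau>\<^sup>2)" .
      qed
    qed
    show "integrable (\<nu>B i) (\<lambda>\<zeta>. (1 + \<bar>\<zeta>\<bar>) ^ 3)" by (rule int) measurable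
    show "\<kappa> ^ 3 * (\<integral>\<zeta>. (1 + \<bar>\<zeta>\<bar>) ^ 3 \<partial>\<nu>B i) \<le> A * \<eta>"
      using third mult_right_mono[OF A_ge(6) \<eta>_nonneg] by linarith
    show "(\<integral>\<zeta>. \<zeta> \<partial>\<nu>B i) = s' * y i" by (rule mean_noise[OF i])
    show "\<bar>s' * y i\<bar> \<le> A * \<kappa>"
      using A_ge(7) s y[OF i] mult_mono[of s' A "\<bar>y i\<bar>" \<kappa>] by (simp add: abs_mult)
    show "\<kappa>\<^sup>2 * \<bar>(\<integral>\<zeta>. \<zeta>\<^sup>2 \<partial>\<nu>B i) - 1\<bar> \<le> A * \<eta>"
    proof -
      have "\<kappa>\<^sup>2 * \<bar>(\<integral>\<zeta>. \<zeta>\<^sup>2 \<partial>\<nu>B i) - 1\<bar> \<le> \<kappa>\<^sup>2 * (D * s' * \<kappa>)"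
        by (intro mult_left_mono second_moment_diff i) simp
      also have "\<dots> = s' * \<eta>" by (simp add: \<eta>_def power2_eq_square power3_eq_cube)
      also have "\<dots> \<le> A * \<eta>" by (rule mult_right_mono[OF A_ge(7) \<eta>_nonneg])
      finally show ?thesis .
    qed
    fix t assume t: "t \<in> T"
    let ?w = "\<lambda>\<zeta>. \<zeta> * s * x i t"
    let ?q = "\<lambda>\<zeta>. s * x i t * \<zeta> - s\<^sup>2 * (x i t)\<^sup>2 / 2 * \<zeta>\<^sup>2 + \<beta> * a * (y i - x i t)\<^sup>2
      + \<beta> * x i t / s * (\<zeta> - s' * y i)"
    have q_measurable: "?q \<in> borel_measurable borel"
      by (intro borel_measurable_continuous_onI continuous_intros)
    have q: "(\<integral>\<zeta>. ?q \<zeta> \<partial>\<nu>B i) = m a \<beta> i t - s\<^sup>2 * (x i t)\<^sup>2 / 2 * ((\<integral>\<zeta>. \<zeta>\<^sup>2 \<partial>\<nu>B i) - 1)"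
    proof -
      have "(\<integral>\<zeta>. c1 * \<zeta> - c2 * \<zeta>\<^sup>2 + c3 + c4 * (\<zeta> - s' * y i) \<partial>\<nu>B i)
          = c1 * (s' * y i) - c2 * (\<integral>\<zeta>. \<zeta>\<^sup>2 \<partial>\<nu>B i) + c3" for c1 c2 c3 c4
      proof -
        have i1: "integrable (\<nu>B i) (\<lambda>\<zeta>. \<zeta>)" and i2: "integrable (\<nu>B i) (\<lambda>\<zeta>. \<zeta>\<^sup>2)"
          by (rule int, measurable)+
        have "(\<lambda>\<zeta>. c1 * \<zeta> - c2 * \<zeta>\<^sup>2 + c3 + c4 * (\<zeta> - s' * y i))
            = (\<lambda>\<zeta>. (c1 + c4) * \<zeta> + (- c2) * \<zeta>\<^sup>2 + (c3 - c4 * (s' * y i)))"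
          by (simp add: fun_eq_iff algebra_simps)
        then have "(\<integral>\<zeta>. c1 * \<zeta> - c2 * \<zeta>\<^sup>2 + c3 + c4 * (\<zeta> - s' * y i) \<partial>\<nu>B i)
            = (c1 + c4) * (\<integral>\<zeta>. \<zeta> \<partial>\<nu>B i) + (- c2) * (\<integral>\<zeta>. \<zeta>\<^sup>2 \<partial>\<nu>B i) + (c3 - c4 * (s' * y i))"
          using i1 i2 by (simp only: Bochner_Integration.integral_add Bochner_Integration.integrable_add
              integrable_mult_right integrable_const integral_mult_right_zero lebesgue_integral_const prob_space) simp
        then show ?thesis unfolding mean_noise[OF i] by (simp add: algebra_simps)
      qed
      from this[of "s * x i t" "s\<^sup>2 * (x i t)\<^sup>2 / 2" "\<beta> * a * (y i - x i t)\<^sup>2" "\<beta> * x i t / s"]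
      show ?thesis unfolding m_def by (simp only: right_diff_distrib) (simp add: mult_ac)
    qed
    have "\<bar>\<integral>\<zeta>. lB a \<beta> i \<zeta> t - ?q \<zeta> \<partial>\<nu>B i\<bar> \<le> (\<integral>\<zeta>. 2 * s ^ 3 * (\<kappa> ^ 3 * (1 + \<bar>\<zeta>\<bar>) ^ 3) \<partial>\<nu>B i)"
    proof (rule integral_abs_bound[THEN order_trans], rule integral_mono_AE)
      show "AE \<zeta> in \<nu>B i. \<bar>lB a \<beta> i \<zeta> t - ?q \<zeta>\<bar> \<le> 2 * s ^ 3 * (\<kappa> ^ 3 * (1 + \<bar>\<zeta>\<bar>) ^ 3)"
        using AE_noise
      proof eventually_elim
        case (elim \<zeta>)
        have eq: "lB a \<beta> i \<zeta> t - ?q \<zeta> = ln (1 + ?w \<zeta>) - ?w \<zeta> + (?w \<zeta>)\<^sup>2 / 2"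
          unfolding lB_def by (simp add: power_mult_distrib algebra_simps)
        have "\<bar>?w \<zeta>\<bar> \<le> s * (\<kappa> * (1 + \<bar>\<zeta>\<bar>))"
        proof -
          have "\<bar>\<zeta>\<bar> * \<bar>x i t\<bar> \<le> (1 + \<bar>\<zeta>\<bar>) * \<kappa>" using x[OF i t] by (intro mult_mono) auto
          then show ?thesis using s mult_left_mono[of "\<bar>\<zeta>\<bar> * \<bar>x i t\<bar>" "(1 + \<bar>\<zeta>\<bar>) * \<kappa>" s]
            by (simp add: abs_mult mult_ac)
        qed
        then have "\<bar>?w \<zeta>\<bar> ^ 3 \<le> (s * (\<kappa> * (1 + \<bar>\<zeta>\<bar>))) ^ 3" by (intro power_mono) auto
        then show ?case unfolding eq
          using ln_one_plus_quadratic[OF bern_arg_small[OF i t elim]] by (simp add: power_mult_distrib)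
      qed
      show "integrable (\<nu>B i) (\<lambda>\<zeta>. \<bar>lB a \<beta> i \<zeta> t - ?q \<zeta>\<bar>)"
        by (intro int borel_measurable_abs borel_measurable_diff meas q_measurable)
    qed (rule int, measurable)
    also have "\<dots> = 2 * s ^ 3 * (\<kappa> ^ 3 * (\<integral>\<zeta>. (1 + \<bar>\<zeta>\<bar>) ^ 3 \<partial>\<nu>B i))" by simp
    also have "\<dots> \<le> 2 * s ^ 3 * ((6 + 4 * s') * \<eta>)" using s by (intro mult_left_mono third) auto
    finally have 1: "\<bar>\<integral>\<zeta>. lB a \<beta> i \<zeta> t - ?q \<zeta> \<partial>\<nu>B i\<bar> \<le> 2 * s ^ 3 * ((6 + 4 * s') * \<eta>)" .
    have "(\<integral>\<zeta>. lB a \<beta> i \<zeta> t - ?q \<zeta> \<partial>\<nu>B i) = (\<integral>\<zeta>. lB a \<beta> i \<zeta> t \<partial>\<nu>B i) - (\<integral>\<zeta>. ?q \<zeta> \<partial>\<nu>B i)"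
      by (rule Bochner_Integration.integral_diff) (intro int meas q_measurable)+
    moreover have "\<bar>s\<^sup>2 * (x i t)\<^sup>2 / 2 * ((\<integral>\<zeta>. \<zeta>\<^sup>2 \<partial>\<nu>B i) - 1)\<bar> \<le> s\<^sup>2 * s' / 2 * \<eta>"
    proof -
      have "(s\<^sup>2 / 2 * (x i t)\<^sup>2) * \<bar>(\<integral>\<zeta>. \<zeta>\<^sup>2 \<partial>\<nu>B i) - 1\<bar> \<le> (s\<^sup>2 / 2 * \<kappa>\<^sup>2) * (D * s' * \<kappa>)"
        by (intro mult_mono second_moment_diff i mult_left_mono sq_le t) auto
      then show ?thesis by (simp add: abs_mult \<eta>_def power2_eq_square power3_eq_cube mult_ac)
    qed
    moreover have "(2 * s ^ 3 * (6 + 4 * s') + s\<^sup>2 * s' / 2) * \<eta> \<le> A * \<eta>"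
      by (rule mult_right_mono[OF A_ge(8) \<eta>_nonneg])
    ultimately show "\<bar>(\<integral>\<zeta>. lB a \<beta> i \<zeta> t \<partial>\<nu>B i) - m a \<beta> i t\<bar> \<le> A * \<eta>"
      using 1 q by (simp only: distrib_right mult.assoc)
  qed (unfold \<nu>B_def, rule sets_two_point)
qed

definition "potB a \<beta> \<zeta> t = (\<Sum>i\<in>I. lB a \<beta> i (\<zeta> i) t)"
definition "potG a \<beta> \<zeta> t = (\<Sum>i\<in>I. lG a \<beta> i (\<zeta> i) t)"

abbreviation "PB \<equiv> PiM I \<nu>B"
abbreviation "PG \<equiv> PiM I (\<lambda>_. std_gauss)"

lemma channels_bern:
  assumes "\<bar>a\<bar> \<le> 1" "\<bar>\<beta>\<bar> \<le> 1"
  shows "channels I \<nu>B T (lB a \<beta>) x (m a \<beta>) A (c \<beta>) \<kappa> \<eta> (\<lambda>i. s' * y i) v"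
  by (rule channels.intro[OF finite_I v _ bern_channel[OF _ assms]])
    (simp_all add: \<nu>B_def prob_space_two_point)

lemma channels_gauss:
  assumes "\<bar>a\<bar> \<le> 1" "\<bar>\<beta>\<bar> \<le> 1"
  shows "channels I (\<lambda>_. std_gauss) T (lG a \<beta>) x (m a \<beta>) A (c \<beta>) \<kappa> \<eta> (\<lambda>i. 0) v"
  by (rule channels.intro[OF finite_I v prob_space_std_gauss gauss_channel[OF _ assms]])

lemma pot_eq:
  assumes "\<bar>a\<bar> \<le> 1" "\<bar>\<beta>\<bar> \<le> 1"
  shows "channels.pot (lB a \<beta>) I = potB a \<beta>" "channels.pot (lG a \<beta>) I = potG a \<beta>"
  unfolding channels.pot_def[OF channels_bern[OF assms], abs_def] potB_def[abs_def]
    channels.pot_def[OF channels_gauss[OF assms], abs_def] potG_def[abs_def] by auto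

text \<open>The slopes of the two free energies, at \<open>0\<close> and at \<open>\<beta>\<close>, after
integration by parts.\<close>

definition "derB a \<zeta> = (\<Sum>i\<in>I. a * wavg T (tilt v (potB a 0 \<zeta>)) (\<lambda>t. (y i - x i t)\<^sup>2)
  + wcov T (tilt v (potB a 0 \<zeta>)) (x i) (x i))"
definition "derG a \<beta> \<zeta> = (\<Sum>i\<in>I. a * wavg T (tilt v (potG a \<beta> \<zeta>)) (\<lambda>t. (y i - x i t)\<^sup>2)
  + (1 + \<beta> / lam) * wcov T (tilt v (potG a \<beta> \<zeta>)) (x i) (x i))"

text \<open>The Bernoulli tangent at \<open>0\<close> and the Gaussian tangent at \<open>\<beta>\<close>
estimate the increment over \<open>[0, \<beta>]\<close> from opposite sides; the two increments differ by at
most twice the replacement error.\<close>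

lemma tangent_comparison:
  assumes a: "\<bar>a\<bar> \<le> 1" and \<beta>: "\<bar>\<beta>\<bar> \<le> 1"
  shows "\<beta> * (\<integral>\<zeta>. derB a \<zeta> \<partial>PB) \<le> \<beta> * (\<integral>\<zeta>. derG a \<beta> \<zeta> \<partial>PG) + real (card I) * (352 * A ^ 5 * \<eta>)"
proof -
  have zero: "\<bar>0::real\<bar> \<le> 1" by simp
  have ss: "s * s = lam" "s\<^sup>2 = lam" using lam by (simp_all add: s_def)
  let ?n = "real (card I)"
  let ?FB = "\<lambda>\<beta>. \<integral>\<zeta>. ln (sum (tilt v (potB a \<beta> \<zeta>)) T) \<partial>PB"
  let ?FG = "\<lambda>\<beta>. \<integral>\<zeta>. ln (sum (tilt v (potG a \<beta> \<zeta>)) T) \<partial>PG"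
  interpret B: channels I \<nu>B T "lB a 0" x "m a 0" A "c 0" \<kappa> \<eta> "\<lambda>i. s' * y i" v
    by (rule channels_bern[OF a zero])
  interpret G: channels I "\<lambda>_. std_gauss" T "lG a \<beta>" x "m a \<beta>" A "c \<beta>" \<kappa> \<eta> "\<lambda>i. 0" v
    by (rule channels_gauss[OF a \<beta>])
  have c: "1 / s * c \<beta> = 1 + \<beta> / lam" for \<beta> unfolding c_def using s ss lam by (simp add: field_simps)
  have "?FB 0 + \<beta> * (\<integral>\<zeta>. derB a \<zeta> \<partial>PB) - \<bar>\<beta> * (1 / s)\<bar> * ?n * (70 * A ^ 4 * \<eta>) \<le> ?FB \<beta>"
  proof -
    have "lB a \<beta> i \<zeta> t = lB a 0 i \<zeta> t + \<beta> * (a * (y i - x i t)\<^sup>2 + 1 / s * ((\<zeta> - s' * y i) * x i t))" for i \<zeta> t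
      by (simp add: lB_def)
    from B.free_energy_tangent[OF channels_bern[OF a \<beta>] this] show ?thesis
      by (simp only: pot_eq[OF a \<beta>] pot_eq[OF a zero] c derB_def wavg_cmult) simp
  qed
  moreover have "?FG \<beta> - \<beta> * (\<integral>\<zeta>. derG a \<beta> \<zeta> \<partial>PG) - \<bar>\<beta> * (1 / s)\<bar> * ?n * (70 * A ^ 4 * \<eta>) \<le> ?FG 0"
  proof -
    have "lG a 0 i \<zeta> t = lG a \<beta> i \<zeta> t + (- \<beta>) * (a * (y i - x i t)\<^sup>2 + 1 / s * ((\<zeta> - 0) * x i t))" for i \<zeta> t
      using s by (simp add: lG_def m_def c_def field_simps)
    from G.free_energy_tangent[OF channels_gauss[OF a zero] this] show ?thesis
      by (simp only: pot_eq[OF a \<beta>] pot_eq[OF a zero] c derG_def wavg_cmult) simp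
  qed
  moreover have "\<bar>?FB \<beta> - ?FG \<beta>\<bar> \<le> ?n * (106 * A ^ 4 * \<eta>)"
    using lindeberg_swap[OF channels_bern[OF a \<beta>] channels_gauss[OF a \<beta>]] by (simp only: pot_eq[OF a \<beta>])
  moreover have "\<bar>?FB 0 - ?FG 0\<bar> \<le> ?n * (106 * A ^ 4 * \<eta>)"
    using lindeberg_swap[OF channels_bern[OF a zero] channels_gauss[OF a zero]] by (simp only: pot_eq[OF a zero])
  ultimately have 1: "\<beta> * (\<integral>\<zeta>. derB a \<zeta> \<partial>PB) \<le> \<beta> * (\<integral>\<zeta>. derG a \<beta> \<zeta> \<partial>PG)
      + 2 * (?n * (106 * A ^ 4 * \<eta>)) + 2 * (\<bar>\<beta> * (1 / s)\<bar> * ?n * (70 * A ^ 4 * \<eta>))"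
    by linarith
  have "\<bar>\<beta> * (1 / s)\<bar> \<le> A"
  proof -
    have "\<bar>\<beta> * (1 / s)\<bar> \<le> 1 / s" using \<beta> s by (simp add: divide_right_mono)
    then show ?thesis using A_ge(3) s by linarith
  qed
  then have "\<bar>\<beta> * (1 / s)\<bar> * (?n * (70 * A ^ 4 * \<eta>)) \<le> A * (?n * (70 * A ^ 4 * \<eta>))"
    using \<eta>_nonneg A_ge(1) by (intro mult_right_mono) auto
  moreover have "1 * (?n * (106 * A ^ 4 * \<eta>)) \<le> A * (?n * (106 * A ^ 4 * \<eta>))"
    using \<eta>_nonneg A_ge(1) by (intro mult_right_mono) auto
  moreover have "A * (?n * (106 * A ^ 4 * \<eta>)) = 106 * (?n * (A ^ 5 * \<eta>))"
    "A * (?n * (70 * A ^ 4 * \<eta>)) = 70 * (?n * (A ^ 5 * \<eta>))"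
    "?n * (352 * A ^ 5 * \<eta>) = 352 * (?n * (A ^ 5 * \<eta>))"
    by (simp_all add: eval_nat_numeral)
  ultimately show ?thesis using 1 by (simp only: mult.assoc)
qed

definition "mseB = (\<integral>\<zeta>. (\<Sum>i\<in>I. (y i - wavg T (tilt v (potB 0 0 \<zeta>)) (x i))\<^sup>2) \<partial>PB)"
definition "varB = (\<integral>\<zeta>. (\<Sum>i\<in>I. wcov T (tilt v (potB 0 0 \<zeta>)) (x i) (x i)) \<partial>PB)"
definition "mseG \<beta> = (\<integral>\<zeta>. (\<Sum>i\<in>I. (y i - wavg T (tilt v (potG (-1) \<beta> \<zeta>)) (x i))\<^sup>2) \<partial>PG)"
definition "varG \<beta> = (\<integral>\<zeta>. (\<Sum>i\<in>I. wcov T (tilt v (potG 0 \<beta> \<zeta>)) (x i) (x i)) \<partial>PG)"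

definition "err \<epsilon> = real (card I) * \<kappa>\<^sup>2 * (2 * \<epsilon> / lam + 352 * A ^ 5 * (\<kappa> * D) / \<epsilon>)"

lemma gauss_var_le:
  assumes "\<bar>a\<bar> \<le> 1" "\<bar>\<beta>\<bar> \<le> 1"
  shows "\<bar>\<integral>\<zeta>. (\<Sum>i\<in>I. wcov T (tilt v (potG a \<beta> \<zeta>)) (x i) (x i)) \<partial>PG\<bar> \<le> real (card I) * (2 * \<kappa>\<^sup>2)"
proof -
  interpret G: channels I "\<lambda>_. std_gauss" T "lG a \<beta>" x "m a \<beta>" A "c \<beta>" \<kappa> \<eta> "\<lambda>i. 0" v
    by (rule channels_gauss[OF assms])
  show ?thesis
  proof (rule G.P.P.abs_integral_le_const)
    fix \<zeta>
    have "\<bar>wcov T (tilt v (potG a \<beta> \<zeta>)) (x i) (x i)\<bar> \<le> 2 * \<kappa>\<^sup>2" if "i \<in> I" for i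
      using abs_wcov_le[where f = "x i" and g = "x i", OF weights_tilt[OF v] x x] that
      by (simp add: power2_eq_square mult.assoc)
    then have "(\<Sum>i\<in>I. \<bar>wcov T (tilt v (potG a \<beta> \<zeta>)) (x i) (x i)\<bar>) \<le> (\<Sum>i\<in>I. 2 * \<kappa>\<^sup>2)"
      by (rule sum_mono)
    then show "\<bar>\<Sum>i\<in>I. wcov T (tilt v (potG a \<beta> \<zeta>)) (x i) (x i)\<bar> \<le> real (card I) * (2 * \<kappa>\<^sup>2)"
      by (simp add: order_trans[OF sum_abs])
  qed simp
qed

text \<open>At \<open>\<beta> \<noteq> 0\<close> the Gaussian noise has amplitude \<open>c \<beta>\<close>
rather than \<open>c 0\<close>, which multiplies the variance by \<open>1 + \<beta> / lam\<close>. The surplus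
costs \<open>O(\<beta>\<^sup>2)\<close> here and \<open>O(\<epsilon>)\<close> after division.\<close>

lemma derG_integral:
  assumes a: "\<bar>a\<bar> \<le> 1" and \<beta>: "\<bar>\<beta>\<bar> \<le> 1"
  shows "\<beta> * (\<integral>\<zeta>. derG a \<beta> \<zeta> \<partial>PG) \<le> \<beta> * (\<integral>\<zeta>. (\<Sum>i\<in>I. a * wavg T (tilt v (potG a \<beta> \<zeta>)) (\<lambda>t. (y i - x i t)\<^sup>2)
      + wcov T (tilt v (potG a \<beta> \<zeta>)) (x i) (x i)) \<partial>PG) + real (card I) * \<kappa>\<^sup>2 * (2 * \<beta>\<^sup>2 / lam)"
proof -
  interpret G: channels I "\<lambda>_. std_gauss" T "lG a \<beta>" x "m a \<beta>" A "c \<beta>" \<kappa> \<eta> "\<lambda>i. 0" v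
    by (rule channels_gauss[OF assms])
  let ?W = "\<lambda>\<zeta>. \<Sum>i\<in>I. wcov T (tilt v (potG a \<beta> \<zeta>)) (x i) (x i)"
  let ?E = "\<lambda>\<zeta>. \<Sum>i\<in>I. a * wavg T (tilt v (potG a \<beta> \<zeta>)) (\<lambda>t. (y i - x i t)\<^sup>2)
    + wcov T (tilt v (potG a \<beta> \<zeta>)) (x i) (x i)"
  note int = G.integrable_wavg[OF subset_refl, unfolded pot_eq[OF assms]]
    G.integrable_wcov[OF subset_refl, unfolded pot_eq[OF assms]]
  have iW: "integrable PG ?W" and iE: "integrable PG ?E"
    by (intro Bochner_Integration.integrable_sum Bochner_Integration.integrable_add integrable_mult_right int)+
  have "derG a \<beta> = (\<lambda>\<zeta>. ?E \<zeta> + \<beta> / lam * ?W \<zeta>)"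
    by (simp add: derG_def fun_eq_iff sum.distrib sum_distrib_left algebra_simps)
  then have eq: "(\<integral>\<zeta>. derG a \<beta> \<zeta> \<partial>PG) = (\<integral>\<zeta>. ?E \<zeta> \<partial>PG) + \<beta> / lam * (\<integral>\<zeta>. ?W \<zeta> \<partial>PG)"
    by (simp only: Bochner_Integration.integral_add[OF iE integrable_mult_right[OF iW]] integral_mult_right_zero)
  have "\<beta> * (\<beta> / lam * (\<integral>\<zeta>. ?W \<zeta> \<partial>PG)) = (\<beta>\<^sup>2 / lam) * (\<integral>\<zeta>. ?W \<zeta> \<partial>PG)"
    by (simp add: power2_eq_square)
  also have "\<dots> \<le> (\<beta>\<^sup>2 / lam) * (real (card I) * (2 * \<kappa>\<^sup>2))"
    using gauss_var_le[OF assms] lam by (intro mult_left_mono) auto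
  finally show ?thesis unfolding eq distrib_left by (simp add: mult_ac)
qed

text \<open>With \<open>a = - 1\<close> the posterior variance contained in the mean of the squared distance
cancels against the one produced by integration by parts, which leaves the squared error of the posterior
mean.\<close>

lemma mse_step:
  assumes \<beta>: "\<bar>\<beta>\<bar> \<le> 1"
  shows "\<beta> * mseG \<beta> \<le> \<beta> * mseB + real (card I) * \<kappa>\<^sup>2 * (2 * \<beta>\<^sup>2 / lam) + real (card I) * (352 * A ^ 5 * \<eta>)"
proof -
  have a: "\<bar>-1::real\<bar> \<le> 1" by simp
  have w: "weights T (tilt v u)" for u by (rule weights_tilt[OF v])
  have B: "derB (-1) = (\<lambda>\<zeta>. - (\<Sum>i\<in>I. (y i - wavg T (tilt v (potB 0 0 \<zeta>)) (x i))\<^sup>2))"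
    unfolding derB_def[abs_def] wavg_sq_dist[OF w] by (simp add: fun_eq_iff sum_negf potB_def[abs_def] lB_def)
  have G: "(\<Sum>i\<in>I. -1 * wavg T (tilt v (potG (-1) \<beta> \<zeta>)) (\<lambda>t. (y i - x i t)\<^sup>2)
      + wcov T (tilt v (potG (-1) \<beta> \<zeta>)) (x i) (x i))
    = - (\<Sum>i\<in>I. (y i - wavg T (tilt v (potG (-1) \<beta> \<zeta>)) (x i))\<^sup>2)" for \<zeta>
    unfolding wavg_sq_dist[OF w] by (simp add: sum_negf)
  show ?thesis
    using tangent_comparison[OF a \<beta>] derG_integral[OF a \<beta>] unfolding B G mseB_def mseG_def by simp
qed

lemma var_step:
  assumes \<beta>: "\<bar>\<beta>\<bar> \<le> 1"
  shows "\<beta> * varB \<le> \<beta> * varG \<beta> + real (card I) * \<kappa>\<^sup>2 * (2 * \<beta>\<^sup>2 / lam) + real (card I) * (352 * A ^ 5 * \<eta>)"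
  using tangent_comparison[of 0 \<beta>] derG_integral[of 0 \<beta>] \<beta> unfolding derB_def varB_def varG_def by simp

theorem risk_comparison:
  assumes \<epsilon>: "0 < \<epsilon>" "\<epsilon> \<le> 1"
  shows "mseG \<epsilon> - err \<epsilon> \<le> mseB" "mseB \<le> mseG (-\<epsilon>) + err \<epsilon>"
    "varG (-\<epsilon>) - err \<epsilon> \<le> varB" "varB \<le> varG \<epsilon> + err \<epsilon>"
proof -
  have err: "\<epsilon> * err \<epsilon> = real (card I) * \<kappa>\<^sup>2 * (2 * \<epsilon>\<^sup>2 / lam) + real (card I) * (352 * A ^ 5 * \<eta>)"
    using \<epsilon> by (simp add: err_def \<eta>_def field_simps power2_eq_square power3_eq_cube)
  have abs: "\<bar>\<epsilon>\<bar> \<le> 1" "\<bar>- \<epsilon>\<bar> \<le> 1" using \<epsilon> by auto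
  have "\<epsilon> * (mseG \<epsilon> - err \<epsilon>) \<le> \<epsilon> * mseB" "\<epsilon> * mseB \<le> \<epsilon> * (mseG (-\<epsilon>) + err \<epsilon>)"
    "\<epsilon> * (varG (-\<epsilon>) - err \<epsilon>) \<le> \<epsilon> * varB" "\<epsilon> * varB \<le> \<epsilon> * (varG \<epsilon> + err \<epsilon>)"
    using mse_step[OF abs(1)] mse_step[OF abs(2)] var_step[OF abs(1)] var_step[OF abs(2)]
    unfolding right_diff_distrib distrib_left err by simp_all
  then show "mseG \<epsilon> - err \<epsilon> \<le> mseB" "mseB \<le> mseG (-\<epsilon>) + err \<epsilon>"
    "varG (-\<epsilon>) - err \<epsilon> \<le> varB" "varB \<le> varG \<epsilon> + err \<epsilon>"
    using \<epsilon>(1) mult_le_cancel_left_pos by blast+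
qed

end

section \<open>Finite-dimensional laws are determined by their projections\<close>

text \<open>Phase-shifted cosines give the real and the imaginary part of the characteristic function and
spare complex-valued weights below.\<close>

lemma char_eqI_cos:
  assumes "real_distribution M" "real_distribution N"
    and "\<And>s d. (\<integral>x. cos (s * x + d) \<partial>M) = (\<integral>x. cos (s * x + d) \<partial>N)"
  shows "char M = char N"
proof
  fix s :: real
  have char: "char K s = Complex (\<integral>x. cos (s * x + 0) \<partial>K) (\<integral>x. cos (s * x + (- pi / 2)) \<partial>K)"
    if K: "real_distribution K" for K :: "real measure"
  proof -
    interpret K: real_distribution K by fact
    have int: "integrable K (\<lambda>x. iexp (s * x))"
      by (rule K.integrable_iexp) auto
    have "Re (char K s) = (\<integral>x. cos (s * x + 0) \<partial>K)" "Im (char K s) = (\<integral>x. cos (s * x + (- pi / 2)) \<partial>K)"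
      using integral_Re[OF int] integral_Im[OF int] unfolding char_def
      by (simp_all add: Re_exp Im_exp cos_diff)
    then show ?thesis by (metis complex_surj)
  qed
  show "char M s = char N s" unfolding char[OF assms(1)] char[OF assms(2)] assms(3) ..
qed

text \<open>A bounded nonnegative density turns a random variable into one with a probability law on the line,
to which Levy's uniqueness theorem applies.\<close>

lemma reweighted_law:
  fixes h V :: "'a \<Rightarrow> real"
  assumes M: "prob_space M" and [measurable]: "h \<in> borel_measurable M" "V \<in> borel_measurable M"
    and h: "\<And>\<omega>. 0 \<le> h \<omega>" "integrable M h" and pos: "0 < mass" and mass: "(\<integral>\<omega>. h \<omega> \<partial>M) = mass"
  defines "L \<equiv> distr (density M (\<lambda>\<omega>. ennreal (h \<omega> / mass))) borel V"
  shows "real_distribution L"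
    and "f \<in> borel_measurable borel \<Longrightarrow> (\<integral>x. f x \<partial>L) = (\<integral>\<omega>. h \<omega> * f (V \<omega>) \<partial>M) / (mass :: real)"
proof -
  have "(\<integral>\<^sup>+\<omega>. ennreal (h \<omega> / mass) \<partial>M) = ennreal (\<integral>\<omega>. h \<omega> / mass \<partial>M)"
    using h pos by (intro nn_integral_eq_integral) auto
  then have "prob_space (density M (\<lambda>\<omega>. ennreal (h \<omega> / mass)))"
    using mass pos by (intro prob_spaceI) (simp add: emeasure_density cong: nn_integral_cong)
  then interpret P: prob_space "density M (\<lambda>\<omega>. ennreal (h \<omega> / mass))" .
  show "real_distribution L" unfolding L_def by (rule P.real_distribution_distr) simp
  assume [measurable]: "f \<in> borel_measurable borel"
  show "(\<integral>x. f x \<partial>L) = (\<integral>\<omega>. h \<omega> * f (V \<omega>) \<partial>M) / mass"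
    unfolding L_def using h pos by (subst integral_distr) (auto simp: integral_density)
qed

lemma integral_indicator_transfer:
  fixes h V :: "'a \<Rightarrow> real" and k W :: "'b \<Rightarrow> real"
  assumes M: "prob_space M" and N: "prob_space N"
    and [measurable]: "h \<in> borel_measurable M" "V \<in> borel_measurable M" "k \<in> borel_measurable N" "W \<in> borel_measurable N"
    and h: "\<And>\<omega>. 0 \<le> h \<omega>" "\<And>\<omega>. h \<omega> \<le> K" and k: "\<And>\<omega>. 0 \<le> k \<omega>" "\<And>\<omega>. k \<omega> \<le> K"
    and cos: "\<And>s d. (\<integral>\<omega>. h \<omega> * cos (s * V \<omega> + d) \<partial>M) = (\<integral>\<omega>. k \<omega> * cos (s * W \<omega> + d) \<partial>N)"
    and B [measurable]: "B \<in> sets borel"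
  shows "(\<integral>\<omega>. h \<omega> * indicator B (V \<omega>) \<partial>M) = (\<integral>\<omega>. k \<omega> * indicator B (W \<omega>) \<partial>N)"
proof -
  interpret M: prob_space M by fact
  interpret N: prob_space N by fact
  define mass where "mass = (\<integral>\<omega>. h \<omega> \<partial>M)"
  have mass': "mass = (\<integral>\<omega>. k \<omega> \<partial>N)" using cos[of 0 0] by (simp add: mass_def)
  have int: "integrable M h" "integrable N k"
    using h k by (auto intro!: M.integrable_const_bound[where B = K] N.integrable_const_bound[where B = K])
  show ?thesis
  proof (cases "mass = 0")
    case True
    have "AE \<omega> in M. h \<omega> = 0" "AE \<omega> in N. k \<omega> = 0"
      using True mass' integral_nonneg_eq_0_iff_AE[OF int(1)] integral_nonneg_eq_0_iff_AE[OF int(2)] h k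
      by (auto simp: mass_def)
    then have "(\<integral>\<omega>. h \<omega> * indicator B (V \<omega>) \<partial>M) = 0" "(\<integral>\<omega>. k \<omega> * indicator B (W \<omega>) \<partial>N) = 0"
      by (auto intro!: integral_eq_zero_AE elim!: eventually_mono)
    then show ?thesis by simp
  next
    case False
    have "0 \<le> mass" unfolding mass_def using h by simp
    with False have pos: "0 < mass" by simp
    let ?LM = "distr (density M (\<lambda>\<omega>. ennreal (h \<omega> / mass))) borel V"
    let ?LN = "distr (density N (\<lambda>\<omega>. ennreal (k \<omega> / mass))) borel W"
    note LM = reweighted_law[OF M _ _ h(1) int(1) pos mass_def[symmetric]]
    note LN = reweighted_law[OF N _ _ k(1) int(2) pos mass'[symmetric]]
    have r: "real_distribution ?LM" "real_distribution ?LN" by (auto intro!: LM(1) LN(1))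
    have L: "(\<integral>x. f x \<partial>?LM) = (\<integral>\<omega>. h \<omega> * f (V \<omega>) \<partial>M) / mass"
      "(\<integral>x. f x \<partial>?LN) = (\<integral>\<omega>. k \<omega> * f (W \<omega>) \<partial>N) / mass" if "f \<in> borel_measurable borel" for f :: "real \<Rightarrow> real"
      using that by (auto intro!: LM(2) LN(2))
    have "char ?LM = char ?LN" by (rule char_eqI_cos[OF r]) (simp add: L cos)
    then have eq: "?LM = ?LN" by (rule Levy_uniqueness[OF r])
    have "(\<integral>\<omega>. h \<omega> * indicator B (V \<omega>) \<partial>M) / mass = (\<integral>x. indicator B x \<partial>?LM)"
      by (rule L(1)[symmetric]) simp
    also have "\<dots> = (\<integral>x. indicator B x \<partial>?LN)" by (simp only: eq)
    also have "\<dots> = (\<integral>\<omega>. k \<omega> * indicator B (W \<omega>) \<partial>N) / mass"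
      by (rule L(2)) simp
    finally show ?thesis using pos by simp
  qed
qed

text \<open>The variables are replaced by indicators one after the other. For the variable \<open>j\<close>
the uniqueness theorem on the line is applied under the density \<open>(\<Prod>t\<in>J. indicator (B t)) * (1
+ cos \<dots>)\<close>, where the cosine carries the variables that are still to be treated; adding
\<open>1\<close> makes it nonnegative. Subtraction of the same statement without the cosine isolates the
cosine term.\<close>

lemma cramer_wold_aux:
  fixes V :: "'t \<Rightarrow> 'a \<Rightarrow> real" and W :: "'t \<Rightarrow> 'b \<Rightarrow> real"
  assumes M: "prob_space M" and N: "prob_space N" and T: "finite T"
    and V [measurable]: "\<And>t. t \<in> T \<Longrightarrow> V t \<in> borel_measurable M"
    and W [measurable]: "\<And>t. t \<in> T \<Longrightarrow> W t \<in> borel_measurable N"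
    and proj: "\<And>\<xi>. distr M borel (\<lambda>\<omega>. \<Sum>t\<in>T. \<xi> t * V t \<omega>) = distr N borel (\<lambda>\<omega>. \<Sum>t\<in>T. \<xi> t * W t \<omega>)"
    and "J \<subseteq> T" and B: "\<And>t. B t \<in> sets borel"
  shows "(\<integral>\<omega>. (\<Prod>t\<in>J. indicator (B t) (V t \<omega>)) * cos ((\<Sum>t\<in>T - J. \<xi> t * V t \<omega>) + d) \<partial>M)
    = (\<integral>\<omega>. (\<Prod>t\<in>J. indicator (B t) (W t \<omega>)) * cos ((\<Sum>t\<in>T - J. \<xi> t * W t \<omega>) + d) \<partial>N)"
proof -
  interpret M: prob_space M by fact
  interpret N: prob_space N by fact
  note B [measurable]
  have "finite J" using assms(7) T by (rule finite_subset)
  then show ?thesis using assms(7)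
  proof (induction J arbitrary: \<xi> d rule: finite_induct)
    case empty
    have "(\<integral>x. cos (x + d) \<partial>distr M borel (\<lambda>\<omega>. \<Sum>t\<in>T. \<xi> t * V t \<omega>))
        = (\<integral>x. cos (x + d) \<partial>distr N borel (\<lambda>\<omega>. \<Sum>t\<in>T. \<xi> t * W t \<omega>))"
      unfolding proj ..
    then show ?case by (simp add: integral_distr)
  next
    case (insert j J)
    let ?R = "T - insert j J"
    \<comment> \<open>Up to the end of this case, \<open>V\<close> and \<open>W\<close> are treated in
      parallel.\<close>
    define pV where "pV \<omega> = (\<Prod>t\<in>J. indicator (B t) (V t \<omega>) :: real)" for \<omega>
    define pW where "pW \<omega> = (\<Prod>t\<in>J. indicator (B t) (W t \<omega>) :: real)" for \<omega>
    define cV where "cV \<omega> = cos ((\<Sum>t\<in>?R. \<xi> t * V t \<omega>) + d)" for \<omega>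
    define cW where "cW \<omega> = cos ((\<Sum>t\<in>?R. \<xi> t * W t \<omega>) + d)" for \<omega>
    have J: "j \<in> T" "J \<subseteq> T" "T - J = insert j ?R" "j \<notin> ?R" "finite ?R" using insert T by auto
    have [measurable]: "V t \<in> borel_measurable M" if "t \<in> J" for t by (rule V) (use that J in blast)
    have [measurable]: "W t \<in> borel_measurable N" if "t \<in> J" for t by (rule W) (use that J in blast)
    have [measurable]: "V j \<in> borel_measurable M" "W j \<in> borel_measurable N"
      by (rule V[OF J(1)], rule W[OF J(1)])
    have [measurable]: "pV \<in> borel_measurable M" "pW \<in> borel_measurable N"
      "cV \<in> borel_measurable M" "cW \<in> borel_measurable N"
      unfolding pV_def pW_def cV_def cW_def by measurable
    have p: "0 \<le> pV \<omega>" "pV \<omega> \<le> 1" "0 \<le> pW \<omega>'" "pW \<omega>' \<le> 1" for \<omega> \<omega>'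
      unfolding pV_def pW_def by (auto intro!: prod_nonneg prod_le_1)
    have c: "\<bar>cV \<omega>\<bar> \<le> 1" "\<bar>cW \<omega>'\<bar> \<le> 1" for \<omega> \<omega>' by (simp_all add: cV_def cW_def)
    have pc: "- 1 \<le> pV \<omega> * cV \<omega>" "- 1 \<le> pW \<omega>' * cW \<omega>'" "\<bar>pV \<omega> * cV \<omega>\<bar> \<le> 1" "\<bar>pW \<omega>' * cW \<omega>'\<bar> \<le> 1" for \<omega> \<omega>'
    proof -
      show *: "\<bar>pV \<omega> * cV \<omega>\<bar> \<le> 1" "\<bar>pW \<omega>' * cW \<omega>'\<bar> \<le> 1"
        using p c by (auto simp: abs_mult intro!: mult_le_one)
      show "- 1 \<le> pV \<omega> * cV \<omega>" "- 1 \<le> pW \<omega>' * cW \<omega>'" using * by linarith+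
    qed
    have IH: "(\<integral>\<omega>. pV \<omega> * cos (s * V j \<omega> + (\<Sum>t\<in>?R. \<zeta> t * V t \<omega>) + e) \<partial>M)
        = (\<integral>\<omega>. pW \<omega> * cos (s * W j \<omega> + (\<Sum>t\<in>?R. \<zeta> t * W t \<omega>) + e) \<partial>N)" for s \<zeta> e
    proof -
      have "(\<Sum>t\<in>T - J. (\<zeta>(j := s)) t * U t) = s * U j + (\<Sum>t\<in>?R. \<zeta> t * U t)" for U :: "'t \<Rightarrow> real"
        unfolding J(3) using J(4,5) by (simp add: sum.insert cong: sum.cong) (auto intro!: sum.cong)
      then show ?thesis using insert.IH[OF J(2), of "\<zeta>(j := s)" e] by (simp add: pV_def pW_def)
    qed
    have base: "(\<integral>\<omega>. pV \<omega> * cos (s * V j \<omega> + e) \<partial>M) = (\<integral>\<omega>. pW \<omega> * cos (s * W j \<omega> + e) \<partial>N)" for s e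
      using IH[of s "\<lambda>_. 0" e] by simp
    have iV: "integrable M (\<lambda>\<omega>. pV \<omega> * cos (f \<omega>))" if [measurable]: "f \<in> borel_measurable M" for f
      by (rule M.integrable_const_bound[where B = 1]) (use p in \<open>auto simp: abs_mult intro!: mult_le_one\<close>)
    have iW: "integrable N (\<lambda>\<omega>. pW \<omega> * cos (f \<omega>))" if [measurable]: "f \<in> borel_measurable N" for f
      by (rule N.integrable_const_bound[where B = 1]) (use p in \<open>auto simp: abs_mult intro!: mult_le_one\<close>)
    \<comment> \<open>The product of two cosines is a sum of cosines of linear forms in the variables outside
      \<open>J\<close>, to which the induction hypothesis applies.\<close>
    have split: "pV \<omega> * (1 + cV \<omega>) * cos (s * V j \<omega> + e) = pV \<omega> * cos (s * V j \<omega> + e)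
        + (pV \<omega> * cos (s * V j \<omega> + (\<Sum>t\<in>?R. \<xi> t * V t \<omega>) + (d + e))
          + pV \<omega> * cos (s * V j \<omega> + (\<Sum>t\<in>?R. - \<xi> t * V t \<omega>) + (e - d))) / 2"
      "pW \<omega>' * (1 + cW \<omega>') * cos (s * W j \<omega>' + e) = pW \<omega>' * cos (s * W j \<omega>' + e)
        + (pW \<omega>' * cos (s * W j \<omega>' + (\<Sum>t\<in>?R. \<xi> t * W t \<omega>') + (d + e))
          + pW \<omega>' * cos (s * W j \<omega>' + (\<Sum>t\<in>?R. - \<xi> t * W t \<omega>') + (e - d))) / 2" for \<omega> \<omega>' s e
    proof -
      have "p * (1 + cos (r + d)) * cos (u + e) = p * cos (u + e) + (p * cos (u + r + (d + e)) + p * cos (u + - r + (e - d))) / 2"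
        for p r u :: real
      proof -
        have "cos (u + r + (d + e)) + cos (u + - r + (e - d)) = 2 * (cos (r + d) * cos (u + e))"
          using cos_add[of "u + e" "r + d"] cos_diff[of "u + e" "r + d"] by (simp add: algebra_simps)
        moreover have "p * (1 + C) * U = p * U + (p * X + p * Y) / 2" if "X + Y = 2 * (C * U)" for C U X Y :: real
        proof -
          have "(p * X + p * Y) / 2 = p * (X + Y) / 2" by (simp only: distrib_left)
          also have "\<dots> = p * C * U" unfolding that by simp
          finally show ?thesis by (simp add: distrib_left distrib_right)
        qed
        ultimately show ?thesis by blast
      qed
      note * = this
      show "pV \<omega> * (1 + cV \<omega>) * cos (s * V j \<omega> + e) = pV \<omega> * cos (s * V j \<omega> + e)
        + (pV \<omega> * cos (s * V j \<omega> + (\<Sum>t\<in>?R. \<xi> t * V t \<omega>) + (d + e))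
          + pV \<omega> * cos (s * V j \<omega> + (\<Sum>t\<in>?R. - \<xi> t * V t \<omega>) + (e - d))) / 2"
        unfolding cV_def * by (simp add: sum_negf)
      show "pW \<omega>' * (1 + cW \<omega>') * cos (s * W j \<omega>' + e) = pW \<omega>' * cos (s * W j \<omega>' + e)
        + (pW \<omega>' * cos (s * W j \<omega>' + (\<Sum>t\<in>?R. \<xi> t * W t \<omega>') + (d + e))
          + pW \<omega>' * cos (s * W j \<omega>' + (\<Sum>t\<in>?R. - \<xi> t * W t \<omega>') + (e - d))) / 2"
        unfolding cW_def * by (simp add: sum_negf)
    qed
    have mR: "(\<lambda>\<omega>. s * V j \<omega> + (\<Sum>t\<in>?R. \<zeta> t * V t \<omega>) + e) \<in> borel_measurable M"
      "(\<lambda>\<omega>. s * W j \<omega> + (\<Sum>t\<in>?R. \<zeta> t * W t \<omega>) + e) \<in> borel_measurable N"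
      "(\<lambda>\<omega>. s * V j \<omega> + e) \<in> borel_measurable M" "(\<lambda>\<omega>. s * W j \<omega> + e) \<in> borel_measurable N" for s \<zeta> e
      by measurable
    have full: "(\<integral>\<omega>. pV \<omega> * (1 + cV \<omega>) * cos (s * V j \<omega> + e) \<partial>M) = (\<integral>\<omega>. pW \<omega> * (1 + cW \<omega>) * cos (s * W j \<omega> + e) \<partial>N)" for s e
      unfolding split
      by (simp only: Bochner_Integration.integral_add Bochner_Integration.integrable_add integrable_divide
          integral_divide_zero iV[OF mR(1)] iV[OF mR(3)] iW[OF mR(2)] iW[OF mR(4)] IH base)
    have b1: "0 \<le> pV \<omega> * (1 + cV \<omega>)" "pV \<omega> * (1 + cV \<omega>) \<le> 2" "0 \<le> pW \<omega>' * (1 + cW \<omega>')" "pW \<omega>' * (1 + cW \<omega>') \<le> 2" for \<omega> \<omega>'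
    proof -
      have "0 \<le> 1 + cV \<omega>" "0 \<le> 1 + cW \<omega>'" using c(1)[of \<omega>] c(2)[of \<omega>'] by linarith+
      then show "0 \<le> pV \<omega> * (1 + cV \<omega>)" "0 \<le> pW \<omega>' * (1 + cW \<omega>')"
        using p(1)[of \<omega>] p(3)[of \<omega>'] by simp_all
      show "pV \<omega> * (1 + cV \<omega>) \<le> 2" "pW \<omega>' * (1 + cW \<omega>') \<le> 2"
        using p(2)[of \<omega>] p(4)[of \<omega>'] pc(3)[of \<omega>] pc(4)[of \<omega>'] unfolding distrib_left by linarith+
    qed
    have "(\<integral>\<omega>. pV \<omega> * (1 + cV \<omega>) * indicator (B j) (V j \<omega>) \<partial>M) = (\<integral>\<omega>. pW \<omega> * (1 + cW \<omega>) * indicator (B j) (W j \<omega>) \<partial>N)"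
      by (rule integral_indicator_transfer[OF M N _ _ _ _ b1(1,2,3,4) full B]) auto
    moreover have "(\<integral>\<omega>. pV \<omega> * indicator (B j) (V j \<omega>) \<partial>M) = (\<integral>\<omega>. pW \<omega> * indicator (B j) (W j \<omega>) \<partial>N)"
      by (rule integral_indicator_transfer[OF M N _ _ _ _ p(1,2,3,4) base B]) auto
    moreover have "integrable M (\<lambda>\<omega>. pV \<omega> * indicator (B j) (V j \<omega>))" "integrable N (\<lambda>\<omega>. pW \<omega> * indicator (B j) (W j \<omega>))"
      "integrable M (\<lambda>\<omega>. pV \<omega> * cV \<omega> * indicator (B j) (V j \<omega>))" "integrable N (\<lambda>\<omega>. pW \<omega> * cW \<omega> * indicator (B j) (W j \<omega>))"
      using p pc by (auto intro!: M.integrable_const_bound[where B = 1] N.integrable_const_bound[where B = 1]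
          simp: indicator_def)
    ultimately have "(\<integral>\<omega>. pV \<omega> * cV \<omega> * indicator (B j) (V j \<omega>) \<partial>M) = (\<integral>\<omega>. pW \<omega> * cW \<omega> * indicator (B j) (W j \<omega>) \<partial>N)"
      by (simp add: distrib_left distrib_right)
    then show ?case
      using insert(1,2) by (simp add: pV_def pW_def cV_def cW_def mult_ac)
  qed
qed

text \<open>The theorem of Cramer and Wold for finitely many real random variables on two arbitrary
probability spaces.\<close>

theorem cramer_wold:
  fixes V :: "'t \<Rightarrow> 'a \<Rightarrow> real" and W :: "'t \<Rightarrow> 'b \<Rightarrow> real"
  assumes M: "prob_space M" and N: "prob_space N" and T: "finite T"
    and V: "\<And>t. t \<in> T \<Longrightarrow> V t \<in> borel_measurable M"
    and W: "\<And>t. t \<in> T \<Longrightarrow> W t \<in> borel_measurable N"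
    and proj: "\<And>\<xi>. distr M borel (\<lambda>\<omega>. \<Sum>t\<in>T. \<xi> t * V t \<omega>) = distr N borel (\<lambda>\<omega>. \<Sum>t\<in>T. \<xi> t * W t \<omega>)"
  shows "distr M (PiM T (\<lambda>_. borel)) (\<lambda>\<omega>. \<lambda>t\<in>T. V t \<omega>) = distr N (PiM T (\<lambda>_. borel)) (\<lambda>\<omega>. \<lambda>t\<in>T. W t \<omega>)"
    (is "?P = ?Q")
proof (rule measure_eqI_PiM_finite[OF T])
  interpret M: prob_space M by fact
  interpret N: prob_space N by fact
  note V [measurable] W [measurable]
  have [measurable]: "(\<lambda>\<omega>. \<lambda>t\<in>T. V t \<omega>) \<in> measurable M (PiM T (\<lambda>_. borel))"
    "(\<lambda>\<omega>. \<lambda>t\<in>T. W t \<omega>) \<in> measurable N (PiM T (\<lambda>_. borel))"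
    by (auto intro!: measurable_restrict)
  interpret P: prob_space ?P by (rule M.prob_space_distr) simp
  show "sets ?P = sets (PiM T (\<lambda>_. borel))" "sets ?Q = sets (PiM T (\<lambda>_. borel))" by simp_all
  show "range (\<lambda>_. space (PiM T (\<lambda>_. borel :: real measure))) \<subseteq> prod_algebra T (\<lambda>_. borel)"
    using T by (auto simp: space_PiM prod_algebra_eq_finite intro!: exI[of _ "\<lambda>_. UNIV"])
  show "(\<Union>i::nat. space (PiM T (\<lambda>_. borel :: real measure))) = space (PiM T (\<lambda>_. borel))" by simp
  show "?P (space (PiM T (\<lambda>_. borel))) \<noteq> \<infinity>" using P.emeasure_space_1 by simp
  fix A assume A: "\<And>i. i \<in> T \<Longrightarrow> A i \<in> sets (borel :: real measure)"
  define B where "B t = (if t \<in> T then A t else {})" for t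
  have B: "B t \<in> sets borel" for t using A by (auto simp: B_def)
  have ind: "indicator (PiE T A) (\<lambda>t\<in>T. u t) = (\<Prod>t\<in>T. indicator (B t) (u t) :: real)" for u
    using T by (auto simp: indicator_def B_def PiE_iff)
  have "(\<integral>\<omega>. indicator (PiE T A) (\<lambda>t\<in>T. V t \<omega>) \<partial>M) = (\<integral>\<omega>. (indicator (PiE T A) (\<lambda>t\<in>T. W t \<omega>) :: real) \<partial>N)"
    using cramer_wold_aux[OF M N T V W proj subset_refl B, where \<xi> = "\<lambda>_. 0" and d = 0] unfolding ind by simp
  moreover have PiE: "PiE T A \<in> sets (PiM T (\<lambda>_. borel))" using A T by (intro sets_PiM_I_finite) auto
  moreover have "measure ?P (PiE T A) = (\<integral>\<omega>. indicator (PiE T A) (\<lambda>t\<in>T. V t \<omega>) \<partial>M)"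
    using PiE by (subst integral_distr[symmetric, where N = "PiM T (\<lambda>_. borel)"]) auto
  moreover have "measure ?Q (PiE T A) = (\<integral>\<omega>. indicator (PiE T A) (\<lambda>t\<in>T. W t \<omega>) \<partial>N)"
    using PiE by (subst integral_distr[symmetric, where N = "PiM T (\<lambda>_. borel)"]) auto
  ultimately have eq: "measure ?P (PiE T A) = measure ?Q (PiE T A)" by simp
  interpret Q: prob_space ?Q by (rule N.prob_space_distr) simp
  from eq show "?P (PiE T A) = ?Q (PiE T A)"
    by (simp add: P.emeasure_eq_measure Q.emeasure_eq_measure)
qed

section \<open>Gaussian processes\<close>

lemma gaussian_rv_square_integrable:
  assumes M: "prob_space M" and X: "gaussian_rv M X"
  shows "X \<in> borel_measurable M" "integrable M X" "integrable M (\<lambda>\<omega>. X \<omega> * X \<omega>)"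
proof -
  interpret prob_space M by fact
  show [measurable]: "X \<in> borel_measurable M" using X by (simp add: gaussian_rv_def)
  from X consider (normal) \<mu> \<sigma> where "\<sigma> > 0" "distributed M lborel X (normal_density \<mu> \<sigma>)"
    | (const) \<mu> where "AE \<omega> in M. X \<omega> = \<mu>"
    unfolding gaussian_rv_def by blast
  then have "\<exists>\<mu>. integrable M (\<lambda>\<omega>. X \<omega> - \<mu>) \<and> integrable M (\<lambda>\<omega>. (X \<omega> - \<mu>) * (X \<omega> - \<mu>))"
  proof cases
    case normal
    have "integrable M (\<lambda>\<omega>. (X \<omega> - \<mu>) ^ k)" for k
      using integrable_normal_moment[OF normal(1), of \<mu> k]
        distributed_integrable[OF normal(2), of "\<lambda>x. (x - \<mu>) ^ k"] by simp
    from this[of 1] this[of 2] show ?thesis by (auto simp: power2_eq_square)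
  next
    case const
    have "integrable M (\<lambda>\<omega>. X \<omega> - \<mu>)" "integrable M (\<lambda>\<omega>. (X \<omega> - \<mu>) * (X \<omega> - \<mu>))"
      by (rule integrable_const_bound[where B = 0], use const in auto)+
    then show ?thesis by blast
  qed
  then obtain \<mu> where *: "integrable M (\<lambda>\<omega>. X \<omega> - \<mu>)" "integrable M (\<lambda>\<omega>. (X \<omega> - \<mu>) * (X \<omega> - \<mu>))" by blast
  from Bochner_Integration.integrable_add[OF *(1) integrable_const[of \<mu>]]
  show "integrable M X" by simp
  have "integrable M (\<lambda>\<omega>. (X \<omega> - \<mu>) * (X \<omega> - \<mu>) + 2 * \<mu> * (X \<omega> - \<mu>) + \<mu> * \<mu>)" using * by simp
  then show "integrable M (\<lambda>\<omega>. X \<omega> * X \<omega>)" by (simp add: algebra_simps)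
qed

text \<open>A degenerate Gaussian variable has a point mass as its law, so the case distinction is on the
variance.\<close>

lemma gaussian_rv_law:
  assumes M: "prob_space M" and X: "gaussian_rv M X"
  shows "distr M borel X = (if cov M X X = 0 then return borel (\<integral>\<omega>. X \<omega> \<partial>M)
    else density lborel (normal_density (\<integral>\<omega>. X \<omega> \<partial>M) (sqrt (cov M X X))))"
proof -
  interpret prob_space M by fact
  have [measurable]: "X \<in> borel_measurable M" using X by (simp add: gaussian_rv_def)
  from X consider (normal) \<mu> \<sigma> where "\<sigma> > 0" "distributed M lborel X (normal_density \<mu> \<sigma>)"
    | (const) \<mu> where "AE \<omega> in M. X \<omega> = \<mu>"
    unfolding gaussian_rv_def by blast
  then show ?thesis
  proof cases
    case normal
    have "(\<integral>\<omega>. X \<omega> \<partial>M) = \<mu>" by (rule normal_distributed_expectation[OF normal])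
    moreover have "cov M X X = \<sigma>\<^sup>2"
      using normal_distributed_variance[OF normal] by (simp add: cov_def power2_eq_square)
    moreover have "distr M borel X = density lborel (normal_density \<mu> \<sigma>)"
      using distributed_distr_eq_density[OF normal(2)] by (metis distr_cong sets_lborel)
    ultimately show ?thesis using normal(1) by simp
  next
    case const
    have "(\<integral>\<omega>. X \<omega> \<partial>M) = (\<integral>\<omega>. \<mu> \<partial>M)" by (rule integral_cong_AE) (use const in auto)
    then have mean: "(\<integral>\<omega>. X \<omega> \<partial>M) = \<mu>" by (simp add: prob_space)
    have "cov M X X = 0" unfolding cov_def mean
      by (rule integral_eq_zero_AE) (use const in auto)
    moreover have "distr M borel X = return borel \<mu>"
    proof -
      have "distr M borel X = distr M borel (\<lambda>_. \<mu>)" by (rule distr_cong_AE) (use const in auto)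
      then show ?thesis by (simp add: distr_const)
    qed
    ultimately show ?thesis using mean by simp
  qed
qed

lemma gaussian_process_linear_form:
  assumes Y: "gaussian_process M S Y" and T: "finite T" "T \<subseteq> S"
  shows "(\<integral>\<omega>. (\<Sum>t\<in>T. \<xi> t * Y \<omega> t) \<partial>M) = (\<Sum>t\<in>T. \<xi> t * (\<integral>\<omega>. Y \<omega> t \<partial>M))"
    and "cov M (\<lambda>\<omega>. \<Sum>t\<in>T. \<xi> t * Y \<omega> t) (\<lambda>\<omega>. \<Sum>t\<in>T. \<xi> t * Y \<omega> t)
      = (\<Sum>s\<in>T. \<Sum>t\<in>T. \<xi> s * \<xi> t * cov M (\<lambda>\<omega>. Y \<omega> s) (\<lambda>\<omega>. Y \<omega> t))"
    and "t \<in> S \<Longrightarrow> (\<lambda>\<omega>. Y \<omega> t) \<in> borel_measurable M"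
proof -
  have M: "prob_space M" using Y by (simp add: gaussian_process_def)
  interpret prob_space M by fact
  have rv: "gaussian_rv M (\<lambda>\<omega>. Y \<omega> t)" if "t \<in> S" for t
  proof -
    have "gaussian_rv M (\<lambda>\<omega>. \<Sum>t\<in>{t}. 1 * Y \<omega> t)"
      using Y that unfolding gaussian_process_def by (elim conjE allE[where x = "{t}"] allE[where x = "\<lambda>_. 1"]) auto
    then show ?thesis by simp
  qed
  note sq = gaussian_rv_square_integrable[OF M rv]
  show "t \<in> S \<Longrightarrow> (\<lambda>\<omega>. Y \<omega> t) \<in> borel_measurable M" by (rule sq(1))
  have int: "integrable M (\<lambda>\<omega>. Y \<omega> t)" if "t \<in> T" for t using sq(2) that T by auto
  show mean: "(\<integral>\<omega>. (\<Sum>t\<in>T. \<xi> t * Y \<omega> t) \<partial>M) = (\<Sum>t\<in>T. \<xi> t * (\<integral>\<omega>. Y \<omega> t \<partial>M))"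
    using int by (simp add: Bochner_Integration.integral_sum)
  \<comment> \<open>Square integrability of the single variables gives integrability of the products by
    \<open>2 * \<bar>z * z'\<bar> \<le> z\<^sup>2 + z'\<^sup>2\<close>.\<close>
  define Z where "Z t \<omega> = Y \<omega> t - (\<integral>\<omega>. Y \<omega> t \<partial>M)" for t \<omega>
  have Z2: "integrable M (\<lambda>\<omega>. Z t \<omega> * Z t \<omega>)" if "t \<in> T" for t
  proof -
    have "integrable M (\<lambda>\<omega>. Y \<omega> t * Y \<omega> t - 2 * (\<integral>\<omega>. Y \<omega> t \<partial>M) * Y \<omega> t + (\<integral>\<omega>. Y \<omega> t \<partial>M) * (\<integral>\<omega>. Y \<omega> t \<partial>M))"
      using sq(3)[of t] int[OF that] that T by auto
    then show ?thesis unfolding Z_def by (simp add: algebra_simps)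
  qed
  have [measurable]: "Z t \<in> borel_measurable M" if "t \<in> T" for t
    unfolding Z_def using sq(1)[of t] that T by auto
  have prod: "integrable M (\<lambda>\<omega>. Z s \<omega> * Z t \<omega>)" if "s \<in> T" "t \<in> T" for s t
  proof (rule Bochner_Integration.integrable_bound[OF Bochner_Integration.integrable_add[OF Z2[OF that(1)] Z2[OF that(2)]]])
    show "AE \<omega> in M. norm (Z s \<omega> * Z t \<omega>) \<le> norm (Z s \<omega> * Z s \<omega> + Z t \<omega> * Z t \<omega>)"
    proof (rule AE_I2)
      fix \<omega>
      have "2 * (\<bar>Z s \<omega>\<bar> * \<bar>Z t \<omega>\<bar>) \<le> Z s \<omega> * Z s \<omega> + Z t \<omega> * Z t \<omega>"
        using zero_le_square[of "\<bar>Z s \<omega>\<bar> - \<bar>Z t \<omega>\<bar>"] by (simp add: algebra_simps)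
      moreover have "0 \<le> \<bar>Z s \<omega>\<bar> * \<bar>Z t \<omega>\<bar>" by simp
      ultimately show "norm (Z s \<omega> * Z t \<omega>) \<le> norm (Z s \<omega> * Z s \<omega> + Z t \<omega> * Z t \<omega>)"
        unfolding real_norm_def abs_mult[of "Z s \<omega>" "Z t \<omega>"] by linarith
    qed
  qed (use that in measurable)
  have centred: "(\<Sum>t\<in>T. \<xi> t * Y \<omega> t) - (\<Sum>t\<in>T. \<xi> t * (\<integral>\<omega>. Y \<omega> t \<partial>M)) = (\<Sum>t\<in>T. \<xi> t * Z t \<omega>)" for \<omega>
    by (simp add: Z_def right_diff_distrib sum_subtractf)
  have "cov M (\<lambda>\<omega>. \<Sum>t\<in>T. \<xi> t * Y \<omega> t) (\<lambda>\<omega>. \<Sum>t\<in>T. \<xi> t * Y \<omega> t)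
      = (\<integral>\<omega>. (\<Sum>t\<in>T. \<xi> t * Z t \<omega>) * (\<Sum>t\<in>T. \<xi> t * Z t \<omega>) \<partial>M)"
    unfolding cov_def mean centred ..
  also have "\<dots> = (\<integral>\<omega>. (\<Sum>s\<in>T. \<Sum>t\<in>T. (\<xi> s * \<xi> t) * (Z s \<omega> * Z t \<omega>)) \<partial>M)"
    by (simp add: sum_product mult_ac)
  also have "\<dots> = (\<Sum>s\<in>T. \<Sum>t\<in>T. (\<xi> s * \<xi> t) * (\<integral>\<omega>. Z s \<omega> * Z t \<omega> \<partial>M))"
    using prod by (simp add: Bochner_Integration.integral_sum Bochner_Integration.integrable_sum)
  finally show "cov M (\<lambda>\<omega>. \<Sum>t\<in>T. \<xi> t * Y \<omega> t) (\<lambda>\<omega>. \<Sum>t\<in>T. \<xi> t * Y \<omega> t)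
      = (\<Sum>s\<in>T. \<Sum>t\<in>T. \<xi> s * \<xi> t * cov M (\<lambda>\<omega>. Y \<omega> s) (\<lambda>\<omega>. Y \<omega> t))"
    by (simp add: cov_def Z_def)
qed

lemma prob_space_PiM_gauss: "prob_space (PiM I (\<lambda>_. std_gauss))"
  by (rule prob_space_PiM) (rule prob_space_std_gauss)

lemma indep_coordinates_gauss:
  assumes "i \<in> I"
  shows "distributed (PiM I (\<lambda>_. std_gauss)) lborel (\<lambda>g. g i) std_normal_density"
    and "prob_space.indep_vars (PiM I (\<lambda>_. std_gauss)) (\<lambda>_. borel) (\<lambda>i g. g i) I"
proof -
  interpret prob_space "PiM I (\<lambda>_. std_gauss)" by (rule prob_space_PiM_gauss)
  have comp [measurable]: "(\<lambda>g. g j) \<in> borel_measurable (PiM I (\<lambda>_. std_gauss))" if "j \<in> I" for j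
    using measurable_component_singleton[OF that, of "\<lambda>_. std_gauss"] sets_std_gauss by (simp cong: measurable_cong_sets)
  have law: "distr (PiM I (\<lambda>_. std_gauss)) std_gauss (\<lambda>g. g j) = std_gauss" if "j \<in> I" for j
    using distr_PiM_component[of I "\<lambda>_. std_gauss" j] that prob_space_std_gauss by simp
  have law_borel: "distr (PiM I (\<lambda>_. std_gauss)) borel (\<lambda>g. g j) = std_gauss" if "j \<in> I" for j
    using law[OF that] distr_cong[OF refl, of borel std_gauss] sets_std_gauss by metis
  have "distr (PiM I (\<lambda>_. std_gauss)) lborel (\<lambda>g. g i) = std_gauss"
    using law_borel[OF assms] distr_cong[OF refl, of borel lborel] by (metis sets_lborel)
  then show "distributed (PiM I (\<lambda>_. std_gauss)) lborel (\<lambda>g. g i) std_normal_density"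
    unfolding distributed_def using comp[OF assms] by (simp add: std_gauss_def)
  have "distr (PiM I (\<lambda>_. std_gauss)) (PiM I (\<lambda>_. borel)) (\<lambda>g. \<lambda>i\<in>I. g i)
      = distr (PiM I (\<lambda>_. std_gauss)) (PiM I (\<lambda>_. std_gauss)) (\<lambda>g. g)"
    by (rule distr_cong) (auto intro!: sets_PiM_cong simp: sets_std_gauss space_PiM fun_eq_iff restrict_def PiE_def extensional_def)
  also have "\<dots> = PiM I (\<lambda>_. std_gauss)" by (rule distr_id)
  also have "\<dots> = PiM I (\<lambda>i. distr (PiM I (\<lambda>_. std_gauss)) borel (\<lambda>g. g i))"
    by (rule PiM_cong) (use law_borel in auto)
  finally show "indep_vars (\<lambda>_. borel) (\<lambda>i g. g i) I"
    using indep_vars_iff_distr_eq_PiM'[where I = I and M' = "\<lambda>_. borel" and X = "\<lambda>i g. g i"] assms comp by blast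
qed

lemma gauss_linear_form:
  assumes I: "finite I"
  defines "M \<equiv> PiM I (\<lambda>_. std_gauss)"
  shows "gaussian_rv M (\<lambda>g. d + (\<Sum>i\<in>I. a i * g i))"
    and "(\<integral>g. d + (\<Sum>i\<in>I. a i * g i) \<partial>M) = d"
    and "cov M (\<lambda>g. d + (\<Sum>i\<in>I. a i * g i)) (\<lambda>g. d + (\<Sum>i\<in>I. a i * g i)) = (\<Sum>i\<in>I. (a i)\<^sup>2)"
proof -
  interpret prob_space M unfolding M_def by (rule prob_space_PiM_gauss)
  have [measurable]: "(\<lambda>g. g i) \<in> borel_measurable M" if "i \<in> I" for i
    using indep_coordinates_gauss(1)[OF that] unfolding M_def distributed_def by simp
  have meas: "(\<lambda>g. d + (\<Sum>i\<in>I. a i * g i)) \<in> borel_measurable M" by measurable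
  \<comment> \<open>Vanishing coefficients are dropped: the sum theorem for normal variables needs positive
    variances.\<close>
  define J where "J = {i \<in> I. a i \<noteq> 0}"
  have J: "finite J" "J \<subseteq> I" using I by (auto simp: J_def)
  have sumJ: "(\<Sum>i\<in>I. a i * g i) = (\<Sum>i\<in>J. a i * g i)" "(\<Sum>i\<in>I. (a i)\<^sup>2) = (\<Sum>i\<in>J. (a i)\<^sup>2)" for g :: "'a \<Rightarrow> real"
    using I by (auto simp: J_def intro!: sum.mono_neutral_right)
  have all: "gaussian_rv M (\<lambda>g. d + (\<Sum>i\<in>I. a i * g i)) \<and> (\<integral>g. d + (\<Sum>i\<in>I. a i * g i) \<partial>M) = d
    \<and> cov M (\<lambda>g. d + (\<Sum>i\<in>I. a i * g i)) (\<lambda>g. d + (\<Sum>i\<in>I. a i * g i)) = (\<Sum>i\<in>I. (a i)\<^sup>2)"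
  proof (cases "J = {}")
    case True
    then show ?thesis using meas unfolding sumJ by (auto simp: gaussian_rv_def cov_def prob_space)
  next
    case False
    then obtain j where "j \<in> I" using J by auto
    have "indep_vars (\<lambda>_. borel) (\<lambda>i g. a i * g i) J"
      using indep_vars_compose2[OF indep_vars_subset[OF indep_coordinates_gauss(2)[OF \<open>j \<in> I\<close>, folded M_def] J(2)],
          of "\<lambda>i x. a i * x" "\<lambda>_. borel"] by simp
    moreover have "distributed M lborel (\<lambda>g. a i * g i) (normal_density 0 \<bar>a i\<bar>)" if "i \<in> J" for i
      using normal_density_affine[of "\<lambda>g. g i" 0 1 "a i" 0] indep_coordinates_gauss(1)[of i I] that J(2)
      by (auto simp: M_def J_def)
    ultimately have "distributed M lborel (\<lambda>g. \<Sum>i\<in>J. a i * g i)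
        (normal_density (\<Sum>i\<in>J. 0) (sqrt (\<Sum>i\<in>J. (\<bar>a i\<bar>)\<^sup>2)))"
      using False J(1) by (intro sum_indep_normal) (auto simp: J_def)
    moreover have pos: "0 < sqrt (\<Sum>i\<in>J. (a i)\<^sup>2)"
      using False J(1) by (auto simp: J_def intro!: sum_pos)
    ultimately have D: "distributed M lborel (\<lambda>g. d + (\<Sum>i\<in>I. a i * g i)) (normal_density d (sqrt (\<Sum>i\<in>J. (a i)\<^sup>2)))"
      using normal_density_affine[of "\<lambda>g. \<Sum>i\<in>J. a i * g i" 0 "sqrt (\<Sum>i\<in>J. (a i)\<^sup>2)" 1 d] unfolding sumJ by simp
    have "(\<integral>g. d + (\<Sum>i\<in>I. a i * g i) \<partial>M) = d" by (rule normal_distributed_expectation[OF pos D])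
    moreover have "cov M (\<lambda>g. d + (\<Sum>i\<in>I. a i * g i)) (\<lambda>g. d + (\<Sum>i\<in>I. a i * g i)) = (\<Sum>i\<in>I. (a i)\<^sup>2)"
      using normal_distributed_variance[OF pos D] unfolding cov_def sumJ
      by (simp add: power2_eq_square[symmetric] sum_nonneg)
    moreover have "gaussian_rv M (\<lambda>g. d + (\<Sum>i\<in>I. a i * g i))"
      using meas pos D unfolding gaussian_rv_def by blast
    ultimately show ?thesis by blast
  qed
  show "gaussian_rv M (\<lambda>g. d + (\<Sum>i\<in>I. a i * g i))" using all by blast
  show "(\<integral>g. d + (\<Sum>i\<in>I. a i * g i) \<partial>M) = d" using all by blast
  show "cov M (\<lambda>g. d + (\<Sum>i\<in>I. a i * g i)) (\<lambda>g. d + (\<Sum>i\<in>I. a i * g i)) = (\<Sum>i\<in>I. (a i)\<^sup>2)" using all by blast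
qed

text \<open>Every projection of the process is Gaussian with mean and variance determined by \<open>m\<close>
and the covariance, hence has the law of the same projection of a linear form in independent normal variables.
The coordinates of the Gaussian observation model thus exist in law, although the probability space that
carries the process may be too small for them.\<close>

theorem gaussian_process_representation:
  fixes Y :: "'w \<Rightarrow> 't \<Rightarrow> real" and f :: "('t \<Rightarrow> real) \<Rightarrow> real" and x :: "'i \<Rightarrow> 't \<Rightarrow> real"
  assumes Y: "gaussian_process M S Y" and T: "finite T" "T \<subseteq> S" and I: "finite I"
    and mean: "\<And>t. t \<in> T \<Longrightarrow> (\<integral>\<omega>. Y \<omega> t \<partial>M) = m t"
    and cov: "\<And>s t. s \<in> T \<Longrightarrow> t \<in> T \<Longrightarrow> cov M (\<lambda>\<omega>. Y \<omega> s) (\<lambda>\<omega>. Y \<omega> t) = (\<Sum>i\<in>I. x i s * x i t)"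
    and f: "f \<in> borel_measurable (PiM T (\<lambda>_. borel))"
  shows "(\<integral>\<omega>. f (\<lambda>t\<in>T. Y \<omega> t) \<partial>M) = (\<integral>g. f (\<lambda>t\<in>T. m t + (\<Sum>i\<in>I. x i t * g i)) \<partial>PiM I (\<lambda>_. std_gauss))"
proof -
  let ?N = "PiM I (\<lambda>_. std_gauss)"
  let ?W = "\<lambda>t g. m t + (\<Sum>i\<in>I. x i t * g i)"
  have M: "prob_space M" using Y by (simp add: gaussian_process_def)
  have N: "prob_space ?N" by (rule prob_space_PiM_gauss)
  have V: "(\<lambda>\<omega>. Y \<omega> t) \<in> borel_measurable M" if "t \<in> T" for t
    using gaussian_process_linear_form(3)[OF Y T] that T by auto
  have W: "?W t \<in> borel_measurable ?N" for t
    using gauss_linear_form(1)[OF I, of "m t" "\<lambda>i. x i t"] by (simp add: gaussian_rv_def)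
  have "distr M borel (\<lambda>\<omega>. \<Sum>t\<in>T. \<xi> t * Y \<omega> t) = distr ?N borel (\<lambda>g. \<Sum>t\<in>T. \<xi> t * ?W t g)" for \<xi>
  proof -
    let ?a = "\<lambda>i. \<Sum>t\<in>T. \<xi> t * x i t" and ?d = "\<Sum>t\<in>T. \<xi> t * m t"
    have form: "(\<lambda>g. \<Sum>t\<in>T. \<xi> t * ?W t g) = (\<lambda>g. ?d + (\<Sum>i\<in>I. ?a i * g i))"
    proof
      fix g
      have "(\<Sum>t\<in>T. \<xi> t * (\<Sum>i\<in>I. x i t * g i)) = (\<Sum>i\<in>I. ?a i * g i)"
        unfolding sum_distrib_left sum_distrib_right by (subst sum.swap) (simp add: mult_ac)
      then show "(\<Sum>t\<in>T. \<xi> t * ?W t g) = ?d + (\<Sum>i\<in>I. ?a i * g i)"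
        by (simp add: distrib_left sum.distrib)
    qed
    have rv: "gaussian_rv M (\<lambda>\<omega>. \<Sum>t\<in>T. \<xi> t * Y \<omega> t)"
      using Y T by (simp add: gaussian_process_def)
    have "cov M (\<lambda>\<omega>. \<Sum>t\<in>T. \<xi> t * Y \<omega> t) (\<lambda>\<omega>. \<Sum>t\<in>T. \<xi> t * Y \<omega> t)
        = (\<Sum>s\<in>T. \<Sum>t\<in>T. \<Sum>i\<in>I. (\<xi> s * x i s) * (\<xi> t * x i t))"
      unfolding gaussian_process_linear_form(2)[OF Y T]
      by (intro sum.cong refl) (simp add: cov sum_distrib_left mult_ac)
    also have "\<dots> = (\<Sum>s\<in>T. \<Sum>i\<in>I. \<Sum>t\<in>T. (\<xi> s * x i s) * (\<xi> t * x i t))"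
      by (rule sum.cong[OF refl], rule sum.swap)
    also have "\<dots> = (\<Sum>i\<in>I. \<Sum>s\<in>T. \<Sum>t\<in>T. (\<xi> s * x i s) * (\<xi> t * x i t))"
      by (rule sum.swap)
    also have "\<dots> = (\<Sum>i\<in>I. (?a i)\<^sup>2)"
      unfolding power2_eq_square sum_product ..
    finally have c: "cov M (\<lambda>\<omega>. \<Sum>t\<in>T. \<xi> t * Y \<omega> t) (\<lambda>\<omega>. \<Sum>t\<in>T. \<xi> t * Y \<omega> t) = (\<Sum>i\<in>I. (?a i)\<^sup>2)" .
    have e: "(\<integral>\<omega>. (\<Sum>t\<in>T. \<xi> t * Y \<omega> t) \<partial>M) = ?d"
      unfolding gaussian_process_linear_form(1)[OF Y T] by (simp add: mean)
    show ?thesis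
      unfolding form gaussian_rv_law[OF M rv] gaussian_rv_law[OF N gauss_linear_form(1)[OF I]]
        gauss_linear_form(2,3)[OF I] c e ..
  qed
  from cramer_wold[OF M N T(1) V W this]
  have law: "distr M (PiM T (\<lambda>_. borel)) (\<lambda>\<omega>. \<lambda>t\<in>T. Y \<omega> t) = distr ?N (PiM T (\<lambda>_. borel)) (\<lambda>g. \<lambda>t\<in>T. ?W t g)" .
  have "(\<integral>\<omega>. f (\<lambda>t\<in>T. Y \<omega> t) \<partial>M) = (\<integral>z. f z \<partial>distr M (PiM T (\<lambda>_. borel)) (\<lambda>\<omega>. \<lambda>t\<in>T. Y \<omega> t))"
    by (rule integral_distr[OF measurable_restrict[OF V] f, symmetric])
  also have "\<dots> = (\<integral>g. f (\<lambda>t\<in>T. ?W t g) \<partial>?N)"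
    unfolding law by (rule integral_distr[OF measurable_restrict[OF W] f])
  finally show ?thesis .
qed

section \<open>Priors on the cube and their discretisations\<close>

text \<open>Rounding every coordinate down to a multiple of \<open>1 / Suc k\<close>. This keeps the cube
invariant, as \<open>-1\<close> and \<open>1\<close> are such multiples, has finite range, and is the value
\<open>undefined\<close> outside \<open>{..<n}\<close>, as in the cube.\<close>

definition grid :: "nat \<Rightarrow> nat \<Rightarrow> (nat \<Rightarrow> real ^ 'd::finite) \<Rightarrow> nat \<Rightarrow> real ^ 'd" where
  "grid n k u = (\<lambda>i\<in>{..<n}. \<chi> j. real_of_int \<lfloor>real (Suc k) * u i $ j\<rfloor> / real (Suc k))"

lemma floor_scaled:
  assumes "x \<in> {-1..1}" shows "\<lfloor>real N * x\<rfloor> \<in> {- int N..int N}"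
proof -
  have "real N * x \<le> real N * 1" by (rule mult_left_mono) (use assms in auto)
  moreover have "real N * (- 1) \<le> real N * x" by (rule mult_left_mono) (use assms in auto)
  ultimately have "real N * x < real_of_int (int N) + 1"
    "real_of_int (- int N) \<le> real N * x" by linarith+
  then show ?thesis unfolding atLeastAtMost_iff le_floor_iff floor_le_iff by blast
qed

lemma grid_in_cube: assumes "u \<in> cube n" shows "grid n k u \<in> cube n"
proof -
  have "real_of_int \<lfloor>real (Suc k) * x\<rfloor> / real (Suc k) \<in> {-1..1}" if "x \<in> {-1..1}" for x
  proof -
    have "real_of_int \<lfloor>real (Suc k) * x\<rfloor> \<le> real (Suc k)" "- real (Suc k) \<le> real_of_int \<lfloor>real (Suc k) * x\<rfloor>"
      using floor_scaled[OF that, of "Suc k"] unfolding atLeastAtMost_iff by linarith+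
    then show ?thesis by (simp add: field_simps)
  qed
  then show ?thesis using assms unfolding cube_def grid_def by (auto simp: PiE_iff)
qed

lemma finite_grid: "finite (grid n k ` (cube n :: (nat \<Rightarrow> real ^ 'd::finite) set))"
proof (rule finite_subset)
  let ?S = "(\<lambda>z. real_of_int z / real (Suc k)) ` {- int (Suc k)..int (Suc k)}"
  let ?V = "(\<lambda>f. \<chi> j. f j) ` (UNIV \<rightarrow>\<^sub>E ?S) :: (real ^ 'd) set"
  show "finite ({..<n} \<rightarrow>\<^sub>E ?V)" by (intro finite_PiE finite_imageI) auto
  show "grid n k ` cube n \<subseteq> {..<n} \<rightarrow>\<^sub>E ?V"
  proof
    fix w assume "w \<in> grid n k ` (cube n :: (nat \<Rightarrow> real ^ 'd) set)"
    then obtain u :: "nat \<Rightarrow> real ^ 'd" where u: "u \<in> cube n" "w = grid n k u" by auto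
    have "w i \<in> ?V" if i: "i < n" for i
    proof
      show "w i = (\<chi> j. real_of_int \<lfloor>real (Suc k) * u i $ j\<rfloor> / real (Suc k))"
        using i by (simp add: u(2) grid_def)
      have "real_of_int \<lfloor>real (Suc k) * u i $ j\<rfloor> / real (Suc k) \<in> ?S" for j
      proof (rule imageI)
        have "u i $ j \<in> {-1..1}" using u(1) i by (auto simp: cube_def PiE_iff)
        then show "\<lfloor>real (Suc k) * u i $ j\<rfloor> \<in> {- int (Suc k)..int (Suc k)}" by (rule floor_scaled)
      qed
      then show "(\<lambda>j. real_of_int \<lfloor>real (Suc k) * u i $ j\<rfloor> / real (Suc k)) \<in> UNIV \<rightarrow>\<^sub>E ?S" by auto
    qed
    then show "w \<in> {..<n} \<rightarrow>\<^sub>E ?V" by (auto simp: u(2) PiE_iff grid_def)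
  qed
qed

lemma grid_tendsto: assumes "u \<in> cube n" shows "(\<lambda>k. grid n k u) \<longlonglongrightarrow> u"
proof -
  have floor_lim: "(\<lambda>k. real_of_int \<lfloor>real (Suc k) * x\<rfloor> / real (Suc k)) \<longlonglongrightarrow> x" for x :: real
  proof (rule real_tendsto_sandwich[where f = "\<lambda>k. x - 1 / real (Suc k)" and h = "\<lambda>_. x"])
    show "(\<lambda>k. x - 1 / real (Suc k)) \<longlonglongrightarrow> x"
      using tendsto_diff[OF tendsto_const LIMSEQ_Suc[OF lim_1_over_n], of x] by simp
    have "x - 1 / real (Suc k) \<le> real_of_int \<lfloor>real (Suc k) * x\<rfloor> / real (Suc k)"
      "real_of_int \<lfloor>real (Suc k) * x\<rfloor> / real (Suc k) \<le> x" for k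
    proof -
      have bracket: "x - 1 / M \<le> real_of_int \<lfloor>M * x\<rfloor> / M \<and> real_of_int \<lfloor>M * x\<rfloor> / M \<le> x"
        if "0 < M" for M :: real
      proof -
        have "(M * x - 1) / M \<le> real_of_int \<lfloor>M * x\<rfloor> / M" "real_of_int \<lfloor>M * x\<rfloor> / M \<le> (M * x) / M"
          using that by (intro divide_right_mono; linarith)+
        then show ?thesis using that by (simp add: diff_divide_distrib)
      qed
      show "x - 1 / real (Suc k) \<le> real_of_int \<lfloor>real (Suc k) * x\<rfloor> / real (Suc k)"
        "real_of_int \<lfloor>real (Suc k) * x\<rfloor> / real (Suc k) \<le> x"
        using bracket[OF of_nat_0_less_iff[THEN iffD2, OF zero_less_Suc]] by blast+
    qed
    then show "\<forall>\<^sub>F k in sequentially. x - 1 / real (Suc k) \<le> real_of_int \<lfloor>real (Suc k) * x\<rfloor> / real (Suc k)"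
      "\<forall>\<^sub>F k in sequentially. real_of_int \<lfloor>real (Suc k) * x\<rfloor> / real (Suc k) \<le> x" by auto
  qed simp
  have "(\<lambda>k. grid n k u i) \<longlonglongrightarrow> u i" for i
  proof (cases "i < n")
    case True
    then show ?thesis unfolding grid_def by (auto intro!: vec_tendstoI floor_lim simp del: of_nat_Suc)
  next
    case False
    then show ?thesis using assms by (auto simp: grid_def cube_def PiE_iff extensional_def)
  qed
  then have "limitin (product_topology (\<lambda>i. euclidean) UNIV) (\<lambda>k. grid n k u) u sequentially"
    unfolding limitin_componentwise by simp
  then show ?thesis by (simp add: euclidean_product_topology)
qed

lemma compact_cube: "compact (cube n :: (nat \<Rightarrow> real ^ 'd::finite) set)"
proof -
  let ?S = "\<lambda>i. if i < n then {x :: real ^ 'd. \<forall>j. x $ j \<in> {-1..1}} else {undefined}"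
  have "{x :: real ^ 'd. \<forall>j. x $ j \<in> {-1..1}} = cbox (\<chi> j. -1) (\<chi> j. 1)"
    by (auto simp: mem_box_cart)
  then have "compact (?S i)" for i by simp
  then have "compactin (product_topology (\<lambda>i. euclidean) UNIV) (PiE UNIV ?S)"
    unfolding compactin_PiE by simp
  moreover have "PiE UNIV ?S = cube n"
    by (auto simp: cube_def PiE_iff extensional_def split: if_splits)
  ultimately show ?thesis by (simp add: euclidean_product_topology)
qed

locale cube_prior =
  fixes n :: nat and \<pi> :: "(nat \<Rightarrow> real ^ 'd::finite) measure"
  assumes prior: "prior_on_cube n \<pi>"
begin

sublocale prob_space \<pi> using prior by (simp add: prior_on_cube_def)

lemma sets_\<pi>: "sets \<pi> = sets (cube_sigma n)" using prior by (simp add: prior_on_cube_def)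

lemma space_\<pi>: "space \<pi> = cube n"
  using sets_eq_imp_space_eq[OF sets_\<pi>]
  by (auto simp: cube_sigma_def space_restrict_space space_PiM cube_def)

lemma coordinate_measurable: assumes "i < n" shows "(\<lambda>u. u i $ j) \<in> borel_measurable \<pi>"
proof -
  have "(\<lambda>u. u i) \<in> borel_measurable (cube_sigma n :: (nat \<Rightarrow> real ^ 'd) measure)"
    unfolding cube_sigma_def
    using assms by (intro measurable_restrict_space1 measurable_component_singleton) auto
  then have "(\<lambda>u. u i) \<in> borel_measurable \<pi>" using sets_\<pi> by (simp cong: measurable_cong_sets)
  moreover have "(\<lambda>x :: real ^ 'd. x $ j) \<in> borel_measurable borel"
    by (intro borel_measurable_continuous_onI continuous_intros)
  ultimately show ?thesis by (rule measurable_compose)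
qed

lemma grid_measurable: "grid n k \<in> measurable \<pi> (count_space (grid n k ` cube n))"
  unfolding measurable_count_space_eq2[OF finite_grid]
proof (intro conjI ballI)
  show "grid n k \<in> space \<pi> \<rightarrow> grid n k ` cube n" by (auto simp: space_\<pi>)
  fix a :: "nat \<Rightarrow> real ^ 'd" assume "a \<in> grid n k ` cube n"
  then have ext: "a i = undefined" if "\<not> i < n" for i using that by (auto simp: grid_def)
  have "grid n k -` {a} \<inter> space \<pi> =
      {u \<in> space \<pi>. \<forall>i\<in>{..<n}. \<forall>j\<in>UNIV. real_of_int \<lfloor>real (Suc k) * u i $ j\<rfloor> / real (Suc k) = a i $ j}"
    using ext by (fastforce simp: grid_def fun_eq_iff vec_eq_iff restrict_def)
  also have "\<dots> \<in> sets \<pi>"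
  proof (intro sets.sets_Collect_finite_All)
    fix i j assume "i \<in> {..<n}"
    then have [measurable]: "(\<lambda>u. u i $ j) \<in> borel_measurable \<pi>" by (intro coordinate_measurable) auto
    show "{u \<in> space \<pi>. real_of_int \<lfloor>real (Suc k) * u i $ j\<rfloor> / real (Suc k) = a i $ j} \<in> sets \<pi>"
      by measurable
  qed auto
  finally show "grid n k -` {a} \<inter> space \<pi> \<in> sets \<pi>" .
qed

definition "grid_weight k t = prob (grid n k -` {t} \<inter> space \<pi>)"
abbreviation "nodes k \<equiv> grid n k ` (cube n :: (nat \<Rightarrow> real ^ 'd) set)"

lemma nodes_subset: "nodes k \<subseteq> cube n" by (auto intro: grid_in_cube)

lemma comp_grid_measurable: "(\<lambda>u. f (grid n k u)) \<in> measurable \<pi> borel"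
  by (rule measurable_compose[OF grid_measurable]) simp

lemma integral_grid:
  fixes f :: "_ \<Rightarrow> real"
  shows "(\<integral>u. f (grid n k u) \<partial>\<pi>) = (\<Sum>t\<in>nodes k. grid_weight k t * f t)"
proof -
  have sets: "grid n k -` {t} \<inter> space \<pi> \<in> sets \<pi>" if "t \<in> nodes k" for t
    using grid_measurable[of k] that unfolding measurable_count_space_eq2[OF finite_grid] by blast
  have "(\<integral>u. f (grid n k u) \<partial>\<pi>)
      = (\<integral>u. (\<Sum>t\<in>nodes k. f t * indicator (grid n k -` {t} \<inter> space \<pi>) u) \<partial>\<pi>)"
  proof (rule Bochner_Integration.integral_cong[OF refl])
    fix u assume u: "u \<in> space \<pi>"
    have "(\<Sum>t\<in>nodes k. f t * indicator (grid n k -` {t} \<inter> space \<pi>) u) = (\<Sum>t\<in>{grid n k u}. f t)"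
      using u finite_grid[of n k]
      by (intro sum.mono_neutral_cong_right) (auto simp: space_\<pi> indicator_def)
    then show "f (grid n k u) = (\<Sum>t\<in>nodes k. f t * indicator (grid n k -` {t} \<inter> space \<pi>) u)" by simp
  qed
  also have "\<dots> = (\<Sum>t\<in>nodes k. f t * grid_weight k t)"
    using sets by (subst Bochner_Integration.integral_sum) (auto simp: grid_weight_def emeasure_eq_measure)
  finally show ?thesis by (simp add: mult.commute)
qed

lemma weights_grid: "weights (nodes k) (grid_weight k)"
  using integral_grid[of "\<lambda>_. 1" k] finite_grid[of n k]
  by (auto simp: weights_def grid_weight_def prob_space)

lemma comp_grid_tendsto:
  assumes "continuous_on (cube n) f" "u \<in> cube n" shows "(\<lambda>k. f (grid n k u)) \<longlonglongrightarrow> f u"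
  using assms grid_tendsto[OF assms(2)] grid_in_cube[OF assms(2)]
  by (auto intro!: continuous_on_tendsto_compose[of "cube n" f] always_eventually)

text \<open>Measurability refers to a product of Borel \<open>\<sigma>\<close>-algebras, continuity to the
product topology. Rounding links the two: a continuous function is the limit of functions of the rounded
parameter, which take finitely many values.\<close>

lemma continuous_measurable:
  fixes f :: "_ \<Rightarrow> 'b::metric_space"
  assumes "continuous_on (cube n) f" shows "f \<in> borel_measurable \<pi>"
  by (rule borel_measurable_LIMSEQ_metric[OF comp_grid_measurable[of f]])
    (use comp_grid_tendsto[OF assms] in \<open>simp add: space_\<pi>\<close>)

lemma continuous_bounded:
  fixes f :: "_ \<Rightarrow> 'b::real_normed_vector"
  assumes "continuous_on (cube n) f" obtains B where "\<And>u. u \<in> cube n \<Longrightarrow> norm (f u) \<le> B"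
proof -
  have "bounded (f ` cube n)" using compact_continuous_image[OF assms compact_cube] by (rule compact_imp_bounded)
  then show ?thesis using that by (auto simp: bounded_iff)
qed

lemma continuous_integrable:
  fixes f :: "_ \<Rightarrow> 'b::{banach, second_countable_topology}"
  assumes "continuous_on (cube n) f" shows "integrable \<pi> f"
proof -
  obtain B where "\<And>u. u \<in> cube n \<Longrightarrow> norm (f u) \<le> B" using continuous_bounded[OF assms] by blast
  then show ?thesis using continuous_measurable[OF assms]
    by (intro integrable_const_bound[where B = B]) (auto simp: space_\<pi> intro!: AE_I2)
qed

lemma integral_grid_tendsto:
  fixes f :: "_ \<Rightarrow> real"
  assumes "continuous_on (cube n) f"
  shows "(\<lambda>k. \<Sum>t\<in>nodes k. grid_weight k t * f t) \<longlonglongrightarrow> (\<integral>u. f u \<partial>\<pi>)"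
proof -
  obtain B where B: "\<And>u. u \<in> cube n \<Longrightarrow> norm (f u) \<le> B" using continuous_bounded[OF assms] by blast
  have "(\<lambda>k. \<integral>u. f (grid n k u) \<partial>\<pi>) \<longlonglongrightarrow> (\<integral>u. f u \<partial>\<pi>)"
  proof (rule integral_dominated_convergence[where w = "\<lambda>_. B"])
    show "AE u in \<pi>. (\<lambda>k. f (grid n k u)) \<longlonglongrightarrow> f u"
      by (rule AE_I2) (use comp_grid_tendsto[OF assms] in \<open>simp add: space_\<pi>\<close>)
    show "AE u in \<pi>. norm (f (grid n k u)) \<le> B" for k
      by (rule AE_I2, rule B, rule grid_in_cube) (simp add: space_\<pi>)
  qed (use continuous_measurable[OF assms] comp_grid_measurable in auto)
  then show ?thesis unfolding integral_grid .
qed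

definition post_avg :: "((nat \<Rightarrow> real ^ 'd) \<Rightarrow> real) \<Rightarrow> ((nat \<Rightarrow> real ^ 'd) \<Rightarrow> real) \<Rightarrow> real" where
  "post_avg Z f = (\<integral>u. exp (Z u) * f u \<partial>\<pi>) / (\<integral>u. exp (Z u) \<partial>\<pi>)"

context
  fixes Z :: "(nat \<Rightarrow> real ^ 'd) \<Rightarrow> real"
  assumes Z: "continuous_on (cube n) Z"
begin

lemma exp_Z: "continuous_on (cube n) (\<lambda>u. exp (Z u))"
  by (intro continuous_intros Z)

lemma partition_pos: "0 < (\<integral>u. exp (Z u) \<partial>\<pi>)"
proof -
  obtain B where B: "\<And>u. u \<in> cube n \<Longrightarrow> norm (Z u) \<le> B" using continuous_bounded[OF Z] by blast
  have "exp (- B) = (\<integral>u. exp (- B) \<partial>\<pi>)" by (simp add: prob_space)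
  also have "\<dots> \<le> (\<integral>u. exp (Z u) \<partial>\<pi>)"
  proof (rule integral_mono)
    fix u assume "u \<in> space \<pi>"
    then show "exp (- B) \<le> exp (Z u)" using B[of u] by (simp add: space_\<pi> abs_le_iff)
  qed (use continuous_integrable[OF exp_Z] in auto)
  finally show ?thesis using exp_gt_zero[of "- B"] by linarith
qed

lemma wavg_grid_tendsto:
  assumes "continuous_on (cube n) f"
  shows "(\<lambda>k. wavg (nodes k) (tilt (grid_weight k) Z) f) \<longlonglongrightarrow> post_avg Z f"
proof -
  have "continuous_on (cube n) (\<lambda>u. exp (Z u) * f u)" by (intro continuous_intros Z assms)
  from tendsto_divide[OF integral_grid_tendsto[OF this] integral_grid_tendsto[OF exp_Z]]
  show ?thesis using partition_pos unfolding wavg_def tilt_def post_avg_def by (simp add: mult.assoc)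
qed

lemma
  fixes f :: "_ \<Rightarrow> 'b::{banach, second_countable_topology}"
  assumes f: "continuous_on (cube n) f"
  shows integrable_posterior: "integrable (posterior \<pi> Z) f"
    and integral_posterior: "(\<integral>u. f u \<partial>posterior \<pi> Z) = (\<integral>u. (exp (Z u) / (\<integral>u. exp (Z u) \<partial>\<pi>)) *\<^sub>R f u \<partial>\<pi>)"
proof -
  have cont: "continuous_on (cube n) (\<lambda>u. exp (Z u) / (\<integral>u. exp (Z u) \<partial>\<pi>))"
    using partition_pos by (intro continuous_intros Z) auto
  have nn: "AE u in \<pi>. 0 \<le> exp (Z u) / (\<integral>u. exp (Z u) \<partial>\<pi>)" using partition_pos by simp
  note m = continuous_measurable[OF f] continuous_measurable[OF cont]
  show "integrable (posterior \<pi> Z) f"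
    unfolding posterior_def integrable_density[OF m nn]
    by (intro continuous_integrable continuous_on_scaleR cont f)
  show "(\<integral>u. f u \<partial>posterior \<pi> Z) = (\<integral>u. (exp (Z u) / (\<integral>u. exp (Z u) \<partial>\<pi>)) *\<^sub>R f u \<partial>\<pi>)"
    unfolding posterior_def by (rule integral_density[OF m nn])
qed

lemma integral_posterior_real: "continuous_on (cube n) f \<Longrightarrow> (\<integral>u. f u \<partial>posterior \<pi> Z) = post_avg Z f"
  by (simp add: integral_posterior post_avg_def divide_inverse mult_ac flip: integral_mult_right_zero)

end

end

lemma finite_multi_indices: "finite (multi_indices n :: ('p::finite \<Rightarrow> nat) set)"
  and card_multi_indices: "card (multi_indices n :: ('p::finite \<Rightarrow> nat) set) = n ^ CARD('p)"
proof -
  have eq: "(multi_indices n :: ('p \<Rightarrow> nat) set) = UNIV \<rightarrow>\<^sub>E {..<n}"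
    by (auto simp: multi_indices_def PiE_iff)
  show "finite (multi_indices n :: ('p \<Rightarrow> nat) set)" unfolding eq by (intro finite_PiE) auto
  show "card (multi_indices n :: ('p \<Rightarrow> nat) set) = n ^ CARD('p)" unfolding eq by (simp add: card_PiE)
qed

text \<open>The matrix \<open>J J\<^sup>T\<close> has rank one, so that only the scalar projections on the
coupling vectors enter the risks.\<close>

lemma H_form: "(Hmat J \<alpha> *v h) \<bullet> k = (J \<alpha> \<bullet> h) * (J \<alpha> \<bullet> k)"
proof -
  have "Hmat J \<alpha> *v h = (J \<alpha> \<bullet> h) *\<^sub>R J \<alpha>"
    by (simp add: Hmat_def vec_eq_iff matrix_vector_mult_def inner_vec_def sum_distrib_left sum_distrib_right mult_ac)
  then show ?thesis by simp
qed

lemma continuous_eta: "continuous_on S (\<lambda>u. eta n u \<alpha>)"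
  unfolding eta_def by (intro continuous_intros continuous_on_vec_lambda) (auto intro!: continuous_intros continuous_on_product_then_coordinatewise)

lemma continuous_zfun: "continuous_on S (\<lambda>u. zfun n J u \<alpha>)"
  unfolding zfun_def by (intro continuous_intros continuous_eta)

context cube_prior
begin

context
  fixes Z :: "(nat \<Rightarrow> real ^ 'd) \<Rightarrow> real" and J :: "('p::finite \<Rightarrow> nat) \<Rightarrow> real ^ ('p \<Rightarrow> 'd)"
  assumes Z: "continuous_on (cube n) Z"
begin

lemma inner_eta_hat: "J \<alpha> \<bullet> eta_hat n \<pi> Z \<alpha> = post_avg Z (\<lambda>u. zfun n J u \<alpha>)"
proof -
  have "J \<alpha> \<bullet> eta_hat n \<pi> Z \<alpha> = (\<integral>u. J \<alpha> \<bullet> eta n u \<alpha> \<partial>posterior \<pi> Z)"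
    unfolding eta_hat_def by (rule integral_inner_right[symmetric]) (rule integrable_posterior[OF Z continuous_eta])
  also have "\<dots> = (\<integral>u. zfun n J u \<alpha> \<partial>posterior \<pi> Z)" by (simp only: zfun_def)
  also have "\<dots> = post_avg Z (\<lambda>u. zfun n J u \<alpha>)" by (rule integral_posterior_real[OF Z continuous_zfun])
  finally show ?thesis .
qed

lemma sq_error_tendsto:
  "(\<lambda>k. \<Sum>\<alpha>\<in>multi_indices n. (zfun n J \<theta> \<alpha> - wavg (nodes k) (tilt (grid_weight k) Z) (\<lambda>u. zfun n J u \<alpha>))\<^sup>2)
    \<longlonglongrightarrow> sq_error n J \<pi> \<theta> Z"
proof -
  have "sq_error n J \<pi> \<theta> Z = (\<Sum>\<alpha>\<in>multi_indices n. (zfun n J \<theta> \<alpha> - post_avg Z (\<lambda>u. zfun n J u \<alpha>))\<^sup>2)"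
    unfolding sq_error_def H_norm_sq_def H_form by (simp add: inner_diff_right inner_eta_hat zfun_def power2_eq_square)
  then show ?thesis by (auto intro!: tendsto_intros wavg_grid_tendsto Z continuous_zfun)
qed

lemma post_var_tendsto:
  "(\<lambda>k. \<Sum>\<alpha>\<in>multi_indices n. wcov (nodes k) (tilt (grid_weight k) Z) (\<lambda>u. zfun n J u \<alpha>) (\<lambda>u. zfun n J u \<alpha>))
    \<longlonglongrightarrow> post_var n J \<pi> Z"
proof -
  let ?z = "\<lambda>\<alpha> u. zfun n J u \<alpha>" and ?c = "\<lambda>\<alpha>. post_avg Z (\<lambda>u. zfun n J u \<alpha>)"
  have w: "weights (nodes k) (tilt (grid_weight k) Z)" for k by (rule weights_tilt[OF weights_grid])
  have cont: "continuous_on (cube n) (\<lambda>u. \<Sum>\<alpha>\<in>multi_indices n. (?c \<alpha> - ?z \<alpha> u)\<^sup>2)"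
    by (intro continuous_intros continuous_zfun)
  have "post_var n J \<pi> Z = (\<integral>u. (\<Sum>\<alpha>\<in>multi_indices n. (?c \<alpha> - ?z \<alpha> u)\<^sup>2) \<partial>posterior \<pi> Z)"
    unfolding post_var_def H_norm_sq_def H_form
    by (simp add: inner_diff_right inner_eta_hat flip: zfun_def power2_eq_square) (simp add: power2_commute)
  also have "\<dots> = post_avg Z (\<lambda>u. \<Sum>\<alpha>\<in>multi_indices n. (?c \<alpha> - ?z \<alpha> u)\<^sup>2)"
    by (rule integral_posterior_real[OF Z cont])
  finally have eq: "post_var n J \<pi> Z = \<dots>" .
  have 1: "(\<lambda>k. \<Sum>\<alpha>\<in>multi_indices n. (?c \<alpha> - wavg (nodes k) (tilt (grid_weight k) Z) (?z \<alpha>))\<^sup>2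
      + wcov (nodes k) (tilt (grid_weight k) Z) (?z \<alpha>) (?z \<alpha>)) \<longlonglongrightarrow> post_var n J \<pi> Z"
    using wavg_grid_tendsto[OF Z cont] unfolding eq wavg_sum wavg_sq_dist[OF w] .
  have 2: "(\<lambda>k. \<Sum>\<alpha>\<in>multi_indices n. (?c \<alpha> - wavg (nodes k) (tilt (grid_weight k) Z) (?z \<alpha>))\<^sup>2)
      \<longlonglongrightarrow> (\<Sum>\<alpha>\<in>multi_indices n. (?c \<alpha> - ?c \<alpha>)\<^sup>2)"
    by (intro tendsto_intros wavg_grid_tendsto Z continuous_zfun)
  show ?thesis using tendsto_diff[OF 1 2] by (simp add: sum.distrib)
qed

end

end

section \<open>The two risks as limits of discretised ones\<close>

definition mse_fun :: "'i set \<Rightarrow> 't set \<Rightarrow> ('t \<Rightarrow> real) \<Rightarrow> ('i \<Rightarrow> 't \<Rightarrow> real) \<Rightarrow> ('i \<Rightarrow> real) \<Rightarrow> ('t \<Rightarrow> real) \<Rightarrow> real" where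
  "mse_fun I T v x y Z = (\<Sum>i\<in>I. (y i - wavg T (tilt v Z) (x i))\<^sup>2)"

definition var_fun :: "'i set \<Rightarrow> 't set \<Rightarrow> ('t \<Rightarrow> real) \<Rightarrow> ('i \<Rightarrow> 't \<Rightarrow> real) \<Rightarrow> ('t \<Rightarrow> real) \<Rightarrow> real" where
  "var_fun I T v x Z = (\<Sum>i\<in>I. wcov T (tilt v Z) (x i) (x i))"

lemma wavg_tilt_restrict: "wavg T (tilt v (restrict Z T)) f = wavg T (tilt v Z) f"
  unfolding wavg_def tilt_def by (simp cong: sum.cong)

lemma mse_fun_restrict: "mse_fun I T v x y (restrict Z T) = mse_fun I T v x y Z"
  and var_fun_restrict: "var_fun I T v x (restrict Z T) = var_fun I T v x Z"
  unfolding mse_fun_def var_fun_def wcov_def wavg_tilt_restrict by simp_all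

lemma wavg_tilt_measurable: "(\<lambda>z. wavg T (tilt v z) f) \<in> borel_measurable (PiM T (\<lambda>_. borel))"
  unfolding wavg_def tilt_def by measurable

lemma mse_fun_measurable: "mse_fun I T v x y \<in> borel_measurable (PiM T (\<lambda>_. borel))"
  unfolding mse_fun_def[abs_def] using wavg_tilt_measurable by measurable

lemma var_fun_measurable: "var_fun I T v x \<in> borel_measurable (PiM T (\<lambda>_. borel))"
  unfolding var_fun_def[abs_def] wcov_def using wavg_tilt_measurable by measurable

lemma measurable_of_restrict:
  assumes f: "f \<in> borel_measurable (PiM T (\<lambda>_. borel))" and "\<And>Z. f (restrict Z T) = f Z"
    and Z: "\<And>t. t \<in> T \<Longrightarrow> (\<lambda>\<omega>. Z \<omega> t) \<in> borel_measurable M"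
  shows "(\<lambda>\<omega>. f (Z \<omega>) :: real) \<in> borel_measurable M"
  using measurable_compose[OF measurable_restrict[of T "\<lambda>t \<omega>. Z \<omega> t" M "\<lambda>_. borel", OF Z] f] assms(2) by simp

lemma mse_fun_bound:
  assumes "weights T v" "\<And>i t. i \<in> I \<Longrightarrow> t \<in> T \<Longrightarrow> \<bar>x i t\<bar> \<le> \<kappa>" "\<And>i. i \<in> I \<Longrightarrow> \<bar>y i\<bar> \<le> \<kappa>"
  shows "\<bar>mse_fun I T v x y Z\<bar> \<le> real (card I) * (4 * \<kappa>\<^sup>2)"
proof -
  have "(y i - wavg T (tilt v Z) (x i))\<^sup>2 \<le> 4 * \<kappa>\<^sup>2" if i: "i \<in> I" for i
  proof -
    have "\<bar>wavg T (tilt v Z) (x i)\<bar> \<le> \<kappa>"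
      by (rule abs_wavg_le[OF weights_tilt[OF assms(1)] assms(2)[OF i]])
    then have "\<bar>y i - wavg T (tilt v Z) (x i)\<bar> \<le> 2 * \<kappa>" using assms(3)[OF i] by linarith
    then have "(y i - wavg T (tilt v Z) (x i))\<^sup>2 \<le> (2 * \<kappa>)\<^sup>2" by (metis abs_ge_zero power2_abs power_mono)
    then show ?thesis by simp
  qed
  then have "(\<Sum>i\<in>I. (y i - wavg T (tilt v Z) (x i))\<^sup>2) \<le> (\<Sum>i\<in>I. 4 * \<kappa>\<^sup>2)" by (rule sum_mono)
  moreover have "0 \<le> (\<Sum>i\<in>I. (y i - wavg T (tilt v Z) (x i))\<^sup>2)" by (simp add: sum_nonneg)
  ultimately show ?thesis by (simp add: mse_fun_def)
qed

lemma var_fun_bound: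
  assumes "weights T v" "\<And>i t. i \<in> I \<Longrightarrow> t \<in> T \<Longrightarrow> \<bar>x i t\<bar> \<le> \<kappa>"
  shows "\<bar>var_fun I T v x Z\<bar> \<le> real (card I) * (4 * \<kappa>\<^sup>2)"
proof -
  have "\<bar>wcov T (tilt v Z) (x i) (x i)\<bar> \<le> 4 * \<kappa>\<^sup>2" if i: "i \<in> I" for i
  proof -
    have "\<bar>wcov T (tilt v Z) (x i) (x i)\<bar> \<le> 2 * \<kappa> * \<kappa>"
      by (rule abs_wcov_le[OF weights_tilt[OF assms(1)] assms(2)[OF i] assms(2)[OF i]])
    moreover have "0 \<le> \<kappa> * \<kappa>" by simp
    ultimately show ?thesis unfolding power2_eq_square by linarith
  qed
  then have "(\<Sum>i\<in>I. \<bar>wcov T (tilt v Z) (x i) (x i)\<bar>) \<le> (\<Sum>i\<in>I. 4 * \<kappa>\<^sup>2)" by (rule sum_mono)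
  then show ?thesis unfolding var_fun_def by (simp add: order_trans[OF sum_abs])
qed

text \<open>The limit is measurable as a pointwise limit. In this way the errors, which involve integrals over
uncountably many parameters, are seen to be measurable functionals of the observation.\<close>

lemma (in prob_space) integral_tendsto_bounded:
  fixes F :: "nat \<Rightarrow> 'a \<Rightarrow> real"
  assumes "\<And>k. F k \<in> borel_measurable M" "\<And>k \<omega>. \<bar>F k \<omega>\<bar> \<le> B"
    and lim: "\<And>\<omega>. \<omega> \<in> space M \<Longrightarrow> (\<lambda>k. F k \<omega>) \<longlonglongrightarrow> G \<omega>"
  shows "(\<lambda>k. \<integral>\<omega>. F k \<omega> \<partial>M) \<longlonglongrightarrow> (\<integral>\<omega>. G \<omega> \<partial>M)"
proof (rule integral_dominated_convergence[where w = "\<lambda>_. B"])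
  show "G \<in> borel_measurable M" by (rule borel_measurable_LIMSEQ_real[OF lim assms(1)])
qed (use assms in auto)

lemma zfun_bound:
  fixes u :: "nat \<Rightarrow> real ^ 'd::finite" and \<alpha> :: "'p::finite \<Rightarrow> nat"
  assumes u: "u \<in> cube n" and \<alpha>: "\<alpha> \<in> multi_indices n" and J: "norm (J \<alpha>) \<le> K"
  shows "\<bar>zfun n J u \<alpha>\<bar> \<le> K * real CARD('p \<Rightarrow> 'd) * real n powr ((1 - real CARD('p)) / 2)"
proof -
  let ?e = "(\<chi> k. \<Prod>i\<in>UNIV. u (\<alpha> i) $ k i) :: real ^ ('p \<Rightarrow> 'd)"
  have "norm ?e \<le> (\<Sum>k\<in>UNIV. \<bar>?e $ k\<bar>)" by (rule norm_le_l1_cart)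
  also have "\<dots> \<le> (\<Sum>k\<in>(UNIV :: ('p \<Rightarrow> 'd) set). 1)"
  proof (rule sum_mono)
    fix k :: "'p \<Rightarrow> 'd"
    have "\<bar>u (\<alpha> i) $ k i\<bar> \<le> 1" for i
      using u \<alpha> by (auto simp: cube_def multi_indices_def PiE_iff abs_le_iff)
    then show "\<bar>?e $ k\<bar> \<le> 1" by (simp add: abs_prod prod_le_1)
  qed
  finally have e: "norm ?e \<le> real CARD('p \<Rightarrow> 'd)" by simp
  have "\<bar>zfun n J u \<alpha>\<bar> \<le> norm (J \<alpha>) * norm (eta n u \<alpha>)"
    unfolding zfun_def by (rule Cauchy_Schwarz_ineq2)
  also have "\<dots> = norm (J \<alpha>) * norm ?e * real n powr ((1 - real CARD('p)) / 2)" by (simp add: eta_def)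
  also have "\<dots> \<le> K * real CARD('p \<Rightarrow> 'd) * real n powr ((1 - real CARD('p)) / 2)"
    using J e order_trans[OF norm_ge_zero J] by (intro mult_right_mono mult_mono) auto
  finally show ?thesis .
qed

lemma powr_minus_half: assumes "0 < r" shows "r powr (- 1 / 2) = 1 / sqrt r"
proof -
  have "r powr (- 1 / 2) = r powr (- (1 / 2))" by simp
  also have "\<dots> = 1 / r powr (1 / 2)" by (rule powr_minus_divide)
  finally show ?thesis by (simp only: powr_half_sqrt[OF less_imp_le[OF assms]])
qed

text \<open>One size \<open>n\<close>, one prior and one true parameter, with signals bounded by
\<open>K\<close> over the square root of \<open>s\<^sub>n\<close>.\<close>

locale model = cube_prior n \<pi> for n and \<pi> :: "(nat \<Rightarrow> real ^ 'd::finite) measure" +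
  fixes J :: "('p::finite \<Rightarrow> nat) \<Rightarrow> real ^ ('p \<Rightarrow> 'd)" and \<theta> :: "nat \<Rightarrow> real ^ 'd" and K :: real
  assumes n: "1 \<le> n" and \<theta>: "\<theta> \<in> cube n" and K: "0 \<le> K"
    and zfun_le: "\<And>u \<alpha>. u \<in> cube n \<Longrightarrow> \<alpha> \<in> multi_indices n \<Longrightarrow>
      \<bar>zfun n J u \<alpha>\<bar> \<le> K * real n powr ((1 - real CARD('p)) / 2)"
begin

abbreviation "I \<equiv> multi_indices n :: ('p \<Rightarrow> nat) set"
abbreviation "x \<alpha> t \<equiv> zfun n J t \<alpha>"
abbreviation "y \<alpha> \<equiv> zfun n J \<theta> \<alpha>"
definition "\<kappa> = K * real n powr ((1 - real CARD('p)) / 2)"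
abbreviation "mse k \<equiv> mse_fun I (nodes k) (grid_weight k) x y"
abbreviation "var k \<equiv> var_fun I (nodes k) (grid_weight k) x"

lemma \<kappa>_bounds: "0 \<le> \<kappa>" "\<alpha> \<in> I \<Longrightarrow> \<bar>y \<alpha>\<bar> \<le> \<kappa>" "\<alpha> \<in> I \<Longrightarrow> t \<in> nodes k \<Longrightarrow> \<bar>x \<alpha> t\<bar> \<le> \<kappa>"
  proof -
  show "0 \<le> \<kappa>" using K by (simp add: \<kappa>_def)
  show "\<alpha> \<in> I \<Longrightarrow> \<bar>y \<alpha>\<bar> \<le> \<kappa>" unfolding \<kappa>_def by (rule zfun_le[OF \<theta>])
  show "\<alpha> \<in> I \<Longrightarrow> t \<in> nodes k \<Longrightarrow> \<bar>x \<alpha> t\<bar> \<le> \<kappa>"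
    unfolding \<kappa>_def using nodes_subset by (intro zfun_le) blast+
qed

text \<open>There are \<open>n ^ p\<close> labels and \<open>\<kappa>\<^sup>2\<close> is of order
\<open>n powr (1 - p)\<close>, so the total signal is of order \<open>n\<close>.\<close>

lemma card_\<kappa>: "real (card I) * \<kappa>\<^sup>2 = K\<^sup>2 * real n"
proof -
  have "(real n powr ((1 - real CARD('p)) / 2))\<^sup>2 = real n powr (1 - real CARD('p))"
    by (simp add: power2_eq_square flip: powr_add)
  moreover have "real n ^ CARD('p) * real n powr (1 - real CARD('p)) = real n"
    using n by (simp flip: powr_realpow powr_add)
  ultimately show ?thesis
    unfolding card_multi_indices \<kappa>_def power_mult_distrib by (simp add: mult.left_commute)
qed

lemma functional_bounds: "\<bar>mse k Z\<bar> \<le> 4 * K\<^sup>2 * real n" "\<bar>var k Z\<bar> \<le> 4 * K\<^sup>2 * real n"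
proof -
  have "\<bar>mse k Z\<bar> \<le> real (card I) * (4 * \<kappa>\<^sup>2)"
    by (rule mse_fun_bound[OF weights_grid]) (use \<kappa>_bounds in blast)+
  then show "\<bar>mse k Z\<bar> \<le> 4 * K\<^sup>2 * real n" using card_\<kappa> by linarith
  have "\<bar>var k Z\<bar> \<le> real (card I) * (4 * \<kappa>\<^sup>2)"
    by (rule var_fun_bound[OF weights_grid]) (use \<kappa>_bounds in blast)+
  then show "\<bar>var k Z\<bar> \<le> 4 * K\<^sup>2 * real n" using card_\<kappa> by linarith
qed

context
  fixes Z :: "(nat \<Rightarrow> real ^ 'd) \<Rightarrow> real" assumes Z: "continuous_on (cube n) Z"
begin

lemma mse_tendsto: "(\<lambda>k. mse k Z) \<longlonglongrightarrow> sq_error n J \<pi> \<theta> Z"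
  and var_tendsto: "(\<lambda>k. var k Z) \<longlonglongrightarrow> post_var n J \<pi> Z"
  using sq_error_tendsto[OF Z] post_var_tendsto[OF Z] unfolding mse_fun_def var_fun_def .

lemma functional_limit_bounds: "\<bar>sq_error n J \<pi> \<theta> Z\<bar> \<le> 4 * K\<^sup>2 * real n" "\<bar>post_var n J \<pi> Z\<bar> \<le> 4 * K\<^sup>2 * real n"
  by (rule LIMSEQ_le_const2[OF tendsto_rabs[OF mse_tendsto]], use functional_bounds in blast,
      rule LIMSEQ_le_const2[OF tendsto_rabs[OF var_tendsto]], use functional_bounds in blast)

end

lemma expected_functional_tendsto:
  fixes Z :: "'w \<Rightarrow> (nat \<Rightarrow> real ^ 'd) \<Rightarrow> real"
  assumes M: "prob_space M" and cont: "\<And>\<omega>. \<omega> \<in> space M \<Longrightarrow> continuous_on (cube n) (Z \<omega>)"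
    and meas: "\<And>t. t \<in> cube n \<Longrightarrow> (\<lambda>\<omega>. Z \<omega> t) \<in> borel_measurable M"
  shows "(\<lambda>k. \<integral>\<omega>. mse k (Z \<omega>) \<partial>M) \<longlonglongrightarrow> (\<integral>\<omega>. sq_error n J \<pi> \<theta> (Z \<omega>) \<partial>M)"
    and "(\<lambda>k. \<integral>\<omega>. var k (Z \<omega>) \<partial>M) \<longlonglongrightarrow> (\<integral>\<omega>. post_var n J \<pi> (Z \<omega>) \<partial>M)"
proof -
  interpret M: prob_space M by fact
  have nodes: "(\<lambda>\<omega>. Z \<omega> t) \<in> borel_measurable M" if "t \<in> nodes k" for t k
    using meas that nodes_subset by auto
  show "(\<lambda>k. \<integral>\<omega>. mse k (Z \<omega>) \<partial>M) \<longlonglongrightarrow> (\<integral>\<omega>. sq_error n J \<pi> \<theta> (Z \<omega>) \<partial>M)"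
  proof (rule M.integral_tendsto_bounded)
    show "(\<lambda>\<omega>. mse k (Z \<omega>)) \<in> borel_measurable M" for k
      by (rule measurable_of_restrict[where f = "mse k" and T = "nodes k", OF mse_fun_measurable mse_fun_restrict nodes])
    show "\<bar>mse k (Z \<omega>)\<bar> \<le> 4 * K\<^sup>2 * real n" for k \<omega> by (rule functional_bounds)
  qed (rule mse_tendsto[OF cont])
  show "(\<lambda>k. \<integral>\<omega>. var k (Z \<omega>) \<partial>M) \<longlonglongrightarrow> (\<integral>\<omega>. post_var n J \<pi> (Z \<omega>) \<partial>M)"
  proof (rule M.integral_tendsto_bounded)
    show "(\<lambda>\<omega>. var k (Z \<omega>)) \<in> borel_measurable M" for k
      by (rule measurable_of_restrict[where f = "var k" and T = "nodes k", OF var_fun_measurable var_fun_restrict nodes])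
    show "\<bar>var k (Z \<omega>)\<bar> \<le> 4 * K\<^sup>2 * real n" for k \<omega> by (rule functional_bounds)
  qed (rule var_tendsto[OF cont])
qed

lemma expected_functional_bounds:
  fixes Z :: "'w \<Rightarrow> (nat \<Rightarrow> real ^ 'd) \<Rightarrow> real"
  assumes M: "prob_space M" and cont: "\<And>\<omega>. \<omega> \<in> space M \<Longrightarrow> continuous_on (cube n) (Z \<omega>)"
  shows "\<bar>1 / real n * (\<integral>\<omega>. sq_error n J \<pi> \<theta> (Z \<omega>) \<partial>M)\<bar> \<le> 4 * K\<^sup>2"
    and "\<bar>1 / real n * (\<integral>\<omega>. post_var n J \<pi> (Z \<omega>) \<partial>M)\<bar> \<le> 4 * K\<^sup>2"
proof -
  interpret M: prob_space M by fact
  have "\<bar>\<integral>\<omega>. sq_error n J \<pi> \<theta> (Z \<omega>) \<partial>M\<bar> \<le> 4 * K\<^sup>2 * real n" "\<bar>\<integral>\<omega>. post_var n J \<pi> (Z \<omega>) \<partial>M\<bar> \<le> 4 * K\<^sup>2 * real n"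
    by (rule M.abs_integral_le_const; use functional_limit_bounds[OF cont] in simp)+
  then show "\<bar>1 / real n * (\<integral>\<omega>. sq_error n J \<pi> \<theta> (Z \<omega>) \<partial>M)\<bar> \<le> 4 * K\<^sup>2"
    and "\<bar>1 / real n * (\<integral>\<omega>. post_var n J \<pi> (Z \<omega>) \<partial>M)\<bar> \<le> 4 * K\<^sup>2"
    using n by (simp_all add: abs_mult pos_divide_le_eq)
qed

end

text \<open>The Bernoulli observation. The parameter \<open>b\<close> is fixed by an assumption instead of
being abbreviated, since its value alone does not determine the type \<open>'p\<close>.\<close>

locale sparse_model = model n \<pi> J \<theta> K
  for n and \<pi> :: "(nat \<Rightarrow> real ^ 'd::finite) measure"
    and J :: "('p::finite \<Rightarrow> nat) \<Rightarrow> real ^ ('p \<Rightarrow> 'd)" and \<theta> K +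
  fixes dn lam lams b :: real
  assumes b_def: "b = b_scale CARD('p) n dn"
    and dn: "0 < dn" "dn < s_scale CARD('p) n" and lam: "0 < lam" and lams: "0 < lams"
    and wd: "bern_well_defined lam n dn J" "bern_well_defined lams n dn J"
begin

lemma b: "0 < b" "b\<^sup>2 + 1 = s_scale CARD('p) n / dn"
proof -
  have "0 < (s_scale CARD('p) n - dn) / dn" using dn by simp
  then show "0 < b" "b\<^sup>2 + 1 = s_scale CARD('p) n / dn"
    using dn by (simp_all add: b_def b_scale_def real_sqrt_gt_0_iff diff_divide_distrib)
qed

lemma loglik_continuous: "continuous_on (cube n) (bern_loglik lam n dn J G)"
proof -
  have ne: "1 + b * sqrt lam * x \<alpha> u \<noteq> 0" "1 - sqrt lam * x \<alpha> u / b \<noteq> 0" if "\<alpha> \<in> I" "u \<in> cube n" for \<alpha> u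
    using wd(1) that unfolding bern_well_defined_def b_def[symmetric] by (metis less_irrefl)+
  have "b \<noteq> 0" using b(1) by simp
  then show ?thesis
    unfolding bern_loglik_def[abs_def] b_def[symmetric]
    by (intro continuous_intros continuous_zfun) (use ne in blast)+
qed

lemma loglik_eq:
  "bern_loglik lam n dn J G t = (\<Sum>\<alpha>\<in>I. ln (1 + (if G \<alpha> then b else - 1 / b) * sqrt lam * x \<alpha> t))"
  unfolding bern_loglik_def b_def[symmetric] by (intro sum.cong refl) auto

definition "edge_prob \<alpha> = (1 / b + sqrt lams * y \<alpha>) / (b + 1 / b)"

text \<open>In terms of \<open>b\<close> one has \<open>q = 1 / (b\<^sup>2 + 1)\<close> and \<open>sqrt (q *
(1 - q)) = b / (b\<^sup>2 + 1) = 1 / (b + 1 / b)\<close>.\<close>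

lemma bern_law_eq: "bern_law lams n dn J \<theta> = Pi_pmf I False (\<lambda>\<alpha>. bernoulli_pmf (edge_prob \<alpha>))"
proof -
  have q: "dn / s_scale CARD('p) n = 1 / (b\<^sup>2 + 1)" using b(2) by simp
  have pos: "0 < b\<^sup>2 + 1" by (simp add: add_nonneg_pos)
  have "1 / (b\<^sup>2 + 1) * (1 - 1 / (b\<^sup>2 + 1)) = (b / (b\<^sup>2 + 1))\<^sup>2"
    using pos by (simp add: field_simps power2_eq_square)
  then have sd: "sqrt (1 / (b\<^sup>2 + 1) * (1 - 1 / (b\<^sup>2 + 1))) = b / (b\<^sup>2 + 1)"
    using b(1) pos by (simp only: real_sqrt_abs) simp
  have "1 / (b\<^sup>2 + 1) + b / (b\<^sup>2 + 1) * sqrt lams * z = (1 / b + sqrt lams * z) / (b + 1 / b)" for z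
  proof -
    have "b + 1 / b = (b\<^sup>2 + 1) / b" using b(1) by (simp add: field_simps power2_eq_square)
    then have "(1 / b + sqrt lams * z) / (b + 1 / b) = ((1 / b + sqrt lams * z) * b) / (b\<^sup>2 + 1)" by simp
    also have "(1 / b + sqrt lams * z) * b = 1 + b * sqrt lams * z" using b(1) by (simp add: distrib_right)
    finally show ?thesis by (simp add: add_divide_distrib)
  qed
  then show ?thesis unfolding bern_law_def edge_prob_def Let_def q sd by simp
qed

lemma noise_law:
  "distr (bern_law lams n dn J \<theta>) (PiM I (\<lambda>_. borel)) (\<lambda>G. \<lambda>\<alpha>\<in>I. if G \<alpha> then b else - 1 / b)
    = PiM I (\<lambda>\<alpha>. two_point b (edge_prob \<alpha>))"
proof -
  let ?M = "measure_pmf (bern_law lams n dn J \<theta>)"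
  let ?X = "\<lambda>\<alpha> G. if G \<alpha> then b else - 1 / b"
  have ne: "I \<noteq> {}" using n by (auto simp: multi_indices_def intro!: exI[of _ "\<lambda>_. 0"])
  have "prob_space.indep_vars ?M (\<lambda>_. count_space UNIV) (\<lambda>\<alpha> G. G \<alpha>) I"
    unfolding bern_law_eq by (rule indep_vars_Pi_pmf[OF finite_multi_indices])
  then have "prob_space.indep_vars ?M (\<lambda>_. borel) ?X I"
    by (rule prob_space.indep_vars_compose2[OF prob_space_measure_pmf, where Y = "\<lambda>_ g. if g then b else - 1 / b"
        and N = "\<lambda>_. borel"]) simp
  then have "distr ?M (PiM I (\<lambda>_. borel)) (\<lambda>G. \<lambda>\<alpha>\<in>I. ?X \<alpha> G) = PiM I (\<lambda>\<alpha>. distr ?M borel (?X \<alpha>))"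
    by (subst (asm) prob_space.indep_vars_iff_distr_eq_PiM'[OF prob_space_measure_pmf ne]) auto
  also have "\<dots> = PiM I (\<lambda>\<alpha>. two_point b (edge_prob \<alpha>))"
  proof (rule PiM_cong[OF refl])
    fix \<alpha> assume \<alpha>: "\<alpha> \<in> I"
    have "map_pmf (\<lambda>G. G \<alpha>) (bern_law lams n dn J \<theta>) = bernoulli_pmf (edge_prob \<alpha>)"
      unfolding bern_law_eq using \<alpha> by (subst Pi_pmf_component[OF finite_multi_indices]) simp
    then have "distr ?M (count_space UNIV) (\<lambda>G. G \<alpha>) = measure_pmf (bernoulli_pmf (edge_prob \<alpha>))"
      by (metis map_pmf_rep_eq)
    then have "two_point b (edge_prob \<alpha>) = distr (distr ?M (count_space UNIV) (\<lambda>G. G \<alpha>)) borel (\<lambda>g. if g then b else - 1 / b)"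
      by (simp add: two_point_def)
    also have "\<dots> = distr ?M borel (?X \<alpha>)" by (subst distr_distr) (auto simp: comp_def)
    finally show "distr ?M borel (?X \<alpha>) = two_point b (edge_prob \<alpha>)" by simp
  qed
  finally show ?thesis .
qed

text \<open>The two summands of \<open>\<delta>\<^sub>n\<close> appear through \<open>(b + 1 / b) / sqrt
s\<^sub>n = sqrt (1 / d\<^sub>n + 1 / (s\<^sub>n - d\<^sub>n))\<close>.\<close>

lemma \<kappa>_delta: "\<kappa> * (b + 1 / b) \<le> K * delta CARD('p) n dn"
proof -
  let ?s = "s_scale CARD('p) n"
  have s: "0 < ?s" using n by (simp add: s_scale_def)
  have powr: "real n powr ((1 - real CARD('p)) / 2) = 1 / sqrt ?s"
  proof -
    have "real n powr ((1 - real CARD('p)) / 2) = (real n powr (real (CARD('p) - 1))) powr (- 1 / 2)"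
      unfolding powr_powr by (simp add: of_nat_diff Suc_leI diff_divide_distrib)
    also have "real n powr (real (CARD('p) - 1)) = ?s"
      unfolding s_scale_def by (rule powr_realpow) (use n in simp)
    also have "?s powr (- 1 / 2) = 1 / sqrt ?s" by (rule powr_minus_half[OF s])
    finally show ?thesis .
  qed
  have "b + 1 / b = (b\<^sup>2 + 1) / b" using b(1) by (simp add: field_simps power2_eq_square)
  then have "(b + 1 / b) / sqrt ?s = ?s / dn / b / sqrt ?s" using b(2) by simp
  also have "\<dots> = sqrt (1 / dn + 1 / (?s - dn))"
  proof (rule real_sqrt_unique[symmetric])
    have b2: "b\<^sup>2 = (?s - dn) / dn" using dn by (simp add: b_def b_scale_def)
    have s2: "(sqrt ?s)\<^sup>2 = ?s" using s by simp
    have "(?s / dn / b / sqrt ?s)\<^sup>2 = ?s\<^sup>2 / dn\<^sup>2 / b\<^sup>2 / (sqrt ?s)\<^sup>2"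
      by (simp only: power_divide)
    also have "\<dots> = ?s\<^sup>2 / dn\<^sup>2 / ((?s - dn) / dn) / ?s" by (simp only: b2 s2)
    also have "\<dots> = 1 / dn + 1 / (?s - dn)" using dn s by (simp add: field_simps power2_eq_square)
    finally show "(?s / dn / b / sqrt ?s)\<^sup>2 = 1 / dn + 1 / (?s - dn)" .
    show "0 \<le> ?s / dn / b / sqrt ?s" using dn s b(1) by simp
  qed
  also have "\<dots> \<le> sqrt (1 / dn) + sqrt (1 / (?s - dn))"
    using dn by (intro sqrt_add_le_add_sqrt) auto
  also have "\<dots> = delta CARD('p) n dn"
  proof -
    have "dn powr (- 1 / 2) = 1 / sqrt dn" "(?s - dn) powr (- 1 / 2) = 1 / sqrt (?s - dn)"
      by (rule powr_minus_half, use dn in simp)+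
    then show ?thesis unfolding delta_def by (simp only: real_sqrt_divide real_sqrt_one)
  qed
  finally have "(b + 1 / b) / sqrt ?s \<le> delta CARD('p) n dn" .
  from mult_left_mono[OF this K] show ?thesis unfolding \<kappa>_def powr by simp
qed

end

text \<open>The regime of small \<open>\<delta>\<^sub>n\<close>, in which every grid gives an instance of the
comparison above.\<close>

locale dense_model = sparse_model n \<pi> J \<theta> K dn lam lams b
  for n and \<pi> :: "(nat \<Rightarrow> real ^ 'd::finite) measure"
    and J :: "('p::finite \<Rightarrow> nat) \<Rightarrow> real ^ ('p \<Rightarrow> 'd)" and \<theta> K dn lam lams b +
  assumes small: "K * delta CARD('p) n dn \<le> 1 / 2" "sqrt lam * (K * delta CARD('p) n dn) \<le> 1 / 2"
begin

lemma comparison: "comparison I (nodes k) (grid_weight k) x y \<kappa> b lam lams"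
proof
  show "finite I" by (rule finite_multi_indices)
  show "weights (nodes k) (grid_weight k)" by (rule weights_grid)
  show "0 < lam" "0 < lams" "0 < b" by (rule lam lams b(1))+
  show "0 \<le> \<kappa>" "\<And>i t. i \<in> I \<Longrightarrow> t \<in> nodes k \<Longrightarrow> \<bar>x i t\<bar> \<le> \<kappa>" "\<And>i. i \<in> I \<Longrightarrow> \<bar>y i\<bar> \<le> \<kappa>"
    using \<kappa>_bounds by blast+
  show "\<kappa> * (b + 1 / b) \<le> 1 / 2" using \<kappa>_delta small(1) by linarith
  have "sqrt lam * (\<kappa> * (b + 1 / b)) \<le> sqrt lam * (K * delta CARD('p) n dn)"
    using lam by (intro mult_left_mono \<kappa>_delta) auto
  then show "sqrt lam * \<kappa> * (b + 1 / b) \<le> 1 / 2" using small(2) by (simp only: mult.assoc)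
  fix i assume i: "i \<in> I"
  have pos: "0 < 1 + b * sqrt lams * y i" "0 < 1 - sqrt lams * y i / b"
    using wd(2) i \<theta> unfolding bern_well_defined_def b_def[symmetric] by blast+
  have "0 \<le> (1 + b * sqrt lams * y i) / b" using pos(1) b(1) by simp
  then show "0 \<le> 1 / b + sqrt lams * y i" using b(1) by (simp add: add_divide_distrib)
  have "0 \<le> (1 - sqrt lams * y i / b) * b" using pos(2) b(1) by simp
  then show "0 \<le> b - sqrt lams * y i" using b(1) by (simp add: left_diff_distrib)
qed

lemma noise_expectation:
  assumes k: "f \<in> borel_measurable (PiM (nodes k) (\<lambda>_. borel))" "\<And>Z. f (restrict Z (nodes k)) = f Z"
  shows "(\<integral>\<zeta>. f (comparison.potB I x y lam lams 0 0 \<zeta>) \<partial>PiM I (comparison.\<nu>B y b lams))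
    = measure_pmf.expectation (bern_law lams n dn J \<theta>) (\<lambda>G. f (bern_loglik lam n dn J G) :: real)"
proof -
  interpret C: comparison I "nodes k" "grid_weight k" x y \<kappa> b lam lams by (rule comparison)
  have nu: "C.\<nu>B = (\<lambda>\<alpha>. two_point b (edge_prob \<alpha>))"
    unfolding C.\<nu>B_def[abs_def] C.p_def C.D_def C.s'_def edge_prob_def ..
  have pot: "C.potB 0 0 \<zeta> = (\<lambda>t. \<Sum>i\<in>I. ln (1 + \<zeta> i * sqrt lam * x i t))" for \<zeta>
    by (simp add: fun_eq_iff C.potB_def C.lB_def C.s_def)
  have meas: "(\<lambda>\<zeta>. f (C.potB 0 0 \<zeta>)) \<in> borel_measurable (PiM I (\<lambda>_. borel))"
    by (rule measurable_of_restrict[where f = f and T = "nodes k", OF k]) (unfold pot, measurable)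
  have "(\<integral>\<zeta>. f (C.potB 0 0 \<zeta>) \<partial>PiM I C.\<nu>B)
      = (\<integral>\<zeta>. f (C.potB 0 0 \<zeta>) \<partial>distr (bern_law lams n dn J \<theta>) (PiM I (\<lambda>_. borel)) (\<lambda>G. \<lambda>\<alpha>\<in>I. if G \<alpha> then b else - 1 / b))"
    unfolding nu noise_law ..
  also have "\<dots> = measure_pmf.expectation (bern_law lams n dn J \<theta>) (\<lambda>G. f (C.potB 0 0 (\<lambda>\<alpha>\<in>I. if G \<alpha> then b else - 1 / b)))"
    by (rule integral_distr[OF measurable_restrict meas]) simp
  also have "\<dots> = measure_pmf.expectation (bern_law lams n dn J \<theta>) (\<lambda>G. f (bern_loglik lam n dn J G))"
  proof -
    have "C.potB 0 0 (\<lambda>\<alpha>\<in>I. if G \<alpha> then b else - 1 / b) = bern_loglik lam n dn J G" for G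
      unfolding pot fun_eq_iff loglik_eq by simp
    then show ?thesis by simp
  qed
  finally show ?thesis .
qed

lemma bern_limits:
  shows "(\<lambda>k. comparison.mseB I (nodes k) (grid_weight k) x y b lam lams) \<longlonglongrightarrow> real n * bern_risk lam lams n dn J \<pi> \<theta>"
    and "(\<lambda>k. comparison.varB I (nodes k) (grid_weight k) x y b lam lams) \<longlonglongrightarrow> real n * bern_var lam lams n dn J \<pi> \<theta>"
proof -
  have n0: "real n \<noteq> 0" using n by simp
  note lim = expected_functional_tendsto[OF prob_space_measure_pmf[of "bern_law lams n dn J \<theta>"],
      of "\<lambda>G. bern_loglik lam n dn J G", OF loglik_continuous]
  have "comparison.mseB I (nodes k) (grid_weight k) x y b lam lams
      = measure_pmf.expectation (bern_law lams n dn J \<theta>) (\<lambda>G. mse k (bern_loglik lam n dn J G))" for k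
    using noise_expectation[where f = "mse k" and k = k, OF mse_fun_measurable mse_fun_restrict]
    unfolding comparison.mseB_def[OF comparison] mse_fun_def .
  then show "(\<lambda>k. comparison.mseB I (nodes k) (grid_weight k) x y b lam lams) \<longlonglongrightarrow> real n * bern_risk lam lams n dn J \<pi> \<theta>"
    using lim(1) n0 by (simp add: bern_risk_def)
  have "comparison.varB I (nodes k) (grid_weight k) x y b lam lams
      = measure_pmf.expectation (bern_law lams n dn J \<theta>) (\<lambda>G. var k (bern_loglik lam n dn J G))" for k
    using noise_expectation[where f = "var k" and k = k, OF var_fun_measurable var_fun_restrict]
    unfolding comparison.varB_def[OF comparison] var_fun_def .
  then show "(\<lambda>k. comparison.varB I (nodes k) (grid_weight k) x y b lam lams) \<longlonglongrightarrow> real n * bern_var lam lams n dn J \<pi> \<theta>"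
    using lim(2) n0 by (simp add: bern_var_def)
qed

text \<open>On the nodes of a grid the given process has the law of \<open>potG\<close>. The means agree by
expansion of the square in \<open>\<beta> * a * (y - x)\<^sup>2\<close>, the covariances because \<open>(lam +
\<beta>)\<^sup>2 / lam = (c \<beta>)\<^sup>2\<close>.\<close>

lemma gauss_expectation:
  fixes Q :: "'w measure"
  assumes Y: "continuous_gaussian_process Q (cube n) (gauss_mean lam lams a \<beta> n J \<theta>) (gauss_cov lam \<beta> n J) Y"
    and k: "f \<in> borel_measurable (PiM (nodes k) (\<lambda>_. borel))" "\<And>Z. f (restrict Z (nodes k)) = f Z"
  shows "(\<integral>g. f (comparison.potG I x y lam lams a \<beta> g) \<partial>PiM I (\<lambda>_. std_gauss)) = (\<integral>\<omega>. f (Y \<omega>) \<partial>Q :: real)"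
proof -
  interpret C: comparison I "nodes k" "grid_weight k" x y \<kappa> b lam lams by (rule comparison)
  have GP: "gaussian_process Q (cube n) Y"
    and mean: "\<And>t. t \<in> cube n \<Longrightarrow> (\<integral>\<omega>. Y \<omega> t \<partial>Q) = gauss_mean lam lams a \<beta> n J \<theta> t"
    and cov: "\<And>s t. s \<in> cube n \<Longrightarrow> t \<in> cube n \<Longrightarrow> cov Q (\<lambda>\<omega>. Y \<omega> s) (\<lambda>\<omega>. Y \<omega> t) = gauss_cov lam \<beta> n J s t"
    using Y by (auto simp: continuous_gaussian_process_def)
  have ss: "sqrt lam * sqrt lam = lam" using lam by simp
  have m: "gauss_mean lam lams a \<beta> n J \<theta> t = (\<Sum>\<alpha>\<in>I. C.m a \<beta> \<alpha> t)" for t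
    unfolding gauss_mean_def
  proof (rule sum.cong[OF refl])
    fix \<alpha>
    have "(Amat lam lams a \<beta> J \<alpha> *v eta n \<theta> \<alpha>) \<bullet> eta n t \<alpha> = (sqrt (lam * lams) - 2 * \<beta> * a) * (y \<alpha> * x \<alpha> t)"
      "(Kmat lam a \<beta> J \<alpha> *v eta n t \<alpha>) \<bullet> eta n t \<alpha> = (lam - 2 * \<beta> * a) * (x \<alpha> t * x \<alpha> t)"
      "(Hmat J \<alpha> *v eta n \<theta> \<alpha>) \<bullet> eta n \<theta> \<alpha> = y \<alpha> * y \<alpha>"
      by (simp_all add: Amat_def Kmat_def scaleR_matrix_vector_assoc[symmetric] H_form zfun_def)
    then show "(Amat lam lams a \<beta> J \<alpha> *v eta n \<theta> \<alpha>) \<bullet> eta n t \<alpha>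
        - 1 / 2 * ((Kmat lam a \<beta> J \<alpha> *v eta n t \<alpha>) \<bullet> eta n t \<alpha>)
        + \<beta> * a * ((Hmat J \<alpha> *v eta n \<theta> \<alpha>) \<bullet> eta n \<theta> \<alpha>) = C.m a \<beta> \<alpha> t"
      using ss by (simp add: C.m_def C.s_def C.s'_def real_sqrt_mult power2_eq_square algebra_simps)
  qed
  have cc: "(lam + \<beta>)\<^sup>2 / lam = C.c \<beta> * C.c \<beta>"
  proof -
    have "C.c \<beta> = (lam + \<beta>) / sqrt lam"
      using lam ss by (simp add: C.c_def C.s_def add_divide_distrib real_div_sqrt)
    then show ?thesis using ss by (simp add: power2_eq_square)
  qed
  have v: "gauss_cov lam \<beta> n J s t = (\<Sum>\<alpha>\<in>I. (C.c \<beta> * x \<alpha> s) * (C.c \<beta> * x \<alpha> t))" for s t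
    unfolding gauss_cov_def
    by (intro sum.cong refl) (simp add: Smat_def cc scaleR_matrix_vector_assoc[symmetric] H_form zfun_def mult_ac)
  have "(\<integral>\<omega>. f (\<lambda>t\<in>nodes k. Y \<omega> t) \<partial>Q)
      = (\<integral>g. f (\<lambda>t\<in>nodes k. (\<Sum>\<alpha>\<in>I. C.m a \<beta> \<alpha> t) + (\<Sum>\<alpha>\<in>I. (C.c \<beta> * x \<alpha> t) * g \<alpha>)) \<partial>PiM I (\<lambda>_. std_gauss))"
  proof (rule gaussian_process_representation[OF GP finite_grid nodes_subset finite_multi_indices _ _ k(1)])
    show "(\<integral>\<omega>. Y \<omega> t \<partial>Q) = (\<Sum>\<alpha>\<in>I. C.m a \<beta> \<alpha> t)" if "t \<in> nodes k" for t
      using mean[OF subsetD[OF nodes_subset that]] m by simp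
    show "cov Q (\<lambda>\<omega>. Y \<omega> s) (\<lambda>\<omega>. Y \<omega> t) = (\<Sum>\<alpha>\<in>I. (C.c \<beta> * x \<alpha> s) * (C.c \<beta> * x \<alpha> t))"
      if "s \<in> nodes k" "t \<in> nodes k" for s t
      using cov[OF subsetD[OF nodes_subset that(1)] subsetD[OF nodes_subset that(2)]] v by simp
  qed
  also have "\<dots> = (\<integral>g. f (C.potG a \<beta> g) \<partial>PiM I (\<lambda>_. std_gauss))"
  proof -
    have "(\<lambda>t. (\<Sum>\<alpha>\<in>I. C.m a \<beta> \<alpha> t) + (\<Sum>\<alpha>\<in>I. (C.c \<beta> * x \<alpha> t) * g \<alpha>)) = C.potG a \<beta> g" for g
      by (simp add: fun_eq_iff C.potG_def C.lG_def sum.distrib mult_ac)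
    then show ?thesis by (simp only: k(2))
  qed
  finally show ?thesis by (simp only: k(2))
qed

lemma gauss_limits:
  fixes Q :: "'w measure"
  assumes Y: "\<And>a \<beta>. a \<in> {-1, 0} \<Longrightarrow>
    continuous_gaussian_process Q (cube n) (gauss_mean lam lams a \<beta> n J \<theta>) (gauss_cov lam \<beta> n J) (Y a \<beta>)"
  shows "(\<lambda>k. comparison.mseG I (nodes k) (grid_weight k) x y lam lams \<beta>) \<longlonglongrightarrow> real n * gauss_risk n J \<pi> \<theta> Q (Y (-1) \<beta>)"
    and "(\<lambda>k. comparison.varG I (nodes k) (grid_weight k) x y lam lams \<beta>) \<longlonglongrightarrow> real n * gauss_var n J \<pi> Q (Y 0 \<beta>)"
proof -
  have n0: "real n \<noteq> 0" using n by simp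
  have GP: "gaussian_process Q (cube n) (Y a \<beta>)" and cont: "\<And>\<omega>. \<omega> \<in> space Q \<Longrightarrow> continuous_on (cube n) (Y a \<beta> \<omega>)"
    if "a \<in> {-1, 0}" for a
    using Y[OF that, of \<beta>] by (auto simp: continuous_gaussian_process_def)
  have Q: "prob_space Q" using GP[of 0] by (simp add: gaussian_process_def)
  have meas: "(\<lambda>\<omega>. Y a \<beta> \<omega> t) \<in> borel_measurable Q" if "a \<in> {-1, 0}" "t \<in> cube n" for a t
    by (rule gaussian_process_linear_form(3)[OF GP[OF that(1)] finite.emptyI _ that(2)]) simp
  have mem: "(-1::real) \<in> {-1, 0}" "(0::real) \<in> {-1, 0}" by auto
  note lim1 = expected_functional_tendsto(1)[OF Q, of "Y (-1) \<beta>", OF cont[OF mem(1)] meas[OF mem(1)]]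
  note lim0 = expected_functional_tendsto(2)[OF Q, of "Y 0 \<beta>", OF cont[OF mem(2)] meas[OF mem(2)]]
  have "comparison.mseG I (nodes k) (grid_weight k) x y lam lams \<beta> = (\<integral>\<omega>. mse k (Y (-1) \<beta> \<omega>) \<partial>Q)" for k
    using gauss_expectation[where f = "mse k" and k = k, OF Y[OF mem(1)] mse_fun_measurable mse_fun_restrict]
    unfolding comparison.mseG_def[OF comparison] mse_fun_def .
  then show "(\<lambda>k. comparison.mseG I (nodes k) (grid_weight k) x y lam lams \<beta>) \<longlonglongrightarrow> real n * gauss_risk n J \<pi> \<theta> Q (Y (-1) \<beta>)"
    using lim1 n0 by (simp add: gauss_risk_def)
  have "comparison.varG I (nodes k) (grid_weight k) x y lam lams \<beta> = (\<integral>\<omega>. var k (Y 0 \<beta> \<omega>) \<partial>Q)" for k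
    using gauss_expectation[where f = "var k" and k = k, OF Y[OF mem(2)] var_fun_measurable var_fun_restrict]
    unfolding comparison.varG_def[OF comparison] var_fun_def .
  then show "(\<lambda>k. comparison.varG I (nodes k) (grid_weight k) x y lam lams \<beta>) \<longlonglongrightarrow> real n * gauss_var n J \<pi> Q (Y 0 \<beta>)"
    using lim0 n0 by (simp add: gauss_var_def)
qed

lemma err_le:
  assumes \<epsilon>: "0 < \<epsilon>"
  shows "comparison.err I \<kappa> b lam lams \<epsilon>
    \<le> real n * (K\<^sup>2 * (2 / lam + 352 * comparison.A lam lams ^ 5 * K) * (\<epsilon> + delta CARD('p) n dn / \<epsilon>))"
proof -
  interpret C: comparison I "nodes k" "grid_weight k" x y \<kappa> b lam lams by (rule comparison)
  let ?d = "delta CARD('p) n dn"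
  have A: "0 \<le> C.A" using C.A_ge(1) by linarith
  have d: "0 \<le> ?d" by (simp add: delta_def)
  have "352 * C.A ^ 5 * (\<kappa> * C.D) / \<epsilon> \<le> 352 * C.A ^ 5 * (K * ?d) / \<epsilon>"
    using A \<epsilon> \<kappa>_delta by (intro divide_right_mono mult_left_mono) (auto simp: C.D_def)
  also have "\<dots> = 352 * C.A ^ 5 * K * (?d / \<epsilon>)" by simp
  finally have "2 * \<epsilon> / lam + 352 * C.A ^ 5 * (\<kappa> * C.D) / \<epsilon> \<le> 2 / lam * \<epsilon> + 352 * C.A ^ 5 * K * (?d / \<epsilon>)"
    by simp
  also have "\<dots> \<le> (2 / lam + 352 * C.A ^ 5 * K) * (\<epsilon> + ?d / \<epsilon>)"
  proof -
    have "0 \<le> 2 / lam * (?d / \<epsilon>)" "0 \<le> 352 * C.A ^ 5 * K * \<epsilon>"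
      using A K d lam \<epsilon> by (auto intro!: mult_nonneg_nonneg)
    then show ?thesis unfolding distrib_left distrib_right by linarith
  qed
  finally have "real (card I) * \<kappa>\<^sup>2 * (2 * \<epsilon> / lam + 352 * C.A ^ 5 * (\<kappa> * C.D) / \<epsilon>)
      \<le> real (card I) * \<kappa>\<^sup>2 * ((2 / lam + 352 * C.A ^ 5 * K) * (\<epsilon> + ?d / \<epsilon>))"
    by (rule mult_left_mono) simp
  then show ?thesis unfolding C.err_def card_\<kappa> by (simp only: mult_ac)
qed

lemma dense_comparison:
  fixes Q :: "'w measure"
  assumes Y: "\<And>a \<beta>. a \<in> {-1, 0} \<Longrightarrow>
    continuous_gaussian_process Q (cube n) (gauss_mean lam lams a \<beta> n J \<theta>) (gauss_cov lam \<beta> n J) (Y a \<beta>)"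
    and \<epsilon>: "0 < \<epsilon>" "\<epsilon> \<le> 1"
  defines "e \<equiv> K\<^sup>2 * (2 / lam + 352 * comparison.A lam lams ^ 5 * K) * (\<epsilon> + delta CARD('p) n dn / \<epsilon>)"
  shows "gauss_risk n J \<pi> \<theta> Q (Y (-1) \<epsilon>) - e \<le> bern_risk lam lams n dn J \<pi> \<theta>"
    and "bern_risk lam lams n dn J \<pi> \<theta> \<le> gauss_risk n J \<pi> \<theta> Q (Y (-1) (-\<epsilon>)) + e"
    and "gauss_var n J \<pi> Q (Y 0 (-\<epsilon>)) - e \<le> bern_var lam lams n dn J \<pi> \<theta>"
    and "bern_var lam lams n dn J \<pi> \<theta> \<le> gauss_var n J \<pi> Q (Y 0 \<epsilon>) + e"
proof -
  let ?e = "comparison.err I \<kappa> b lam lams \<epsilon>"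
  have e: "?e \<le> real n * e" unfolding e_def by (rule err_le[OF \<epsilon>(1)])
  have n0: "0 < real n" using n by simp
  note finite_bounds = comparison.risk_comparison[OF comparison \<epsilon>]
  note gl = gauss_limits[where Q = Q and Y = Y, OF Y]
  have "real n * gauss_risk n J \<pi> \<theta> Q (Y (-1) \<epsilon>) - ?e \<le> real n * bern_risk lam lams n dn J \<pi> \<theta>"
    by (rule LIMSEQ_le[OF tendsto_diff[OF gl(1) tendsto_const] bern_limits(1)])
      (use finite_bounds(1) in auto)
  moreover have "real n * bern_risk lam lams n dn J \<pi> \<theta> \<le> real n * gauss_risk n J \<pi> \<theta> Q (Y (-1) (-\<epsilon>)) + ?e"
    by (rule LIMSEQ_le[OF bern_limits(1) tendsto_add[OF gl(1) tendsto_const]])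
      (use finite_bounds(2) in auto)
  moreover have "real n * gauss_var n J \<pi> Q (Y 0 (-\<epsilon>)) - ?e \<le> real n * bern_var lam lams n dn J \<pi> \<theta>"
    by (rule LIMSEQ_le[OF tendsto_diff[OF gl(2) tendsto_const] bern_limits(2)])
      (use finite_bounds(3) in auto)
  moreover have "real n * bern_var lam lams n dn J \<pi> \<theta> \<le> real n * gauss_var n J \<pi> Q (Y 0 \<epsilon>) + ?e"
    by (rule LIMSEQ_le[OF bern_limits(2) tendsto_add[OF gl(2) tendsto_const]])
      (use finite_bounds(4) in auto)
  ultimately have "real n * (gauss_risk n J \<pi> \<theta> Q (Y (-1) \<epsilon>) - e) \<le> real n * bern_risk lam lams n dn J \<pi> \<theta>"
    "real n * bern_risk lam lams n dn J \<pi> \<theta> \<le> real n * (gauss_risk n J \<pi> \<theta> Q (Y (-1) (-\<epsilon>)) + e)"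
    "real n * (gauss_var n J \<pi> Q (Y 0 (-\<epsilon>)) - e) \<le> real n * bern_var lam lams n dn J \<pi> \<theta>"
    "real n * bern_var lam lams n dn J \<pi> \<theta> \<le> real n * (gauss_var n J \<pi> Q (Y 0 \<epsilon>) + e)"
    using e unfolding right_diff_distrib distrib_left by linarith+
  then show "gauss_risk n J \<pi> \<theta> Q (Y (-1) \<epsilon>) - e \<le> bern_risk lam lams n dn J \<pi> \<theta>"
    and "bern_risk lam lams n dn J \<pi> \<theta> \<le> gauss_risk n J \<pi> \<theta> Q (Y (-1) (-\<epsilon>)) + e"
    and "gauss_var n J \<pi> Q (Y 0 (-\<epsilon>)) - e \<le> bern_var lam lams n dn J \<pi> \<theta>"
    and "bern_var lam lams n dn J \<pi> \<theta> \<le> gauss_var n J \<pi> Q (Y 0 \<epsilon>) + e"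
    using n0 mult_le_cancel_left_pos by blast+
qed

end

section \<open>Uniformity in the size and the parameter\<close>

text \<open>The bound holds from some size on, and only finitely many couplings belong to smaller
sizes.\<close>

lemma coupling_bound:
  fixes J :: "nat \<Rightarrow> ('p::finite \<Rightarrow> nat) \<Rightarrow> 'v::real_normed_vector"
  assumes "(\<lambda>n. SUP \<alpha>\<in>multi_indices n. norm (J n \<alpha>)) \<in> O(\<lambda>_. 1)"
  obtains K where "0 \<le> K" "\<And>n \<alpha>. \<alpha> \<in> multi_indices n \<Longrightarrow> norm (J n \<alpha>) \<le> K"
proof -
  from assms obtain c where "\<forall>\<^sub>F n in sequentially. norm (SUP \<alpha>\<in>multi_indices n. norm (J n \<alpha>)) \<le> c * norm (1::real)"
    by (auto elim!: landau_o.bigE)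
  then obtain N where N: "\<And>n. N \<le> n \<Longrightarrow> \<bar>SUP \<alpha>\<in>multi_indices n. norm (J n \<alpha>)\<bar> \<le> c"
    by (auto simp: eventually_sequentially)
  let ?S = "\<Sum>n<N. \<Sum>\<alpha>\<in>multi_indices n. norm (J n \<alpha>)"
  have S: "0 \<le> ?S" by (intro sum_nonneg) auto
  have "norm (J n \<alpha>) \<le> \<bar>c\<bar> + ?S" if \<alpha>: "\<alpha> \<in> multi_indices n" for n \<alpha>
  proof (cases "N \<le> n")
    case True
    have "norm (J n \<alpha>) \<le> (SUP \<alpha>\<in>multi_indices n. norm (J n \<alpha>))"
      using \<alpha> finite_multi_indices by (intro cSUP_upper bdd_above_finite finite_imageI) auto
    then show ?thesis using N[OF True] S by linarith
  next
    case False
    have "norm (J n \<alpha>) \<le> (\<Sum>\<alpha>\<in>multi_indices n. norm (J n \<alpha>))"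
      using \<alpha> finite_multi_indices by (intro member_le_sum) auto
    also have "\<dots> \<le> ?S"
      using False by (intro member_le_sum[where f = "\<lambda>n. \<Sum>\<alpha>\<in>multi_indices n. norm (J n \<alpha>)"] sum_nonneg) auto
    finally show ?thesis by linarith
  qed
  moreover have "0 \<le> \<bar>c\<bar> + ?S" using S by linarith
  ultimately show ?thesis using that by blast
qed

theorem theorem12:
  fixes lam lams :: real
    and dn :: "nat \<Rightarrow> real"
    and J :: "nat \<Rightarrow> ('p::finite \<Rightarrow> nat) \<Rightarrow> real ^ ('p \<Rightarrow> 'd::finite)"
    and \<pi> :: "nat \<Rightarrow> (nat \<Rightarrow> real ^ 'd) measure"
    and Q :: "nat \<Rightarrow> (nat \<Rightarrow> real ^ 'd) \<Rightarrow> 'w measure"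
    and Y :: "nat \<Rightarrow> (nat \<Rightarrow> real ^ 'd) \<Rightarrow> real \<Rightarrow> real \<Rightarrow> 'w \<Rightarrow> (nat \<Rightarrow> real ^ 'd) \<Rightarrow> real"
  assumes "CARD('p) \<ge> 2"
    and "lam > 0" and "lams > 0"
    and "\<forall>n\<ge>1. 0 < dn n \<and> dn n < s_scale CARD('p) n"
    and "\<forall>n\<ge>1. prior_on_cube n (\<pi> n)"
    and gauss: "\<forall>n\<ge>1. \<forall>\<theta>\<in>cube n. \<forall>a\<in>{-1, 0}. \<forall>\<beta>.
           continuous_gaussian_process (Q n \<theta>) (cube n)
             (gauss_mean lam lams a \<beta> n (J n) \<theta>) (gauss_cov lam \<beta> n (J n)) (Y n \<theta> a \<beta>)"
    and "(\<lambda>n. SUP \<alpha>\<in>multi_indices n. norm (J n \<alpha>)) \<in> O(\<lambda>_. 1)"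
    and "filterlim dn at_top sequentially"
    and "filterlim (\<lambda>n. s_scale CARD('p) n - dn n) at_top sequentially"
    and "\<forall>\<kappa>\<in>{lam, lams}. \<forall>n\<ge>1. bern_well_defined \<kappa> n (dn n) (J n)"
  shows "\<exists>C \<epsilon>0. \<epsilon>0 > 0 \<and>
    (\<forall>\<epsilon>\<in>{0<..<\<epsilon>0}. \<forall>n\<ge>1. \<forall>\<theta>\<in>cube n.
      (let R = bern_risk lam lams n (dn n) (J n) (\<pi> n) \<theta>;
           V = bern_var lam lams n (dn n) (J n) (\<pi> n) \<theta>;
           RG = (\<lambda>\<beta>. gauss_risk n (J n) (\<pi> n) \<theta> (Q n \<theta>) (Y n \<theta> (-1) \<beta>));
           VG = (\<lambda>\<beta>. gauss_var n (J n) (\<pi> n) (Q n \<theta>) (Y n \<theta> 0 \<beta>));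
           err = C * (\<epsilon> + delta CARD('p) n (dn n) / \<epsilon>)
       in RG \<epsilon> - err \<le> R \<and> R \<le> RG (-\<epsilon>) + err \<and>
          VG (-\<epsilon>) - err \<le> V \<and> V \<le> VG \<epsilon> + err))"
proof -
  obtain K0 where K0: "0 \<le> K0" "\<And>n \<alpha>. \<alpha> \<in> multi_indices n \<Longrightarrow> norm (J n \<alpha>) \<le> K0"
    using coupling_bound[OF assms(7)] by blast
  define K where "K = K0 * real CARD('p \<Rightarrow> 'd) + 1"
  have K1: "1 \<le> K" using K0 by (simp add: K_def)
  \<comment> \<open>Below \<open>\<delta>0\<close> the smallness conditions of the comparison hold;
    \<open>C2\<close> is chosen for the opposite case, in which risks differ by at most \<open>8 *
    K\<^sup>2\<close>.\<close>
  define \<delta>0 where "\<delta>0 = 1 / (2 * K * (1 + sqrt lam))"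
  have \<delta>0: "0 < \<delta>0" using K1 assms(2) by (simp add: \<delta>0_def add_pos_pos)
  define C1 where "C1 = K\<^sup>2 * (2 / lam + 352 * comparison.A lam lams ^ 5 * K)"
  define C2 where "C2 = 8 * K\<^sup>2 / \<delta>0"
  have C2: "0 \<le> C2" using \<delta>0 by (simp add: C2_def)
  define C where "C = \<bar>C1\<bar> + C2"
  have "RG \<epsilon> - C * (\<epsilon> + delta CARD('p) n (dn n) / \<epsilon>) \<le> R \<and> R \<le> RG (-\<epsilon>) + C * (\<epsilon> + delta CARD('p) n (dn n) / \<epsilon>) \<and>
      VG (-\<epsilon>) - C * (\<epsilon> + delta CARD('p) n (dn n) / \<epsilon>) \<le> V \<and> V \<le> VG \<epsilon> + C * (\<epsilon> + delta CARD('p) n (dn n) / \<epsilon>)"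
    if \<epsilon>: "0 < \<epsilon>" "\<epsilon> < 1" and n: "1 \<le> n" and \<theta>: "\<theta> \<in> cube n"
      and R: "R = bern_risk lam lams n (dn n) (J n) (\<pi> n) \<theta>"
      and V: "V = bern_var lam lams n (dn n) (J n) (\<pi> n) \<theta>"
      and RG: "RG = (\<lambda>\<beta>. gauss_risk n (J n) (\<pi> n) \<theta> (Q n \<theta>) (Y n \<theta> (-1) \<beta>))"
      and VG: "VG = (\<lambda>\<beta>. gauss_var n (J n) (\<pi> n) (Q n \<theta>) (Y n \<theta> 0 \<beta>))"
    for \<epsilon> n \<theta> R V RG VG
  proof -
    let ?\<delta> = "delta CARD('p) n (dn n)"
    have Y: "continuous_gaussian_process (Q n \<theta>) (cube n)
        (gauss_mean lam lams a \<beta> n (J n) \<theta>) (gauss_cov lam \<beta> n (J n)) (Y n \<theta> a \<beta>)" if "a \<in> {-1, 0}" for a \<beta>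
      using gauss n \<theta> that by blast
    have \<delta>: "0 \<le> ?\<delta>" by (simp add: delta_def)
    interpret sparse_model n "\<pi> n" "J n" \<theta> K "dn n" lam lams "b_scale CARD('p) n (dn n)"
    proof
      show "prior_on_cube n (\<pi> n)" using assms(5) n by blast
      show "1 \<le> n" "\<theta> \<in> cube n" "0 \<le> K" using n \<theta> K1 by auto
      show "0 < dn n" "dn n < s_scale CARD('p) n" "0 < lam" "0 < lams" using assms n by auto
      show "bern_well_defined lam n (dn n) (J n)" "bern_well_defined lams n (dn n) (J n)"
        using assms(10) n by auto
      fix u :: "nat \<Rightarrow> real ^ 'd" and \<alpha> :: "'p \<Rightarrow> nat" assume u: "u \<in> cube n" "\<alpha> \<in> multi_indices n"
      have "\<bar>zfun n (J n) u \<alpha>\<bar> \<le> K0 * real CARD('p \<Rightarrow> 'd) * real n powr ((1 - real CARD('p)) / 2)"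
        by (rule zfun_bound[where J = "J n", OF u K0(2)[OF u(2)]])
      also have "\<dots> \<le> K * real n powr ((1 - real CARD('p)) / 2)"
        by (rule mult_right_mono) (simp_all add: K_def)
      finally show "\<bar>zfun n (J n) u \<alpha>\<bar> \<le> K * real n powr ((1 - real CARD('p)) / 2)" .
    qed (rule refl)
    show ?thesis
    proof (cases "?\<delta> \<le> \<delta>0")
      case True
      have K\<delta>0: "K * \<delta>0 = 1 / (2 * (1 + sqrt lam))" using K1 by (simp add: \<delta>0_def)
      have half: "1 / (2 * (1 + sqrt lam)) \<le> 1 / 2" "sqrt lam * (1 / (2 * (1 + sqrt lam))) \<le> 1 / 2"
        using assms(2) by (simp_all add: divide_simps add_pos_pos)
      have "K * ?\<delta> \<le> K * \<delta>0" "sqrt lam * (K * ?\<delta>) \<le> sqrt lam * (K * \<delta>0)"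
        using True K1 assms(2) by (auto intro!: mult_left_mono)
      then have "K * ?\<delta> \<le> 1 / 2" "sqrt lam * (K * ?\<delta>) \<le> 1 / 2"
        unfolding K\<delta>0 using half by (blast intro: order_trans)+
      then interpret dense_model n "\<pi> n" "J n" \<theta> K "dn n" lam lams "b_scale CARD('p) n (dn n)"
        by unfold_locales
      have "C1 * (\<epsilon> + ?\<delta> / \<epsilon>) \<le> C * (\<epsilon> + ?\<delta> / \<epsilon>)"
        using \<epsilon> \<delta> C2 by (intro mult_right_mono) (auto simp: C_def)
      then show ?thesis
        using dense_comparison[where Q = "Q n \<theta>" and Y = "Y n \<theta>", OF Y \<epsilon>(1) less_imp_le[OF \<epsilon>(2)]]
        unfolding R V RG VG C1_def by linarith
    next
      case False
      have "8 * K\<^sup>2 \<le> C * (\<epsilon> + ?\<delta> / \<epsilon>)"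
      proof -
        have "\<delta>0 * \<epsilon> \<le> \<delta>0 * 1" using \<epsilon> \<delta>0 by (intro mult_left_mono) auto
        then have "\<delta>0 \<le> ?\<delta> / \<epsilon>" using False \<epsilon> by (simp add: le_divide_eq)
        then have "C2 * \<delta>0 \<le> C * (\<epsilon> + ?\<delta> / \<epsilon>)"
          using C2 \<epsilon> \<delta>0 by (intro mult_mono) (auto simp: C_def)
        then show ?thesis using \<delta>0 by (simp add: C2_def)
      qed
      moreover have "\<bar>R\<bar> \<le> 4 * K\<^sup>2" "\<bar>V\<bar> \<le> 4 * K\<^sup>2"
        unfolding R V bern_risk_def bern_var_def
        by (rule expected_functional_bounds[OF prob_space_measure_pmf loglik_continuous])+
      moreover have "\<bar>RG \<beta>\<bar> \<le> 4 * K\<^sup>2" "\<bar>VG \<beta>\<bar> \<le> 4 * K\<^sup>2" for \<beta>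
      proof -
        have Q: "prob_space (Q n \<theta>)" using Y[of 0] by (simp add: continuous_gaussian_process_def gaussian_process_def)
        have cont: "continuous_on (cube n) (Y n \<theta> a \<beta> \<omega>)" if "a \<in> {-1, 0}" "\<omega> \<in> space (Q n \<theta>)" for a \<omega>
          using Y[OF that(1), of \<beta>] that(2) by (auto simp: continuous_gaussian_process_def)
        show "\<bar>RG \<beta>\<bar> \<le> 4 * K\<^sup>2"
          unfolding RG gauss_risk_def by (rule expected_functional_bounds(1)[OF Q cont]) simp_all
        show "\<bar>VG \<beta>\<bar> \<le> 4 * K\<^sup>2"
          unfolding VG gauss_var_def by (rule expected_functional_bounds(2)[OF Q cont]) simp_all
      qed
      moreover have "g - e \<le> r \<and> r \<le> g + e" if "\<bar>r\<bar> \<le> 4 * K\<^sup>2" "\<bar>g\<bar> \<le> 4 * K\<^sup>2" "8 * K\<^sup>2 \<le> e" for g r e :: real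
        using that by linarith
      ultimately show ?thesis by blast
    qed
  qed
  then show ?thesis unfolding Let_def by (intro exI[of _ C] exI[of _ 1]) auto
qed

end
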